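(* A net with no $\flat$-formulas in its conclusions is strongly indexable and sequentializable iff it is a proof net.
   Context: A net is a finite graph-like object whose nodes are links and whose directed edges are labelled by formulas or $\flat$-formulas, together with a set of boxes (each delimited by one of course link, its principal port, and pax links, its auxiliary ports, containing a net; boxes are disjoint or nested). Links: axiom (conclusions $A^\bot,A$), cut (premises $A,A^\bot$), one, bottom, tensor, par (conclusion $A\mathbin{⅋}B$), flat (premise $A$, conclusion $\flat A$), pax, why not (any number of premises $\flat A$, conclusion $?A$), of course, paragraph (premise $A$, conclusion $\S A$). An indexing is a map $I$ from edges to $\mathbb Z$ with equal index on both conclusions of an axiom and both premises of a cut, equal index on premises and conclusion of one, bottom, tensor, par, flat, pax, why not, of course links, and premise index $i+1$ when the conclusion of a paragraph link has index $i$; it is strong if all conclusions of the net get the same index. Sequentializable nets are defined inductively: the empty net, a single axiom, a single one link; the juxtaposition of two sequentializable nets; and the results of adding to sequentializable nets a cut between two of their conclusions $A,A^\bot$ from two different nets, a tensor on conclusions of two different nets, a bottom link, a par link on two conclusions of one net, a why not link on conclusions $\flat A,\ldots,\flat A$, a flat link, a paragraph link, or a box around a net with conclusions $\flat B_1,\ldots,\flat B_n,A$. A switching of a net is obtained from its underlying undirected graph by keeping exactly one premise of each par and why not link and collapsing each depth-zero box into a single node. A net is DR-correct if all its switchings are acyclic and the net inside each box is DR-correct. A DR-net is a DR-correct net with no $\flat$-formula among its conclusions. The $\mathbin{⅋}$-closure of a net with conclusions $A_1,\ldots,A_n$ is obtained by adding a tree of par links yielding the single conclusion $A_1\mathbin{⅋}\cdots\mathbin{⅋}A_n$.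 A cycle is balanced if it traverses paragraph links from premise to conclusion as many times as from conclusion to premise. A proof net is a DR-net whose $\mathbin{⅋}$-closure has all its cycles balanced. *)

theory Defs
  imports Main
begin

datatype 'a formula =
    Atom 'a
  | NegAtom 'a
  | One
  | Bottom
  | Tensor "'a formula" "'a formula"
  | Par "'a formula" "'a formula"
  | OfCourse "'a formula"
  | WhyNot "'a formula"
  | Paragraph "'a formula"

fun dual :: "'a formula \<Rightarrow> 'a formula" where
  "dual (Atom X) = NegAtom X"
| "dual (NegAtom X) = Atom X"
| "dual One = Bottom"
| "dual Bottom = One"
| "dual (Tensor A B) = Par (dual A) (dual B)"
| "dual (Par A B) = Tensor (dual A) (dual B)"
| "dual (OfCourse A) = WhyNot (dual A)"
| "dual (WhyNot A) = OfCourse (dual A)"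
| "dual (Paragraph A) = Paragraph (dual A)"

datatype 'a label = Formula "'a formula" | Flat "'a formula"

text \<open>An edge carries its label; the identifier distinguishes edges with equal labels.\<close>

datatype 'a edge = Edge (edge_id: nat) (label: "'a label")

text \<open>
  A link is given by its kind and its incident edges, premises before the conclusion. Since every
  link has an incident edge, and an edge of a net is a conclusion of one link and a premise of at
  most one link, distinct links of a net are distinct values of this type.
\<close>

datatype 'a link =
    AxLink "'a edge" "'a edge"
  | CutLink "'a edge" "'a edge"
  | OneLink "'a edge"
  | BottomLink "'a edge"
  | TensorLink "'a edge" "'a edge" "'a edge"
  | ParLink "'a edge" "'a edge" "'a edge"
  | FlatLink "'a edge" "'a edge"
  | PaxLink "'a edge" "'a edge"
  | WhyNotLink "'a edge set" "'a edge"
  | OfCourseLink "'a edge" "'a edge"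
  | ParagraphLink "'a edge" "'a edge"

fun prems :: "'a link \<Rightarrow> 'a edge set" where
  "prems (AxLink c d) = {}"
| "prems (CutLink a b) = {a, b}"
| "prems (OneLink c) = {}"
| "prems (BottomLink c) = {}"
| "prems (TensorLink a b c) = {a, b}"
| "prems (ParLink a b c) = {a, b}"
| "prems (FlatLink a c) = {a}"
| "prems (PaxLink a c) = {a}"
| "prems (WhyNotLink E c) = E"
| "prems (OfCourseLink a c) = {a}"
| "prems (ParagraphLink a c) = {a}"

fun concs :: "'a link \<Rightarrow> 'a edge set" where
  "concs (AxLink c d) = {c, d}"
| "concs (CutLink a b) = {}"
| "concs (OneLink c) = {c}"
| "concs (BottomLink c) = {c}"
| "concs (TensorLink a b c) = {c}"
| "concs (ParLink a b c) = {c}"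
| "concs (FlatLink a c) = {c}"
| "concs (PaxLink a c) = {c}"
| "concs (WhyNotLink E c) = {c}"
| "concs (OfCourseLink a c) = {c}"
| "concs (ParagraphLink a c) = {c}"

text \<open>The two premises of a tensor or par link must be different edges; for the two conclusions of
  an axiom and the two premises of a cut this is forced by the labels.\<close>

fun typed :: "'a link \<Rightarrow> bool" where
  "typed (AxLink c d) \<longleftrightarrow> (\<exists>A. label c = Formula (dual A) \<and> label d = Formula A)"
| "typed (CutLink a b) \<longleftrightarrow> (\<exists>A. label a = Formula A \<and> label b = Formula (dual A))"
| "typed (OneLink c) \<longleftrightarrow> label c = Formula One"
| "typed (BottomLink c) \<longleftrightarrow> label c = Formula Bottom"
| "typed (TensorLink a b c) \<longleftrightarrow> a \<noteq> b \<and>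
     (\<exists>A B. label a = Formula A \<and> label b = Formula B \<and> label c = Formula (Tensor A B))"
| "typed (ParLink a b c) \<longleftrightarrow> a \<noteq> b \<and>
     (\<exists>A B. label a = Formula A \<and> label b = Formula B \<and> label c = Formula (Par A B))"
| "typed (FlatLink a c) \<longleftrightarrow> (\<exists>A. label a = Formula A \<and> label c = Flat A)"
| "typed (PaxLink a c) \<longleftrightarrow> (\<exists>A. label a = Flat A \<and> label c = Flat A)"
| "typed (WhyNotLink E c) \<longleftrightarrow> finite E \<and>
     (\<exists>A. (\<forall>a\<in>E. label a = Flat A) \<and> label c = Formula (WhyNot A))"
| "typed (OfCourseLink a c) \<longleftrightarrow> (\<exists>A. label a = Formula A \<and> label c = Formula (OfCourse A))"
| "typed (ParagraphLink a c) \<longleftrightarrow> (\<exists>A. label a = Formula A \<and> label c = Formula (Paragraph A))"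

text \<open>The content of a box does not include its ports.\<close>

datatype 'a box = Box (principal: "'a link") (auxiliary: "'a link set") (content: "'a link set")

definition ports :: "'a box \<Rightarrow> 'a link set" where
  "ports b = insert (principal b) (auxiliary b)"

definition box_links :: "'a box \<Rightarrow> 'a link set" where
  "box_links b = ports b \<union> content b"

datatype 'a net = Net (links: "'a link set") (boxes: "'a box set")

definition edges_of :: "'a link set \<Rightarrow> 'a edge set" where
  "edges_of L = \<Union>(prems ` L) \<union> \<Union>(concs ` L)"

definition conclusions_of :: "'a link set \<Rightarrow> 'a edge set" where
  "conclusions_of L = edges_of L - \<Union>(prems ` L)"

abbreviation edges :: "'a net \<Rightarrow> 'a edge set" where
  "edges N \<equiv> edges_of (links N)"

abbreviation conclusions :: "'a net \<Rightarrow> 'a edge set" where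
  "conclusions N \<equiv> conclusions_of (links N)"

definition net_graph :: "'a link set \<Rightarrow> bool" where
  "net_graph L \<longleftrightarrow> finite L \<and> (\<forall>l\<in>L. typed l) \<and>
     (\<forall>e\<in>edges_of L. \<exists>!l. l \<in> L \<and> e \<in> concs l) \<and>
     (\<forall>l\<in>L. \<forall>m\<in>L. prems l \<inter> prems m \<noteq> {} \<longrightarrow> l = m)"

definition delimits_box :: "'a link set \<Rightarrow> 'a box \<Rightarrow> bool" where
  "delimits_box L b \<longleftrightarrow> box_links b \<subseteq> L \<and>
     (\<exists>a c. principal b = OfCourseLink a c) \<and>
     (\<forall>l\<in>auxiliary b. \<exists>a c. l = PaxLink a c) \<and>
     ports b \<inter> content b = {} \<and>
     net_graph (content b) \<and>
     conclusions_of (content b) = \<Union>(prems ` ports b)"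

definition is_net :: "'a net \<Rightarrow> bool" where
  "is_net N \<longleftrightarrow> net_graph (links N) \<and>
     (\<forall>b\<in>boxes N. delimits_box (links N) b) \<and>
     (\<forall>a c. OfCourseLink a c \<in> links N \<longrightarrow> (\<exists>!b. b \<in> boxes N \<and> OfCourseLink a c = principal b)) \<and>
     (\<forall>a c. PaxLink a c \<in> links N \<longrightarrow> (\<exists>!b. b \<in> boxes N \<and> PaxLink a c \<in> auxiliary b)) \<and>
     (\<forall>b\<in>boxes N. \<forall>b'\<in>boxes N. b \<noteq> b' \<longrightarrow>
        box_links b \<inter> box_links b' = {} \<or>
        box_links b \<subseteq> content b' \<or> box_links b' \<subseteq> content b)"

definition flat_free_conclusions :: "'a net \<Rightarrow> bool" where
  "flat_free_conclusions N \<longleftrightarrow> (\<forall>e\<in>conclusions N. \<exists>A. label e = Formula A)"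

definition box_net :: "'a net \<Rightarrow> 'a box \<Rightarrow> 'a net" where
  "box_net N b = Net (content b) {c \<in> boxes N. box_links c \<subseteq> content b}"

fun index_constraint :: "('a edge \<Rightarrow> int) \<Rightarrow> 'a link \<Rightarrow> bool" where
  "index_constraint I (ParagraphLink a c) \<longleftrightarrow> I a = I c + 1"
| "index_constraint I l \<longleftrightarrow> (\<forall>e \<in> prems l \<union> concs l. \<forall>e' \<in> prems l \<union> concs l. I e = I e')"

definition indexing :: "'a net \<Rightarrow> ('a edge \<Rightarrow> int) \<Rightarrow> bool" where
  "indexing N I \<longleftrightarrow> (\<forall>l\<in>links N. index_constraint I l)"

definition strong_indexing :: "'a net \<Rightarrow> ('a edge \<Rightarrow> int) \<Rightarrow> bool" where
  "strong_indexing N I \<longleftrightarrow> indexing N I \<and> (\<forall>e\<in>conclusions N. \<forall>e'\<in>conclusions N. I e = I e')"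

definition strongly_indexable :: "'a net \<Rightarrow> bool" where
  "strongly_indexable N \<longleftrightarrow> (\<exists>I. strong_indexing N I)"

definition juxtapose :: "'a net \<Rightarrow> 'a net \<Rightarrow> 'a net" where
  "juxtapose M N = Net (links M \<union> links N) (boxes M \<union> boxes N)"

definition add_link :: "'a link \<Rightarrow> 'a net \<Rightarrow> 'a net" where
  "add_link l N = Net (insert l (links N)) (boxes N)"

text \<open>In the box rule, \<open>E\<close> is the set of edges labelled \<open>\<flat>B\<^sub>1, \<dots>, \<flat>B\<^sub>n\<close>, and \<open>f\<close> gives for each of
  them the conclusion of the pax link placed below it.\<close>

inductive sequentializable :: "'a net \<Rightarrow> bool" where
  empty: "sequentializable (Net {} {})"
| ax: "typed (AxLink c d) \<Longrightarrow> sequentializable (Net {AxLink c d} {})"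
| one: "typed (OneLink c) \<Longrightarrow> sequentializable (Net {OneLink c} {})"
| juxtaposition:
    "\<lbrakk>sequentializable M; sequentializable N; edges M \<inter> edges N = {}\<rbrakk>
     \<Longrightarrow> sequentializable (juxtapose M N)"
| cut:
    "\<lbrakk>sequentializable M; sequentializable N; edges M \<inter> edges N = {};
      a \<in> conclusions M; b \<in> conclusions N; typed (CutLink a b)\<rbrakk>
     \<Longrightarrow> sequentializable (add_link (CutLink a b) (juxtapose M N))"
| tensor:
    "\<lbrakk>sequentializable M; sequentializable N; edges M \<inter> edges N = {};
      a \<in> conclusions M; b \<in> conclusions N; c \<notin> edges M \<union> edges N; typed (TensorLink a b c)\<rbrakk>
     \<Longrightarrow> sequentializable (add_link (TensorLink a b c) (juxtapose M N))"
| bottom: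
    "\<lbrakk>sequentializable N; c \<notin> edges N; typed (BottomLink c)\<rbrakk>
     \<Longrightarrow> sequentializable (add_link (BottomLink c) N)"
| par:
    "\<lbrakk>sequentializable N; a \<in> conclusions N; b \<in> conclusions N; c \<notin> edges N;
      typed (ParLink a b c)\<rbrakk>
     \<Longrightarrow> sequentializable (add_link (ParLink a b c) N)"
| why_not:
    "\<lbrakk>sequentializable N; E \<subseteq> conclusions N; c \<notin> edges N; typed (WhyNotLink E c)\<rbrakk>
     \<Longrightarrow> sequentializable (add_link (WhyNotLink E c) N)"
| flat:
    "\<lbrakk>sequentializable N; a \<in> conclusions N; c \<notin> edges N; typed (FlatLink a c)\<rbrakk>
     \<Longrightarrow> sequentializable (add_link (FlatLink a c) N)"
| para:
    "\<lbrakk>sequentializable N; a \<in> conclusions N; c \<notin> edges N; typed (ParagraphLink a c)\<rbrakk>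
     \<Longrightarrow> sequentializable (add_link (ParagraphLink a c) N)"
| box:
    "\<lbrakk>sequentializable N; conclusions N = insert a E;
      c \<notin> edges N; typed (OfCourseLink a c);
      inj_on f E; f ` E \<inter> edges N = {}; c \<notin> f ` E; \<forall>e\<in>E. typed (PaxLink e (f e));
      p = OfCourseLink a c; P = (\<lambda>e. PaxLink e (f e)) ` E\<rbrakk>
     \<Longrightarrow> sequentializable (Net (insert p P \<union> links N) (insert (Box p P (links N)) (boxes N)))"

text \<open>
  An undirected multigraph is given by a set of triples \<open>(u, e, v)\<close>, the edge \<open>e\<close> joining \<open>u\<close> and
  \<open>v\<close>; isolated nodes and edges with a free end are left out, being on no cycle. A cycle is listed
  by its successive steps, the last one returning to the source of the first; it repeats neither
  nodes nor edges, but may consist of one loop or of two parallel edges.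
\<close>

definition step_source :: "'v \<times> 'e \<times> 'v \<Rightarrow> 'v" where "step_source = fst"
definition step_edge :: "'v \<times> 'e \<times> 'v \<Rightarrow> 'e" where "step_edge = fst \<circ> snd"
definition step_target :: "'v \<times> 'e \<times> 'v \<Rightarrow> 'v" where "step_target = snd \<circ> snd"

definition cycle :: "('v \<times> 'e \<times> 'v) set \<Rightarrow> ('v \<times> 'e \<times> 'v) list \<Rightarrow> bool" where
  "cycle G p \<longleftrightarrow> p \<noteq> [] \<and>
     (\<forall>(u, e, v) \<in> set p. (u, e, v) \<in> G \<or> (v, e, u) \<in> G) \<and>
     (\<forall>i < length p. step_target (p ! i) = step_source (p ! (Suc i mod length p))) \<and>
     distinct (map step_source p) \<and> distinct (map step_edge p)"

definition outermost_boxes :: "'a net \<Rightarrow> 'a box set" where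
  "outermost_boxes N = {b \<in> boxes N. \<forall>b'\<in>boxes N. \<not> box_links b \<subseteq> content b'}"

datatype 'a node = LinkNode "'a link" | BoxNode "'a box"

fun collapses_to :: "'a net \<Rightarrow> 'a link \<Rightarrow> 'a node \<Rightarrow> bool" where
  "collapses_to N l (LinkNode k) \<longleftrightarrow> k = l \<and> l \<in> links N \<and> (\<forall>b\<in>boxes N. l \<notin> box_links b)"
| "collapses_to N l (BoxNode b) \<longleftrightarrow> b \<in> outermost_boxes N \<and> l \<in> box_links b"

fun switched :: "'a link \<Rightarrow> bool" where
  "switched (ParLink a b c) = True"
| "switched (WhyNotLink E c) = True"
| "switched _ = False"

definition switching_choice :: "'a net \<Rightarrow> ('a link \<Rightarrow> 'a edge) \<Rightarrow> bool" where
  "switching_choice N s \<longleftrightarrow>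
     (\<forall>l\<in>links N. switched l \<and> prems l \<noteq> {} \<longrightarrow> s l \<in> prems l)"

definition switching :: "'a net \<Rightarrow> ('a link \<Rightarrow> 'a edge) \<Rightarrow> ('a node \<times> 'a edge \<times> 'a node) set" where
  "switching N s =
     {(x, e, y). (\<exists>l m. collapses_to N l x \<and> collapses_to N m y \<and>
                        e \<in> concs l \<and> e \<in> prems m \<and> (switched m \<longrightarrow> e = s m)) \<and>
                 \<not> (\<exists>b. x = BoxNode b \<and> y = BoxNode b)}"

inductive DR_correct :: "'a net \<Rightarrow> bool" where
  "\<lbrakk>\<And>s. switching_choice N s \<Longrightarrow> \<nexists>p. cycle (switching N s) p;
    \<And>b. b \<in> boxes N \<Longrightarrow> DR_correct (box_net N b)\<rbrakk>
   \<Longrightarrow> DR_correct N"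

definition DR_net :: "'a net \<Rightarrow> bool" where
  "DR_net N \<longleftrightarrow> is_net N \<and> DR_correct N \<and> flat_free_conclusions N"

text \<open>The \<open>\<parr>\<close>-closure is determined up to the shape of the tree of par links and the names of the
  added edges. A net with at most one conclusion is its own closure.\<close>

inductive par_closure :: "'a net \<Rightarrow> 'a net \<Rightarrow> bool" where
  closed: "\<forall>e\<in>conclusions N. \<forall>e'\<in>conclusions N. e = e' \<Longrightarrow> par_closure N N"
| step:
    "\<lbrakk>a \<in> conclusions N; b \<in> conclusions N; c \<notin> edges N; typed (ParLink a b c);
      par_closure (add_link (ParLink a b c) N) C\<rbrakk>
     \<Longrightarrow> par_closure N C"

definition underlying_graph :: "'a net \<Rightarrow> ('a link \<times> 'a edge \<times> 'a link) set" where
  "underlying_graph N = {(l, e, m). l \<in> links N \<and> m \<in> links N \<and> e \<in> concs l \<and> e \<in> prems m}"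

text \<open>The positions at which a cycle enters a paragraph link by its premise and leaves it by its
  conclusion; then the other way round.\<close>

definition downward_traversals :: "('a link \<times> 'a edge \<times> 'a link) list \<Rightarrow> nat set" where
  "downward_traversals p = {i. i < length p \<and>
     step_target (p ! i) =
       ParagraphLink (step_edge (p ! i)) (step_edge (p ! (Suc i mod length p)))}"

definition upward_traversals :: "('a link \<times> 'a edge \<times> 'a link) list \<Rightarrow> nat set" where
  "upward_traversals p = {i. i < length p \<and>
     step_target (p ! i) =
       ParagraphLink (step_edge (p ! (Suc i mod length p))) (step_edge (p ! i))}"

definition balanced :: "('a link \<times> 'a edge \<times> 'a link) list \<Rightarrow> bool" where
  "balanced p \<longleftrightarrow> card (downward_traversals p) = card (upward_traversals p)"

definition proof_net :: "'a net \<Rightarrow> bool" where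
  "proof_net N \<longleftrightarrow> DR_net N \<and>
     (\<exists>C. par_closure N C \<and> (\<forall>p. cycle (underlying_graph C) p \<longrightarrow> balanced p))"

end

theory Submission
  imports Defs
begin

text \<open>
  The switching graphs at depth zero are handled as one graph in which two premises of the same
  par or why not link form a cusp: the switchings are acyclic iff every cycle has a cusp. As in
  Yeo's theorem, a strict order on the edges, given by cusp-free paths that no cusp-free
  continuation can meet again, has a maximal element; its target is a terminal link which either is
  a par-like link or separates the graph. Peeling off such a link sequentializes the net.

  For the indexings, the \<open>\<section>\<close>-links put weights on the edges of the underlying graph, an
  indexing is a potential for these weights, and a potential exists iff every cycle has weight zero,
  i.e. is balanced. The \<open>\<parr>\<close>-closure forces the conclusions to have equal indices.
\<close>

section \<open>Paths, cycles and potentials in multigraphs\<close>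

text \<open>A terminal tensor or cut need not separate the graph, and its rule applies only if it
  does; the order on directed steps serves to find one that does. A step fails to be maximal for one
  of two reasons. If an edge leaves its target, that edge lies above it, because a return would
  close a cusp-free cycle. If its target has no cusp but some cycle passes through the step, take
  such a cycle with the fewest cusps: the step into its first cusp lies above, since any return to
  the cycle yields a cycle with fewer cusps or a cusp-free one. Boxes collapse to nodes that no edge
  of the depth-zero graph enters, so they never stand at the end of a maximal step; a box is opened
  only when it is all that is left. On the side of the indexings the potential lives on links: its
  value at a link is the index of the conclusions, and the premises lie higher by one exactly at a
  paragraph link. With this choice the two conclusions of an axiom agree automatically.\<close>

definition rev_step :: "'v \<times> 'e \<times> 'v \<Rightarrow> 'v \<times> 'e \<times> 'v" where
  "rev_step s = (step_target s, step_edge s, step_source s)"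

lemma step_simps [simp]:
  "step_source (u, e, v) = u" "step_edge (u, e, v) = e" "step_target (u, e, v) = v"
  "step_source (rev_step s) = step_target s" "step_edge (rev_step s) = step_edge s"
  "step_target (rev_step s) = step_source s" "rev_step (rev_step s) = s"
  "rev_step (u, e, v) = (v, e, u)"
  by (simp_all add: step_source_def step_edge_def step_target_def rev_step_def)

definition sym_steps :: "('v \<times> 'e \<times> 'v) set \<Rightarrow> ('v \<times> 'e \<times> 'v) set" where
  "sym_steps G = {s. s \<in> G \<or> rev_step s \<in> G}"

lemma rev_step_sym_steps [simp]: "rev_step s \<in> sym_steps G \<longleftrightarrow> s \<in> sym_steps G"
  by (auto simp: sym_steps_def)

text \<open>In a net an edge has one concluding link and at most one link using it, so the edge
  determines the triple; a traversal is then known, up to direction, by its edge.\<close>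

definition edge_determined :: "('v \<times> 'e \<times> 'v) set \<Rightarrow> bool" where
  "edge_determined G \<longleftrightarrow> inj_on step_edge G"

lemma sym_steps_same_edge:
  assumes "edge_determined G" "s \<in> sym_steps G" "t \<in> sym_steps G" "step_edge s = step_edge t"
  shows "s = t \<or> s = rev_step t"
proof -
  have 1: "x = y" if "x \<in> G" "y \<in> G" "step_edge x = step_edge y" for x y
    using assms(1) that by (auto simp: edge_determined_def inj_on_def)
  show ?thesis
    using 1[of s t] 1[of "rev_step s" t] 1[of s "rev_step t"] 1[of "rev_step s" "rev_step t"]
      assms(2-4) step_simps(7)
    by (auto simp: sym_steps_def) (metis step_simps(7))+
qed

abbreviation linked :: "'v \<times> 'e \<times> 'v \<Rightarrow> 'v \<times> 'e \<times> 'v \<Rightarrow> bool" where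
  "linked s t \<equiv> step_target s = step_source t"

definition closed_chain :: "('s \<Rightarrow> 's \<Rightarrow> bool) \<Rightarrow> 's list \<Rightarrow> bool" where
  "closed_chain R p \<longleftrightarrow> p \<noteq> [] \<and> successively R p \<and> R (last p) (hd p)"

lemma closed_chain_rotate: "closed_chain R (xs @ ys) \<Longrightarrow> closed_chain R (ys @ xs)"
  by (cases "xs = []"; cases "ys = []") (auto simp: closed_chain_def successively_append_iff)

lemma closed_chain_mono:
  "closed_chain R p \<Longrightarrow> (\<And>s t. R s t \<Longrightarrow> Q s t) \<Longrightarrow> closed_chain Q p"
  by (auto simp: closed_chain_def intro: successively_mono)

lemma successively_iff_nth:
  "successively R p \<longleftrightarrow> (\<forall>i. Suc i < length p \<longrightarrow> R (p ! i) (p ! Suc i))"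
proof (induction p)
  case (Cons x p)
  then show ?case
    by (cases p) (auto simp: nth_Cons' less_Suc_eq_0_disj)
qed simp

lemma closed_chain_iff_nth:
  "closed_chain R p \<longleftrightarrow> p \<noteq> [] \<and> (\<forall>i < length p. R (p ! i) (p ! (Suc i mod length p)))"
proof (cases "p = []")
  case False
  have *: "(\<forall>i < length p. Q i) \<longleftrightarrow> (\<forall>i. Suc i < length p \<longrightarrow> Q i) \<and> Q (length p - 1)" for Q
  proof -
    have "i < length p \<longleftrightarrow> Suc i < length p \<or> i = length p - 1" for i
      using False by (cases p) auto
    then show ?thesis by blast
  qed
  show ?thesis
    using False unfolding closed_chain_def successively_iff_nth *
    by (auto simp: last_conv_nth hd_conv_nth)
qed (simp add: closed_chain_def)

lemma cycle_iff_closed_chain: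
  "cycle G p \<longleftrightarrow> set p \<subseteq> sym_steps G \<and> closed_chain linked p \<and>
     distinct (map step_source p) \<and> distinct (map step_edge p)"
proof -
  have "(\<forall>(u, e, v) \<in> set p. (u, e, v) \<in> G \<or> (v, e, u) \<in> G) \<longleftrightarrow> set p \<subseteq> sym_steps G"
    by (force simp: sym_steps_def)
  then show ?thesis
    by (auto simp: cycle_def closed_chain_iff_nth)
qed

lemma cycle_mono: "cycle G p \<Longrightarrow> G \<subseteq> H \<Longrightarrow> cycle H p"
  unfolding cycle_def by fast

lemma cycle_rotate: "cycle G (xs @ ys) \<Longrightarrow> cycle G (ys @ xs)"
  by (auto simp: cycle_iff_closed_chain intro: closed_chain_rotate)

text \<open>Sources shifted by one position; in particular distinct sources give distinct
  targets.\<close>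

lemma closed_chain_targets:
  assumes "closed_chain linked p"
  shows "map step_target p = rotate1 (map step_source p)"
proof -
  have "map step_target (x # p) = map step_source p @ [step_target (last (x # p))]"
    if "successively linked (x # p)" for x and p :: "('a \<times> 'b \<times> 'a) list"
    using that by (induction p arbitrary: x) auto
  then show ?thesis
    using assms by (cases p) (auto simp: closed_chain_def)
qed

lemma chain_vertices:
  assumes "successively linked p" "p \<noteq> []"
  shows "map step_source p @ [step_target (last p)] = step_source (hd p) # map step_target p"
  using assms by (induction p) (auto simp: successively_Cons)

section \<open>Simple paths and connectedness\<close>

inductive spath :: "('v \<times> 'e \<times> 'v) set \<Rightarrow> 'v \<Rightarrow> ('v \<times> 'e \<times> 'v) list \<Rightarrow> 'v \<Rightarrow> bool" for H where
  Nil: "spath H u [] u"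
| Cons: "\<lbrakk>s \<in> sym_steps H; spath H (step_target s) p v;
    step_source s \<notin> insert v (step_source ` set p)\<rbrakk> \<Longrightarrow> spath H (step_source s) (s # p) v"

text \<open>Cuts off a loop: when a walk comes back to a vertex of the path, the path is restarted
  from there.\<close>

lemma spath_suffix:
  assumes "spath H x p v" "u \<in> insert v (step_source ` set p)"
  shows "\<exists>p'. spath H u p' v"
  using assms by induction (auto intro: spath.intros)

lemma spath_props:
  assumes "spath H u p v"
  shows "set p \<subseteq> sym_steps H" "successively linked p" "distinct (map step_source p)"
    "v \<notin> step_source ` set p" "p \<noteq> [] \<Longrightarrow> step_source (hd p) = u"
    "p \<noteq> [] \<Longrightarrow> step_target (last p) = v" "p = [] \<Longrightarrow> u = v"
    "step_target ` set p \<subseteq> insert v (step_source ` set p)"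
    "u \<in> insert v (step_source ` set p)"
  using assms by (induction) (auto simp: successively_Cons)

text \<open>An edge used again, in either direction, would bring the path back to the source of its
  first use, which \<open>spath\<close> forbids.\<close>

lemma spath_distinct_edges:
  assumes "edge_determined H" "spath H u p v"
  shows "distinct (map step_edge p)"
  using assms(2)
proof induction
  case (Cons s p v)
  have "step_edge s \<noteq> step_edge t" if "t \<in> set p" for t
  proof
    assume "step_edge s = step_edge t"
    then have "t = s \<or> t = rev_step s"
      using sym_steps_same_edge[OF assms(1), of t s] Cons.hyps spath_props(1)[OF Cons.hyps(2)] that
      by auto
    then show False
    proof
      assume "t = s"
      then show False using that Cons.hyps(3) by blast
    next
      assume "t = rev_step s"
      then have "step_source s = step_target t" by simp
      then show False using that Cons.hyps(3) spath_props(8)[OF Cons.hyps(2)] by blast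
    qed
  qed
  then show ?case
    using Cons.IH by auto
qed simp

definition adjacent_in :: "('v \<times> 'e \<times> 'v) set \<Rightarrow> ('v \<times> 'v) set" where
  "adjacent_in H = {(step_source s, step_target s) |s. s \<in> sym_steps H}"

lemma adjacent_in_sym: "(u, v) \<in> adjacent_in H \<Longrightarrow> (v, u) \<in> adjacent_in H"
  unfolding adjacent_in_def by (smt (verit) mem_Collect_eq prod.inject rev_step_sym_steps step_simps(4,6))

lemma connected_sym: "(u, v) \<in> (adjacent_in H)\<^sup>* \<Longrightarrow> (v, u) \<in> (adjacent_in H)\<^sup>*"
  by (meson adjacent_in_sym sym_def sym_rtrancl)

lemma connected_imp_spath:
  assumes "(u, v) \<in> (adjacent_in H)\<^sup>*"
  shows "\<exists>p. spath H u p v"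
  using assms
proof (induction rule: converse_rtrancl_induct)
  case base
  then show ?case by (auto intro: spath.Nil)
next
  case (step x y)
  then obtain s p where s: "s \<in> sym_steps H" "x = step_source s" "y = step_target s" "spath H y p v"
    unfolding adjacent_in_def by blast
  show ?case
  proof (cases "x \<in> insert v (step_source ` set p)")
    case True
    then show ?thesis using spath_suffix[OF s(4)] by simp
  next
    case False
    then show ?thesis using s(1-4) spath.Cons[of s H p v] by auto
  qed
qed

lemma spath_close_cycle:
  assumes "edge_determined H" "spath H (step_target s) p (step_source s)" 
    and "step_edge s \<notin> step_edge ` set p" "s \<in> sym_steps G" "H \<subseteq> G"
  shows "cycle G (s # p)"
proof -
  note p = spath_props[OF assms(2)]
  have "sym_steps H \<subseteq> sym_steps G"
    using assms(5) by (auto simp: sym_steps_def)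
  then show ?thesis
    using p assms(3,4) spath_distinct_edges[OF assms(1,2)]
    unfolding cycle_iff_closed_chain closed_chain_def
    by (cases "p = []") (auto simp: successively_Cons)
qed

text \<open>Edges are inserted one by one. An edge within a component of the earlier ones closes a
  cycle, whose zero weight says that its equation already holds; an edge between two components is
  accommodated by shifting the potential on one of them.\<close>

lemma potential_exists:
  fixes G :: "('v \<times> 'e \<times> 'v) set" and w :: "'v \<times> 'e \<times> 'v \<Rightarrow> int"
  assumes fin: "finite G" and det: "edge_determined G"
    and bal: "\<And>p. cycle G p \<Longrightarrow> (\<Sum>s\<leftarrow>p. if s \<in> G then w s else - w (rev_step s)) = 0"
  shows "\<exists>J. \<forall>s\<in>G. J (step_target s) - J (step_source s) = w s"
proof -
  let ?wt = "\<lambda>s. if s \<in> G then w s else - w (rev_step s)"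
  have "\<exists>J. \<forall>s\<in>H. J (step_target s) - J (step_source s) = w s" if "H \<subseteq> G" for H
    using finite_subset[OF that fin] that
  proof (induction H rule: finite_induct)
    case (insert g H)
    then obtain J where J: "\<forall>s\<in>H. J (step_target s) - J (step_source s) = w s"
      by auto
    have detH: "edge_determined H"
      using det insert.prems unfolding edge_determined_def inj_on_def by blast
    let ?R = "(adjacent_in H)\<^sup>*"
    show ?case
    proof (cases "(step_target g, step_source g) \<in> ?R")
      case True
      obtain p where p: "spath H (step_target g) p (step_source g)"
        using connected_imp_spath[OF True] by blast
      have "step_edge g \<notin> step_edge ` set p"
      proof
        assume "step_edge g \<in> step_edge ` set p"
        then obtain t where t: "t \<in> set p" "step_edge t = step_edge g" by auto
        then have "t \<in> H \<or> rev_step t \<in> H"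
          using spath_props(1)[OF p] by (auto simp: sym_steps_def)
        then have "g \<in> H"
          using det insert.prems t(2) unfolding edge_determined_def inj_on_def
          by (metis insert_subset step_simps(5) subsetD)
        then show False using insert.hyps by simp
      qed
      then have "cycle G (g # p)"
        using spath_close_cycle[OF detH p] insert.prems by (auto simp: sym_steps_def)
      then have 0: "w g + (\<Sum>s\<leftarrow>p. ?wt s) = 0"
        using bal insert.prems by force
      have wt: "?wt s = J (step_target s) - J (step_source s)" if "s \<in> sym_steps H" for s
      proof (cases "s \<in> H")
        case True
        then show ?thesis using J insert.prems by auto
      next
        case False
        then have r: "rev_step s \<in> H" using that by (auto simp: sym_steps_def)
        then have "s \<notin> G"
          using False det insert.prems unfolding edge_determined_def inj_on_def
          by (metis insert_subset step_simps(5) subsetD)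
        then show ?thesis using J r by force
      qed
      \<comment> \<open>Along a path the weights telescope.\<close>
      have "(\<Sum>s\<leftarrow>p. ?wt s) = J v - J u" if "spath H u p v" for u v p
        using that by induction (simp_all add: wt del: split_paired_All)
      from this[OF p] 0 have "J (step_target g) - J (step_source g) = w g"
        by linarith
      then show ?thesis using J by (intro exI[of _ J]) simp
    next
      case False
      \<comment> \<open>The component of the target of \<open>g\<close> moves by the constant that
        makes the equation for \<open>g\<close> true. Edges of \<open>H\<close> stay within a
        component, so their equations survive.\<close>
      define J' where "J' x = (if (step_target g, x) \<in> ?R
        then J x + (J (step_source g) + w g - J (step_target g)) else J x)" for x
      have "J' (step_target s) - J' (step_source s) = w s" if "s \<in> H" for s
      proof -
        have "(step_source s, step_target s) \<in> ?R" "(step_target s, step_source s) \<in> ?R"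
          using that adjacent_in_sym[of "step_source s" "step_target s" H]
          unfolding adjacent_in_def sym_steps_def by blast+
        then have "(step_target g, step_source s) \<in> ?R \<longleftrightarrow> (step_target g, step_target s) \<in> ?R"
          by (meson rtrancl_trans)
        then show ?thesis
          using bspec[OF J that] by (simp add: J'_def)
      qed
      moreover have "J' (step_target g) - J' (step_source g) = w g"
        using False by (simp add: J'_def)
      ultimately show ?thesis by (intro exI[of _ J']) simp
    qed
  qed simp
  then show ?thesis by blast
qed

section \<open>Graphs with cusps\<close>

lemma image_Int_empty_iff: "A \<inter> g ` B = {} \<longleftrightarrow> (\<forall>y\<in>B. g y \<notin> A)"
  by auto

lemma insert_Int_subset: "A = insert w B \<Longrightarrow> C \<inter> B = {} \<Longrightarrow> A \<inter> C \<subseteq> {w}"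
  by blast

lemma disjoint_insert_subset: "A = insert x B \<Longrightarrow> B \<inter> C = {} \<Longrightarrow> D \<subseteq> C \<Longrightarrow> x \<notin> D \<Longrightarrow> A \<inter> D = {}"
  by blast

lemma disjoint_subset: "C \<inter> D = {} \<Longrightarrow> C' \<subseteq> C \<Longrightarrow> C' \<inter> D = {}"
  by blast

lemma meets_only_disjoint: "A \<inter> C \<subseteq> {w} \<Longrightarrow> D \<subseteq> C \<Longrightarrow> w \<notin> D \<Longrightarrow> A \<inter> D = {}"
  by blast

text \<open>\<open>cusp v\<close> is a partial equivalence on the edges that enter \<open>v\<close>;
  for nets it relates the premises of one switched link. Transitivity lets one member of a cusp be
  exchanged for another.\<close>

locale cusped_graph =
  fixes G :: "('v \<times> 'e \<times> 'v) set" and cusp :: "'v \<Rightarrow> 'e \<Rightarrow> 'e \<Rightarrow> bool"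
  assumes finite_graph: "finite G"
    and determined: "edge_determined G"
    and no_loop: "(u, e, u) \<notin> G"
    and cusp_sym: "cusp v e e' \<Longrightarrow> cusp v e' e"
    and cusp_trans: "cusp v e e' \<Longrightarrow> cusp v e' e'' \<Longrightarrow> cusp v e e''"
    and cusp_incoming: "cusp v e e' \<Longrightarrow> \<exists>u. (u, e, v) \<in> G"
begin

definition follows :: "'v \<times> 'e \<times> 'v \<Rightarrow> 'v \<times> 'e \<times> 'v \<Rightarrow> bool" where
  "follows s t \<longleftrightarrow> step_target s = step_source t \<and> step_edge s \<noteq> step_edge t"

definition adm :: "'v \<times> 'e \<times> 'v \<Rightarrow> 'v \<times> 'e \<times> 'v \<Rightarrow> bool" where
  "adm s t \<longleftrightarrow> follows s t \<and> \<not> cusp (step_target s) (step_edge s) (step_edge t)"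

lemma adm_rev: "adm (rev_step t) (rev_step s) \<longleftrightarrow> adm s t"
  by (auto simp: adm_def follows_def dest: cusp_sym)

lemma adm_linked: "successively adm p \<Longrightarrow> successively linked p"
  by (erule successively_mono) (auto simp: adm_def follows_def)

lemma adm_follows: "successively adm p \<Longrightarrow> successively follows p"
  by (erule successively_mono) (auto simp: adm_def)

text \<open>The edges of a cusp enter its vertex, so a step running into the vertex along one of
  them has the direction of the edge; the opposite direction would make the edge a loop.\<close>

lemma cusp_step_in_graph:
  assumes "s \<in> sym_steps G" "cusp (step_target s) (step_edge s) e"
  shows "s \<in> G"
proof -
  obtain u where u: "(u, step_edge s, step_target s) \<in> G"
    using cusp_incoming[OF assms(2)] by blast
  then have "(u, step_edge s, step_target s) \<in> sym_steps G"
    by (simp add: sym_steps_def)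
  then have "s = (u, step_edge s, step_target s) \<or> s = rev_step (u, step_edge s, step_target s)"
    using sym_steps_same_edge[OF determined assms(1)] by (metis step_simps(2))
  then show ?thesis
  proof
    assume "s = rev_step (u, step_edge s, step_target s)"
    then have "step_target s = u"
      by (metis step_simps(1,6))
    then show ?thesis
      using u no_loop by metis
  qed (use u in simp)
qed

definition reversed :: "('v \<times> 'e \<times> 'v) list \<Rightarrow> ('v \<times> 'e \<times> 'v) list" where
  "reversed p = rev (map rev_step p)"

lemma reversed_simps [simp]:
  "reversed p = [] \<longleftrightarrow> p = []"
  "map step_source (reversed p) = rev (map step_target p)"
  "successively adm (reversed p) \<longleftrightarrow> successively adm p"
 "p \<noteq> [] \<Longrightarrow> hd (reversed p) = rev_step (last p)"
  "p \<noteq> [] \<Longrightarrow> last (reversed p) = rev_step (hd p)"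
  by (auto simp: reversed_def rev_map successively_map adm_rev hd_rev last_rev last_map hd_map
      o_def)

lemma set_reversed_subset [simp]: "set (reversed p) \<subseteq> sym_steps G \<longleftrightarrow> set p \<subseteq> sym_steps G"
  unfolding reversed_def set_rev set_map image_subset_iff rev_step_sym_steps by blast

text \<open>Rings may have cusps. With \<open>follows\<close> in place of \<open>linked\<close>,
  going along an edge and straight back is no ring.\<close>

definition is_ring :: "('v \<times> 'e \<times> 'v) list \<Rightarrow> bool" where
  "is_ring p \<longleftrightarrow> set p \<subseteq> sym_steps G \<and> closed_chain follows p \<and> distinct (map step_source p)"

text \<open>The step \<open>s\<close> is only the way in: it decides which first steps avoid a cusp,
  while its source may be met again by \<open>p\<close>. Appending the last target makes all
  vertices of \<open>p\<close> distinct.\<close>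

definition is_trail :: "'v \<times> 'e \<times> 'v \<Rightarrow> ('v \<times> 'e \<times> 'v) list \<Rightarrow> bool" where
  "is_trail s p \<longleftrightarrow> p \<noteq> [] \<and> set p \<subseteq> sym_steps G \<and> successively adm (s # p) \<and>
     distinct (map step_source p @ [step_target (last p)])"

text \<open>The condition on \<open>q\<close> is what makes every concatenation of \<open>p\<close>
  with a trail from \<open>t\<close> a trail again. The target of \<open>t\<close>, where
  \<open>p\<close> and \<open>q\<close> meet, is neither among the sources of \<open>p\<close> nor
  among the targets of \<open>q\<close>.\<close>

definition precedes :: "'v \<times> 'e \<times> 'v \<Rightarrow> 'v \<times> 'e \<times> 'v \<Rightarrow> bool" where
  "precedes s t \<longleftrightarrow> (\<exists>p. is_trail s p \<and> last p = t \<and>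
     (\<forall>q. is_trail t q \<longrightarrow> step_source ` set p \<inter> step_target ` set q = {}))"

lemma is_trail_linked: "is_trail s p \<Longrightarrow> successively linked p"
  by (auto simp: is_trail_def successively_Cons dest: adm_linked)

lemma is_trail_vertices:
  assumes "is_trail s p"
  shows "map step_source p @ [step_target (last p)] = step_target s # map step_target p"
proof -
  have "p \<noteq> []" "adm s (hd p)" using assms by (auto simp: is_trail_def successively_Cons)
  then show ?thesis
    using chain_vertices[OF is_trail_linked[OF assms]] by (simp add: adm_def follows_def)
qed

lemma is_trail_append:
  assumes p: "is_trail s p" and q: "is_trail (last p) q"
    and disj: "step_source ` set p \<inter> step_target ` set q = {}"
  shows "is_trail s (p @ q)"
proof -
  have "distinct (map step_source p @ map step_source q @ [step_target (last q)])"
  proof -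
    have "map step_source q @ [step_target (last q)] = step_target (last p) # map step_target q"
      by (rule is_trail_vertices[OF q])
    moreover have "distinct (map step_source q @ [step_target (last q)])"
      using q by (simp add: is_trail_def)
    moreover have "distinct (map step_source p)" "step_target (last p) \<notin> step_source ` set p"
      using p by (auto simp: is_trail_def)
    ultimately show ?thesis
      using disj by auto
  qed
  then show ?thesis
    using p q by (auto simp: is_trail_def successively_Cons successively_append_iff)
qed

lemma is_trail_prefix:
  assumes "is_trail s (p @ q)" "p \<noteq> []"
  shows "is_trail s p"
proof -
  have succ: "successively adm (s # p)"
    using assms(1) successively_append_iff[of adm "s # p" q] by (simp add: is_trail_def)
  have "distinct (step_target s # map step_target (p @ q))"
    using is_trail_vertices[OF assms(1)] assms(1) by (metis is_trail_def)
  moreover have "step_target s = step_source (hd p)"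
    using succ assms(2) by (simp add: successively_Cons adm_def follows_def)
  moreover have "successively linked p"
    using succ assms(2) by (simp add: successively_Cons adm_linked)
  ultimately have "distinct (map step_source p @ [step_target (last p)])"
    using chain_vertices[of p] assms(2) by simp
  then show ?thesis
    using assms succ by (simp add: is_trail_def)
qed

text \<open>A trail \<open>q\<close> from \<open>u\<close> extends \<open>p'\<close> to a trail from
  \<open>t\<close>, so the condition on \<open>p\<close> applies to \<open>p' @ q\<close> and the
  one on \<open>p'\<close> to \<open>q\<close>.\<close>

lemma precedes_trans:
  assumes "precedes s t" "precedes t u"
  shows "precedes s u"
proof -
  obtain p where p: "is_trail s p" "last p = t"
    "\<forall>q. is_trail t q \<longrightarrow> step_source ` set p \<inter> step_target ` set q = {}"
    using assms(1) unfolding precedes_def by (elim exE conjE)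
  obtain p' where p': "is_trail t p'" "last p' = u"
    "\<forall>q. is_trail u q \<longrightarrow> step_source ` set p' \<inter> step_target ` set q = {}"
    using assms(2) unfolding precedes_def by (elim exE conjE)
  have 1: "is_trail s (p @ p')"
    using is_trail_append[OF p(1), of p'] p p' by simp
  have "step_source ` set (p @ p') \<inter> step_target ` set q = {}" if q: "is_trail u q" for q
  proof -
    have "is_trail t (p' @ q)"
      using is_trail_append[OF p'(1), of q] p' q by simp
    then show ?thesis
      using p(3)[rule_format, of "p' @ q"] p'(3)[rule_format, OF q] by (simp add: image_Un Int_Un_distrib Int_Un_distrib2)
  qed
  moreover have "last (p @ p') = u"
    using p' by (auto simp: is_trail_def)
  ultimately show ?thesis
    unfolding precedes_def using 1 by (intro exI[of _ "p @ p'"]) simp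
qed

text \<open>A trail from \<open>s\<close> ending in \<open>s\<close> would have the target of
  \<open>s\<close> as its first and as its last vertex.\<close>

lemma precedes_irrefl: "\<not> precedes s s"
proof
  assume "precedes s s"
  then obtain p where p: "is_trail s p" "last p = s" unfolding precedes_def by (elim exE conjE)
  then show False
    using is_trail_vertices[OF p(1)] unfolding is_trail_def
    by (cases p) (auto simp: adm_def follows_def)
qed

text \<open>Inner junctions only. The junction that closes a ring is left out; in the rings counted
  below it lies at the target of \<open>s\<close>, where there is no cusp.\<close>

fun ncusps :: "('v \<times> 'e \<times> 'v) list \<Rightarrow> nat" where
  "ncusps (s # t # p) = (if adm s t then 0 else 1) + ncusps (t # p)"
| "ncusps _ = 0"

lemma ncusps_append:
  "xs \<noteq> [] \<Longrightarrow> ys \<noteq> [] \<Longrightarrow>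
   ncusps (xs @ ys) = ncusps xs + (if adm (last xs) (hd ys) then 0 else 1) + ncusps ys"
proof (induction xs rule: ncusps.induct)
  case ("2_2" v)
  then show ?case by (cases ys) auto
qed auto

lemma ncusps_0_iff: "ncusps p = 0 \<longleftrightarrow> successively adm p"
  by (induction p rule: ncusps.induct) auto

lemma first_cusp:
  "ncusps p \<noteq> 0 \<Longrightarrow> \<exists>p1 p2. p = p1 @ p2 \<and> p1 \<noteq> [] \<and> p2 \<noteq> [] \<and> successively adm p1 \<and>
     \<not> adm (last p1) (hd p2)"
proof (induction p rule: ncusps.induct)
  case (1 s t p)
  show ?case
  proof (cases "adm s t")
    case True
    then obtain p1 p2 where *: "t # p = p1 @ p2" "p1 \<noteq> []" "p2 \<noteq> []" "successively adm p1"
      "\<not> adm (last p1) (hd p2)"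
      using 1 by (auto simp del: split_paired_Ex)
    moreover have "hd p1 = t" using * by (metis hd_append2 list.sel(1))
    ultimately have "s # t # p = (s # p1) @ p2 \<and> s # p1 \<noteq> [] \<and> p2 \<noteq> [] \<and>
       successively adm (s # p1) \<and> \<not> adm (last (s # p1)) (hd p2)"
      using True by (simp add: successively_Cons)
    then show ?thesis by blast
  next
    case False
    then have "s # t # p = [s] @ (t # p) \<and> \<not> adm (last [s]) (hd (t # p))"
      by simp
    then show ?thesis by (metis list.distinct(1) successively.simps(2))
  qed
qed auto

end

section \<open>Maximal steps for the order\<close>

locale cuspfree_acyclic = cusped_graph +
  assumes no_cuspfree_ring:
    "\<lbrakk>set p \<subseteq> sym_steps G; closed_chain adm p; distinct (map step_source p)\<rbrakk> \<Longrightarrow> False"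
begin

text \<open>The edge of \<open>d\<close> does not enter the source of \<open>d\<close>, so it takes
  part in no cusp there; a trail from \<open>d\<close> back to that vertex would close to a
  cusp-free ring. Hence the one-step trail \<open>[d]\<close> is a witness.\<close>

lemma descending_successor:
  assumes s: "s \<in> G" and d: "d \<in> G" "step_source d = step_target s"
  shows "precedes s d"
proof -
  have loop: "step_source x \<noteq> step_target x" if "x \<in> G" for x
    using that no_loop by (metis prod.exhaust step_simps(1,3))
  have edge: "step_edge s \<noteq> step_edge d"
    using determined s d loop unfolding edge_determined_def inj_on_def by metis
  have nocusp: "\<not> cusp (step_source d) e (step_edge d)" for e
  proof
    assume "cusp (step_source d) e (step_edge d)"
    then have "rev_step d \<in> G"
      using cusp_step_in_graph[of "rev_step d" e] cusp_sym d(1) by (auto simp: sym_steps_def)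
    then have "rev_step d = d"
      using determined d unfolding edge_determined_def inj_on_def by (metis step_simps(5))
    then show False
      using loop[OF d(1)] by (metis step_simps(4))
  qed
  have trail: "is_trail s [d]"
    using s d edge loop[OF d(1)] nocusp by (auto simp: is_trail_def adm_def follows_def sym_steps_def)
  have "step_source d \<notin> step_target ` set q" if q: "is_trail d q" for q
  proof
    assume "step_source d \<in> step_target ` set q"
    then obtain t where t: "t \<in> set q" "step_target t = step_source d"
      by (metis imageE)
    then obtain q0 q2 where q_eq: "q = (q0 @ [t]) @ q2"
      by (metis append.assoc append_Cons append_Nil split_list)
    have trail': "is_trail d (q0 @ [t])"
      using is_trail_prefix[of d "q0 @ [t]" q2] q unfolding q_eq by simp
    have tq: "successively adm (d # q0 @ [t])" "set (q0 @ [t]) \<subseteq> sym_steps G"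
      and dist: "distinct (map step_source (q0 @ [t]))" "step_target t \<notin> step_source ` set (q0 @ [t])"
      using trail' unfolding is_trail_def by auto
    \<comment> \<open>The return cannot run through \<open>d\<close> backwards: right after
      \<open>d\<close> this is a turning back, and later it would start where the trail itself
      started.\<close>
    have "step_edge t \<noteq> step_edge d"
    proof
      assume e: "step_edge t = step_edge d"
      have "t = d \<or> t = rev_step d"
        using sym_steps_same_edge[OF determined _ _ e] tq(2) d(1) by (simp add: sym_steps_def)
      then have td: "t = rev_step d"
        using t(2) loop[OF d(1)] by auto
      show False
      proof (cases q0)
        case Nil
        then show False using tq(1) e by (simp add: adm_def follows_def)
      next
        case (Cons h q0')
        then have "step_source h = step_source t"
          using tq(1) td by (simp add: adm_def follows_def)
        then show False using dist(1) Cons by simp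
      qed
    qed
    then have "adm t d"
      using t(2) nocusp[of "step_edge t"] by (simp add: adm_def follows_def)
    moreover have "set (d # q0 @ [t]) \<subseteq> sym_steps G"
      using tq(2) d(1) by (simp add: sym_steps_def)
    moreover have "distinct (map step_source (d # q0 @ [t]))"
      using dist t(2) by simp
    ultimately show False
      using no_cuspfree_ring[of "d # q0 @ [t]"] tq(1) by (simp add: closed_chain_def)
  qed
  then show ?thesis
    unfolding precedes_def using trail by (intro exI[of _ "[d]"]) simp
qed

text \<open>The witness is the part \<open>p1\<close> of a ring up to its first cusp
  \<open>w\<close>. A continuation of its last step \<open>a\<close> that came back to the ring
  would contain a detour \<open>q1\<close> from \<open>w\<close> to a vertex \<open>x\<close> with
  only its ends on the ring. Whether \<open>x\<close> lies before or after \<open>w\<close>, ring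
  and detour recombine to a ring with fewer cusps or to a cusp-free one.\<close>

lemma cusp_successor:
  assumes ring: "is_ring p0" "last p0 = s"
    and nocusp: "\<And>e e'. \<not> cusp (step_target s) e e'"
  shows "\<exists>t\<in>G. precedes s t"
proof -
  \<comment> \<open>Minimality of the number of cusps makes the step into the first cusp of \<open>\<omega>\<close> a successor.\<close>
  obtain \<omega> where \<omega>: "is_ring \<omega>" "last \<omega> = s"
    and least: "\<And>p. is_ring p \<Longrightarrow> last p = s \<Longrightarrow> ncusps \<omega> \<le> ncusps p"
    using ex_has_least_nat[of "\<lambda>p. is_ring p \<and> last p = s" p0 ncusps] ring by blast
  have \<omega>S: "set \<omega> \<subseteq> sym_steps G" and \<omega>closed: "closed_chain follows \<omega>"
    and \<omega>dist: "distinct (map step_source \<omega>)" and \<omega>ne: "\<omega> \<noteq> []"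
    and \<omega>succ: "successively follows \<omega>" and \<omega>last: "follows s (hd \<omega>)"
    using \<omega> by (auto simp: is_ring_def closed_chain_def)
  have \<omega>targets: "map step_target \<omega> = rotate1 (map step_source \<omega>)"
    using closed_chain_targets[OF closed_chain_mono[OF \<omega>closed]] by (simp add: follows_def)
  then have \<omega>target_set: "step_target ` set \<omega> = step_source ` set \<omega>"
    by (metis set_map set_rotate1)
  have \<omega>target_inj: "x = y" if "x \<in> set \<omega>" "y \<in> set \<omega>" "step_target x = step_target y" for x y
    using \<omega>targets \<omega>dist that by (metis distinct_map distinct1_rotate inj_on_def)
  have \<omega>source_inj: "x = y" if "x \<in> set \<omega>" "y \<in> set \<omega>" "step_source x = step_source y" for x y
    using \<omega>dist that by (metis distinct_map inj_on_def)
  \<comment> \<open>The closing junction has no cusp, so a ring with \<open>ncusps\<close> zero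
    would be cusp-free all around.\<close>
  have "adm s (hd \<omega>)"
    using \<omega>last nocusp by (simp add: adm_def)
  then have "ncusps \<omega> \<noteq> 0"
    using no_cuspfree_ring[OF \<omega>S _ \<omega>dist] \<omega>ne \<omega>(2) by (auto simp: closed_chain_def ncusps_0_iff)
  then obtain p1 p2 where \<omega>eq: "\<omega> = p1 @ p2" and ne: "p1 \<noteq> []" "p2 \<noteq> []"
    and p1: "successively adm p1" and junction: "\<not> adm (last p1) (hd p2)"
    using first_cusp[of \<omega>] by blast
  define a where "a = last p1"
  define w where "w = step_target a"
  have a_in: "a \<in> set p1" and hd_in: "hd p2 \<in> set p2" using ne by (simp_all add: a_def)
  have fol: "follows a (hd p2)"
    using \<omega>succ ne by (simp add: \<omega>eq a_def successively_append_iff)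
  then have cusp_a: "cusp w (step_edge a) (step_edge (hd p2))" and w_hd: "w = step_source (hd p2)"
    using junction by (auto simp: a_def w_def adm_def follows_def)
  have aG: "a \<in> G"
    using cusp_step_in_graph[of a] cusp_a \<omega>S a_in by (auto simp: w_def \<omega>eq)
  have hd\<omega>: "hd \<omega> = hd p1" and last\<omega>: "last p2 = s"
    using \<omega>eq ne \<omega>(2) by auto
  have source_hd: "step_source (hd p1) = step_target s"
    using \<omega>last hd\<omega> by (simp add: follows_def)
  have p1_props: "set p1 \<subseteq> sym_steps G" "distinct (map step_source p1)"
    and p2_props: "set p2 \<subseteq> sym_steps G" "distinct (map step_source p2)"
    and disj: "step_source ` set p1 \<inter> step_source ` set p2 = {}"
    using \<omega>S \<omega>dist by (auto simp: \<omega>eq)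
  have w_notin: "w \<notin> step_source ` set p1"
    using disj hd_in w_hd by blast
  have trail: "is_trail s p1"
    using ne p1 p1_props w_notin \<open>adm s (hd \<omega>)\<close> hd\<omega>
    by (simp add: is_trail_def successively_Cons a_def w_def)
  have p2succ: "successively follows p2"
    using \<omega>succ by (simp add: \<omega>eq successively_append_iff)

  have "step_source ` set p1 \<inter> step_target ` set q = {}" if q: "is_trail a q" for q
  proof (rule ccontr)
    assume "step_source ` set p1 \<inter> step_target ` set q \<noteq> {}"
    \<comment> \<open>The first return to any vertex of \<open>\<omega>\<close> is taken, not only
      to \<open>p1\<close>; thus the detour meets the ring in its ends alone.\<close>
    then have "\<exists>x\<in>set q. step_target x \<in> step_source ` set \<omega>"
      unfolding \<omega>eq set_append image_Un image_Int_empty_iff by (metis UnI1)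
    from split_list_first_propE[OF this] obtain q0 t q2 where q_eq: "q = q0 @ t # q2"
      and t: "step_target t \<in> step_source ` set \<omega>"
      and q0: "\<forall>x\<in>set q0. step_target x \<notin> step_source ` set \<omega>"
      by metis
    define q1 where "q1 = q0 @ [t]"
    define x where "x = step_target t"
    have q1ne: "q1 \<noteq> []" and last_q1: "last q1 = t" by (simp_all add: q1_def)
    have trail1: "is_trail a q1"
      using is_trail_prefix[of a q1 q2] q unfolding q_eq q1_def by simp
    have q1: "set q1 \<subseteq> sym_steps G" "successively adm q1" "adm a (hd q1)"
      "distinct (map step_source q1)" "x \<notin> step_source ` set q1"
      using trail1 q1ne by (auto simp: is_trail_def successively_Cons last_q1 x_def)
    have q1v: "map step_source q1 @ [x] = w # map step_target q1"
      using is_trail_vertices[OF trail1] by (simp add: last_q1 x_def w_def)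
    have hd_q1: "step_source (hd q1) = w"
      using q1(3) by (simp add: adm_def follows_def w_def)
    have "x \<noteq> w"
      using q1(5) hd_q1 q1ne by (metis hd_in_set imageI)
    have q1_sources: "step_source ` set q1 = insert w (step_target ` set q0)"
    proof -
      have "map step_source q1 = w # map step_target q0"
        using q1v by (simp add: q1_def x_def)
      then show ?thesis by (metis image_set list.simps(15))
    qed
    then have q1_meets: "step_source ` set q1 \<inter> step_source ` set \<omega> \<subseteq> {w}"
      by (rule insert_Int_subset) (use q0 in \<open>simp only: image_Int_empty_iff simp_thms\<close>)
    \<comment> \<open>Otherwise transitivity through \<open>hd p2\<close> would make
      \<open>a\<close> and \<open>hd q1\<close> a cusp, although the trail passes from one to the
      other.\<close>
    have cusp_hd_q1: "\<not> cusp w (step_edge (hd q1)) (step_edge (hd p2))"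
      using q1(3) cusp_a cusp_sym cusp_trans unfolding adm_def w_def by metis
    have hd_q1_edge: "step_edge (hd q1) \<noteq> step_edge (hd p2)"
    proof
      assume e: "step_edge (hd q1) = step_edge (hd p2)"
      then have "cusp w (step_edge a) (step_edge (hd q1))" using cusp_a by simp
      then show False using q1(3) by (simp add: adm_def w_def)
    qed
    \<comment> \<open>If the last edge of the detour were on the ring, so would be its source; the
      detour would be a single step from \<open>w\<close>, along one of the two ring edges at
      \<open>w\<close>. Both are excluded as first steps of \<open>q1\<close>.\<close>
    have t_edge: "step_edge t \<noteq> step_edge g" if g: "g \<in> set \<omega>" for g
    proof
      assume e: "step_edge t = step_edge g"
      have tg: "t = g \<or> t = rev_step g"
        using sym_steps_same_edge[OF determined _ _ e] q1(1) \<omega>S g by (auto simp: q1_def)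
      have src: "step_source t \<in> step_source ` set \<omega>"
        using tg
      proof
        assume "t = rev_step g"
        then show ?thesis using \<omega>target_set g by (metis imageI step_simps(4))
      qed (use g in blast)
      have "q0 = []"
      proof (rule ccontr)
        assume "q0 \<noteq> []"
        then have "step_target (last q0) = step_source t"
          using q1(2) by (simp add: q1_def successively_append_iff adm_def follows_def)
        then show False using q0 src \<open>q0 \<noteq> []\<close> by (metis last_in_set)
      qed
      then have "hd q1 = t" by (simp add: q1_def)
      have "step_source t = w" using hd_q1 \<open>hd q1 = t\<close> by simp
      from tg show False
      proof
        assume "t = g"
        then have "g = hd p2"
          using \<omega>source_inj[of g "hd p2"] g hd_in w_hd \<open>step_source t = w\<close> by (simp add: \<omega>eq)
        then show False using hd_q1_edge \<open>hd q1 = t\<close> \<open>t = g\<close> by simp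
      next
        assume "t = rev_step g"
        then have "g = a"
          using \<omega>target_inj[of g a] g a_in \<open>step_source t = w\<close> by (simp add: \<omega>eq w_def)
        then show False using q1(3) \<open>hd q1 = t\<close> \<open>t = rev_step g\<close> by (simp add: adm_def follows_def)
      qed
    qed
    \<comment> \<open>\<open>g\<close> is the ring step that leaves \<open>x\<close>; its position
      before or after the cusp \<open>w\<close> separates the two cases.\<close>
    obtain g where g: "g \<in> set \<omega>" "step_source g = x"
      using t by (auto simp: x_def)
    have fol_tg: "follows t g"
      using g t_edge[OF g(1)] by (simp add: follows_def x_def)
    show False
    proof (cases "g \<in> set p1")
      case True
      then obtain p1a p1b where p1eq: "p1 = p1a @ g # p1b"
        by (metis split_list)
      \<comment> \<open>From \<open>x\<close> along \<open>p1\<close> to \<open>w\<close> and back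
        by the detour: the only junction left for a cusp is the one at \<open>x\<close>, between
        \<open>t\<close> and \<open>g\<close>.\<close>
      let ?c = "(g # p1b) @ q1"
      have lastb: "last (g # p1b) = a" using p1eq by (simp add: a_def)
      have c1: "successively adm ?c"
        using p1 q1(2,3) lastb successively_append_iff[of adm "g # p1b" q1]
        unfolding p1eq by (simp add: successively_append_iff)
      have c2: "set ?c \<subseteq> sym_steps G" using p1_props q1(1) by (simp add: p1eq)
      have c3: "distinct (map step_source ?c)"
      proof -
        have "step_source ` set q1 \<inter> step_source ` set (g # p1b) = {}"
          by (rule meets_only_disjoint[OF q1_meets]) (use w_notin in \<open>auto simp: \<omega>eq p1eq\<close>)
        then show ?thesis using q1(4) p1_props(2) unfolding p1eq by auto
      qed
      have "\<not> adm t g"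
        using no_cuspfree_ring[OF c2 _ c3] c1 q1ne last_q1 by (auto simp: closed_chain_def)
      then have cusp_tg: "cusp x (step_edge t) (step_edge g)"
        using fol_tg by (simp add: adm_def x_def)
      show False
      proof (cases "p1a = []")
        case True
        then have "x = step_target s" using source_hd g by (simp add: p1eq)
        then show False using cusp_tg nocusp by simp
      next
        case p1a: False
        \<comment> \<open>Following \<open>q1\<close> backwards enters \<open>w\<close> by its conclusion and so saves the cusp there.\<close>
        let ?p = "p1a @ reversed q1 @ p2"
        have adm_x: "adm (last p1a) g"
          using p1 p1a by (simp add: p1eq successively_append_iff)
        have j1: "adm (last p1a) (rev_step t)"
        proof -
          have "last p1a \<in> set \<omega>" using p1a by (simp add: \<omega>eq p1eq)
          then have "step_edge t \<noteq> step_edge (last p1a)" by (rule t_edge)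
          moreover have "step_target (last p1a) = x" using adm_x g by (simp add: adm_def follows_def)
          moreover have "\<not> cusp x (step_edge (last p1a)) (step_edge t)"
            using adm_x cusp_tg cusp_trans \<open>step_target (last p1a) = x\<close> unfolding adm_def by metis
          ultimately show ?thesis by (simp add: adm_def follows_def x_def)
        qed
        have j2: "adm (rev_step (hd q1)) (hd p2)"
          using hd_q1 w_hd hd_q1_edge cusp_hd_q1 by (simp add: adm_def follows_def)
        have succ_p1a: "successively adm p1a" using p1 by (simp add: p1eq successively_append_iff)
        have "ncusps ?p = ncusps p2"
          using p1a ne q1ne j1 j2 succ_p1a q1(2) ncusps_0_iff[of p1a] ncusps_0_iff[of "reversed q1"]
          by (simp add: ncusps_append last_q1)
        moreover have "ncusps \<omega> = 1 + ncusps p2"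
          using ne p1 junction ncusps_0_iff[of p1] by (simp add: \<omega>eq ncusps_append)
        moreover have "is_ring ?p"
        proof -
          have q1_targets: "step_target ` set q1 = insert x (step_target ` set q0)"
            by (simp add: q1_def x_def)
          have q0_disj: "step_target ` set q0 \<inter> step_source ` set \<omega> = {}"
            using q0 unfolding image_Int_empty_iff[symmetric] by (simp only: Int_commute)
          have "x \<in> step_source ` set p1"
            using g(2) True by (metis imageI)
          then have x_notin: "x \<notin> step_source ` set p2"
            using disj by (metis IntI empty_iff)
          have x_notin': "x \<notin> step_source ` set p1a"
            using p1_props(2) g(2) by (simp add: p1eq)
          have sub: "set p1a \<subseteq> set p1" "set p1a \<subseteq> set \<omega>" "set p2 \<subseteq> set \<omega>"
            by (simp_all add: \<omega>eq p1eq subset_iff)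
          have "step_source ` set p1a \<inter> step_target ` set q1 = {}"
            unfolding Int_commute[of "step_source ` set p1a"]
            by (rule disjoint_insert_subset[OF q1_targets q0_disj image_mono[OF sub(2)] x_notin'])
          moreover have "step_target ` set q1 \<inter> step_source ` set p2 = {}"
            by (rule disjoint_insert_subset[OF q1_targets q0_disj image_mono[OF sub(3)] x_notin])
          moreover have "distinct (map step_target q1)"
          proof -
            have "distinct (map step_source q1 @ [x])" using q1(4,5) by simp
            then show ?thesis unfolding q1v by simp
          qed
          moreover have "step_source ` set p1a \<inter> step_source ` set p2 = {}"
            by (rule disjoint_subset[OF disj image_mono[OF sub(1)]])
          moreover have "distinct (map step_source p1a)"
            using p1_props(2) by (simp add: p1eq)
          ultimately have d: "distinct (map step_source ?p)"
            using p2_props(2)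
            by (simp only: map_append reversed_simps(2) distinct_append distinct_rev set_append
                set_rev set_map Int_Un_distrib Un_empty simp_thms)
          have f: "successively follows ?p"
            using p1a ne q1ne j1 j2 adm_follows[OF succ_p1a] q1(2) adm_follows[of "reversed q1"] p2succ
            by (simp add: successively_append_iff last_q1) (simp add: adm_def)
          have "follows (last ?p) (hd ?p)"
            using \<omega>last p1a ne last\<omega> hd\<omega> by (simp add: p1eq)
          then show ?thesis
            using f d p1_props(1) p2_props(1) q1(1) ne unfolding is_ring_def closed_chain_def
            by (simp add: p1eq)
        qed
        ultimately show False
          using least[of ?p] ne last\<omega> by simp
      qed
    next
      case False
      then obtain p2a p2b where p2eq: "p2 = p2a @ g # p2b"
        using g(1) unfolding \<omega>eq by (metis Un_iff set_append split_list)
      have p2a: "p2a \<noteq> []"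
        using g(2) w_hd \<open>x \<noteq> w\<close> by (auto simp: p2eq)
      let ?p = "p1 @ q1 @ g # p2b"
      have j0: "adm (last p1) (hd q1)" using q1(3) by (simp add: a_def)
      have np: "ncusps ?p = (if adm t g then 0 else 1) + ncusps (g # p2b)"
        using p1 q1(2) j0 ne q1ne ncusps_0_iff[of p1] ncusps_0_iff[of q1]
        by (simp add: ncusps_append last_q1)
      have n\<omega>: "ncusps \<omega> = 1 + ncusps p2a + (if adm (last p2a) g then 0 else 1) + ncusps (g # p2b)"
        using p1 junction ne p2a ncusps_0_iff[of p1] by (simp add: \<omega>eq p2eq ncusps_append)
      have f: "successively follows ?p"
        using adm_follows[OF p1] adm_follows[OF q1(2)] p2succ fol_tg j0 ne q1ne
        unfolding p2eq by (simp add: successively_append_iff last_q1) (simp add: adm_def)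
      have d: "distinct (map step_source ?p)"
      proof -
        have "step_source ` set q1 \<inter> step_source ` set p1 = {}"
          by (rule meets_only_disjoint[OF q1_meets _ w_notin]) (simp add: \<omega>eq image_Un)
        moreover have "w \<notin> step_source ` set (g # p2b)"
          using p2_props(2) w_hd p2a unfolding p2eq by (cases p2a) auto
        then have "step_source ` set q1 \<inter> step_source ` set (g # p2b) = {}"
          by (intro meets_only_disjoint[OF q1_meets] image_mono) (auto simp: \<omega>eq p2eq)
        ultimately show ?thesis
          using p1_props(2) p2_props(2) q1(4) disj unfolding p2eq by auto
      qed
      have "last ?p = s" using last\<omega> by (simp add: p2eq)
      moreover have "is_ring ?p"
        using f d p1_props(1) p2_props(1) q1(1) ne \<omega>last hd\<omega> last\<omega>
        unfolding is_ring_def closed_chain_def p2eq by simp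
      ultimately have le: "ncusps \<omega> \<le> ncusps ?p"
        by (rule least[rotated])
      have ntg: "\<not> adm t g" and n2: "ncusps p2a = 0" and adm_g: "adm (last p2a) g"
        using le unfolding np n\<omega> by (auto split: if_splits)
      have cusp_tg: "cusp x (step_edge t) (step_edge g)"
        using ntg fol_tg by (simp add: adm_def x_def)
      \<comment> \<open>The detour along \<open>q1\<close> trades the cusp at \<open>w\<close> for one at \<open>x\<close>, so minimality leaves no cusp in
        \<open>p2a\<close>, and \<open>q1\<close> closes up with it.\<close>
      let ?c = "q1 @ reversed p2a"
      have target_p2a: "step_target (last p2a) = x" 
        using adm_g g by (simp add: adm_def follows_def)
      have j1: "adm t (rev_step (last p2a))"
      proof -
        have "last p2a \<in> set \<omega>" using p2a by (simp add: \<omega>eq p2eq)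
        then have "step_edge t \<noteq> step_edge (last p2a)" by (rule t_edge)
        moreover have "\<not> cusp x (step_edge t) (step_edge (last p2a))"
          using adm_g cusp_tg cusp_trans cusp_sym target_p2a unfolding adm_def by metis
        ultimately show ?thesis using target_p2a by (simp add: adm_def follows_def x_def)
      qed
      have hd_p2: "hd p2 = hd p2a" using p2a by (simp add: p2eq)
      have j2: "adm (rev_step (hd p2a)) (hd q1)"
        using hd_q1 w_hd hd_q1_edge cusp_hd_q1 cusp_sym unfolding hd_p2
        by (auto simp: adm_def follows_def)
      have c1: "closed_chain adm ?c"
        using q1(2) q1ne p2a j1 j2 n2 ncusps_0_iff[of p2a]
        by (simp add: closed_chain_def successively_append_iff last_q1)
      have c2: "set ?c \<subseteq> sym_steps G"
        using q1(1) p2_props(1) by (simp add: p2eq)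
      have c3: "distinct (map step_source ?c)"
      proof -
        have chain: "map step_source p2a @ [x] = w # map step_target p2a"
          using chain_vertices[of p2a] p2a n2 ncusps_0_iff[of p2a] adm_linked[of p2a] target_p2a
            w_hd hd_p2 by simp
        have "x \<notin> step_source ` set p2a"
          using p2_props(2) g(2) by (auto simp: p2eq)
        then have dd: "distinct (w # map step_target p2a)"
          using p2_props(2) unfolding chain[symmetric] p2eq by simp
        have "step_target ` set p2a \<subseteq> step_source ` set \<omega>"
          unfolding \<omega>target_set[symmetric] by (rule image_mono) (auto simp: \<omega>eq p2eq)
        moreover have "w \<notin> step_target ` set p2a" using dd by simp
        ultimately have "step_source ` set q1 \<inter> step_target ` set p2a = {}"
          by (intro meets_only_disjoint[OF q1_meets])
        moreover have "distinct (map step_target p2a)" using dd by simp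
        ultimately show ?thesis
          using q1(4)
          by (simp only: map_append reversed_simps(2) distinct_append distinct_rev set_rev set_map
              simp_thms)
      qed
      show False by (rule no_cuspfree_ring[OF c2 c1 c3])
    qed
  qed
  then have "precedes s a"
    unfolding precedes_def using trail by (intro exI[of _ p1]) (simp add: a_def)
  then show ?thesis using aG by blast
qed

text \<open>The contrapositives of the two successor lemmas, at a maximal step; finiteness of
  \<open>G\<close> provides it.\<close>

theorem splitting_vertex:
  assumes "G \<noteq> {}"
  obtains s where "s \<in> G" "\<And>d. d \<in> G \<Longrightarrow> step_source d \<noteq> step_target s"
    "(\<exists>e e'. cusp (step_target s) e e') \<or> (\<forall>p. is_ring p \<longrightarrow> last p \<noteq> s)"
proof -
  have "asymp_on G precedes" "transp_on G precedes"
    using precedes_trans precedes_irrefl by (auto intro!: asymp_onI transp_onI simp del: split_paired_All) blast+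
  from Finite_Set.bex_max_element[OF finite_graph this assms]
  obtain s where s: "s \<in> G" "\<And>t. t \<in> G \<Longrightarrow> \<not> precedes s t"
    using precedes_irrefl by metis
  show ?thesis
    using that[OF s(1)] descending_successor[OF s(1)] cusp_successor[of _ s] s(2) by metis
qed

end

section \<open>Nets at depth zero\<close>

lemma incident_nonempty: "prems l \<union> concs l \<noteq> {}"
  by (cases l) auto

lemma finite_incident: "typed l \<Longrightarrow> finite (prems l \<union> concs l)"
  by (cases l) auto

lemma edges_ofI:
  "l \<in> L \<Longrightarrow> e \<in> prems l \<Longrightarrow> e \<in> edges_of L"
  "l \<in> L \<Longrightarrow> e \<in> concs l \<Longrightarrow> e \<in> edges_of L"
  by (auto simp: edges_of_def)

lemma net_graph_finite: "net_graph L \<Longrightarrow> finite L"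
  by (simp add: net_graph_def)

lemma net_graph_finite_edges: "net_graph L \<Longrightarrow> finite (edges_of L)"
  using finite_incident by (auto simp: net_graph_def edges_of_def)

lemma net_graph_concluded: "net_graph L \<Longrightarrow> e \<in> edges_of L \<Longrightarrow> \<exists>l\<in>L. e \<in> concs l"
  unfolding net_graph_def by blast

lemma net_graph_conc_unique:
  "net_graph L \<Longrightarrow> l \<in> L \<Longrightarrow> m \<in> L \<Longrightarrow> e \<in> concs l \<Longrightarrow> e \<in> concs m \<Longrightarrow> l = m"
  unfolding net_graph_def using edges_ofI(2) by metis

lemma net_graph_prem_unique:
  "net_graph L \<Longrightarrow> l \<in> L \<Longrightarrow> m \<in> L \<Longrightarrow> e \<in> prems l \<Longrightarrow> e \<in> prems m \<Longrightarrow> l = m"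
  unfolding net_graph_def by (metis disjoint_iff)

lemma net_graph_subset:
  assumes "net_graph L" "L' \<subseteq> L" "\<And>l e. l \<in> L' \<Longrightarrow> e \<in> prems l \<Longrightarrow> \<exists>m\<in>L'. e \<in> concs m"
  shows "net_graph L'"
  unfolding net_graph_def
proof (intro conjI ballI)
  show "finite L'" using assms(1,2) net_graph_finite finite_subset by blast
next
  fix l assume "l \<in> L'"
  then show "typed l" using assms(1,2) by (auto simp: net_graph_def)
next
  fix e assume "e \<in> edges_of L'"
  then obtain m where m: "m \<in> L'" "e \<in> concs m"
    using assms(3) by (auto simp: edges_of_def)
  then show "\<exists>!l. l \<in> L' \<and> e \<in> concs l"
    using net_graph_conc_unique[OF assms(1)] assms(2) by (intro ex1I[of _ m]) auto
next
  fix l m assume "l \<in> L'" "m \<in> L'"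
  then show "prems l \<inter> prems m \<noteq> {} \<longrightarrow> l = m"
    using net_graph_prem_unique[OF assms(1)] assms(2) by blast
qed

lemma conclusions_of_iff: "e \<in> conclusions_of L \<longleftrightarrow> e \<in> edges_of L \<and> (\<forall>l\<in>L. e \<notin> prems l)"
  by (auto simp: conclusions_of_def)

lemma is_netD:
  assumes "is_net N"
  shows "net_graph (links N)" "\<And>b. b \<in> boxes N \<Longrightarrow> delimits_box (links N) b"
    "\<And>b b'. b \<in> boxes N \<Longrightarrow> b' \<in> boxes N \<Longrightarrow> b \<noteq> b' \<Longrightarrow>
        box_links b \<inter> box_links b' = {} \<or> box_links b \<subseteq> content b' \<or> box_links b' \<subseteq> content b"
  using assms unfolding is_net_def by blast+

section \<open>Boxes and what they enclose\<close>

lemma principal_in_box: "principal b \<in> box_links b"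
  by (simp add: box_links_def ports_def)

lemma delimits_boxD:
  assumes "delimits_box L b"
  shows "box_links b \<subseteq> L" "\<exists>a c. principal b = OfCourseLink a c"
    "\<And>l. l \<in> auxiliary b \<Longrightarrow> \<exists>a c. l = PaxLink a c"
    "ports b \<inter> content b = {}" "net_graph (content b)"
    "conclusions_of (content b) = \<Union>(prems ` ports b)"
    "content b \<subseteq> box_links b" "\<not> box_links b \<subseteq> content b"
    "principal b \<notin> content b"
  using assms unfolding delimits_box_def box_links_def ports_def by blast+

text \<open>Nothing enters a box from outside: the premises of the ports are conclusions of the
  content, and the content concludes all of its own edges.\<close>

lemma box_prem_concluded_inside:
  assumes "net_graph L" "delimits_box L b" "l \<in> box_links b" "e \<in> prems l" "m \<in> L" "e \<in> concs m"
  shows "m \<in> content b"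
proof -
  note b = delimits_boxD[OF assms(2)]
  have "e \<in> edges_of (content b)"
  proof (cases "l \<in> ports b")
    case True
    then have "e \<in> conclusions_of (content b)" using b(6) assms(4) by blast
    then show ?thesis by (simp add: conclusions_of_iff)
  next
    case False
    then show ?thesis using assms(3,4) edges_ofI(1) by (auto simp: box_links_def)
  qed
  then obtain m' where "m' \<in> content b" "e \<in> concs m'"
    using net_graph_concluded[OF b(5)] by blast
  then show ?thesis
    using net_graph_conc_unique[OF assms(1), of m' m] assms(5,6) b(1,7) by blast
qed

text \<open>Edges leave the content only through the ports, whose premises are exactly its
  conclusions.\<close>

lemma box_content_conc_used:
  assumes "delimits_box L b" "m \<in> content b" "e \<in> concs m"
  shows "\<exists>l\<in>box_links b. e \<in> prems l"
proof (cases "e \<in> conclusions_of (content b)")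
  case True
  then show ?thesis using delimits_boxD(6)[OF assms(1)] by (auto simp: box_links_def)
next
  case False
  then show ?thesis
    using edges_ofI(2)[OF assms(2,3)] by (auto simp: conclusions_of_iff box_links_def)
qed

lemma principal_unique:
  assumes "is_net N" "b \<in> boxes N" "b' \<in> boxes N" "principal b = principal b'"
  shows "b = b'"
proof -
  obtain a c where p: "principal b = OfCourseLink a c"
    using delimits_boxD(2) is_netD(2) assms by blast
  moreover have "principal b \<in> links N"
    using delimits_boxD(1) is_netD(2) assms principal_in_box by blast
  ultimately have "\<exists>!b. b \<in> boxes N \<and> OfCourseLink a c = principal b"
    using assms(1) unfolding is_net_def by metis
  then show ?thesis using assms p by metis
qed

text \<open>Here \<open>l\<close> is a port of \<open>b\<close>. It rules out disjointness, and
  \<open>b'\<close> lying inside \<open>b\<close> would put it into the content of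
  \<open>b\<close>.\<close>

lemma nested_boxes:
  assumes "is_net N" "b \<in> boxes N" "b' \<in> boxes N" "l \<in> box_links b" "l \<in> content b'" "l \<notin> content b"
  shows "box_links b \<subseteq> content b'"
proof -
  have "b \<noteq> b'" using assms by auto
  then consider "box_links b \<inter> box_links b' = {}" | "box_links b \<subseteq> content b'" | "box_links b' \<subseteq> content b"
    using is_netD(3)[OF assms(1-3)] by blast
  then show ?thesis
    using assms(4-6) by cases (auto simp: box_links_def)
qed

text \<open>Among the boxes containing \<open>l\<close>, one with the most links is outermost, since
  a box around it would have strictly more.\<close>

lemma in_outermost_box:
  assumes N: "is_net N" and b: "b \<in> boxes N" "l \<in> box_links b"
  shows "\<exists>b'\<in>outermost_boxes N. l \<in> box_links b'"
proof -
  let ?P = "\<lambda>b. b \<in> boxes N \<and> l \<in> box_links b"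
  have fin: "finite (links N)" using is_netD(1)[OF N] net_graph_finite by blast
  have sub: "box_links b \<subseteq> links N" if "b \<in> boxes N" for b
    using delimits_boxD(1) is_netD(2)[OF N] that by blast
  then have "\<forall>b. ?P b \<longrightarrow> card (box_links b) < Suc (card (links N))"
    using fin by (simp add: card_mono less_Suc_eq_le)
  then obtain b' where b': "?P b'" and max: "\<And>c. ?P c \<Longrightarrow> card (box_links c) \<le> card (box_links b')"
    using ex_has_greatest_nat[of ?P b "card \<circ> box_links"] b by (metis comp_apply)
  have "\<not> box_links b' \<subseteq> content c" if c: "c \<in> boxes N" for c
  proof
    assume *: "box_links b' \<subseteq> content c"
    note dc = delimits_boxD[OF is_netD(2)[OF N c]]
    have "box_links b' \<subset> box_links c"
      using * dc(7,8) by blast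
    moreover have "finite (box_links c)" using sub[OF c] fin finite_subset by blast
    ultimately have "card (box_links b') < card (box_links c)"
      by (rule psubset_card_mono[rotated])
    moreover have "?P c" using c b' * dc(7) by blast
    ultimately show False using max[of c] by simp
  qed
  then show ?thesis using b' by (auto simp: outermost_boxes_def)
qed

section \<open>Collapsing the boxes\<close>

lemma collapses_exists:
  assumes "is_net N" "l \<in> links N"
  shows "\<exists>x. collapses_to N l x"
proof (cases "\<exists>b\<in>boxes N. l \<in> box_links b")
  case True
  then obtain b where "b \<in> outermost_boxes N" "l \<in> box_links b"
    using in_outermost_box[OF assms(1)] by blast
  then have "collapses_to N l (BoxNode b)" by simp
  then show ?thesis ..
next
  case False
  then have "collapses_to N l (LinkNode l)" using assms by simp
  then show ?thesis ..
qed

lemma collapses_in_links: "is_net N \<Longrightarrow> collapses_to N l x \<Longrightarrow> l \<in> links N"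
  using delimits_boxD(1) is_netD(2) by (cases x) (auto simp: outermost_boxes_def)

text \<open>An outermost box that meets \<open>b\<close> is \<open>b\<close> or contains
  \<open>b\<close>; the remaining nesting is excluded by being outermost.\<close>

lemma box_collapses:
  assumes N: "is_net N" and b: "b \<in> boxes N" "k \<in> box_links b" "k' \<in> box_links b"
    and "collapses_to N k x"
  shows "collapses_to N k' x"
proof (cases x)
  case (LinkNode m)
  then show ?thesis using assms by auto
next
  case (BoxNode b')
  then have b': "b' \<in> outermost_boxes N" "k \<in> box_links b'" using assms(5) by auto
  then have "b' \<in> boxes N" "\<not> box_links b' \<subseteq> content b" using b(1) by (auto simp: outermost_boxes_def)
  then have "b = b' \<or> box_links b \<subseteq> content b'"
    using is_netD(3)[OF N b(1), of b'] b'(2) b(2) by blast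
  then have "k' \<in> box_links b'"
    using b(3) delimits_boxD(7)[OF is_netD(2)[OF N \<open>b' \<in> boxes N\<close>]] by blast
  then show ?thesis using b' BoxNode by simp
qed

lemma collapses_unique:
  assumes N: "is_net N" and "collapses_to N l x" "collapses_to N l y"
  shows "x = y"
proof (cases x; cases y)
  fix b b' assume xy: "x = BoxNode b" "y = BoxNode b'"
  then have o: "b \<in> outermost_boxes N" "l \<in> box_links b" "b' \<in> outermost_boxes N" "l \<in> box_links b'"
    using assms by auto
  then have "b \<in> boxes N" "b' \<in> boxes N" "\<not> box_links b \<subseteq> content b'" "\<not> box_links b' \<subseteq> content b"
    by (auto simp: outermost_boxes_def)
  then have "b = b'" using is_netD(3)[OF N, of b b'] o by blast
  then show ?thesis using xy by simp
qed (use assms in \<open>auto simp: outermost_boxes_def\<close>)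

section \<open>The graph at depth zero, before any switching is chosen\<close>

definition depth0_graph :: "'a net \<Rightarrow> ('a node \<times> 'a edge \<times> 'a node) set" where
  "depth0_graph N = {(x, e, y). (\<exists>l m. collapses_to N l x \<and> collapses_to N m y \<and>
       e \<in> concs l \<and> e \<in> prems m) \<and> \<not> (\<exists>b. x = BoxNode b \<and> y = BoxNode b)}"

text \<open>An edge used in a box is concluded in the same box, and box-to-box edges are left out of
  the graph. So box nodes occur only as sources.\<close>

lemma depth0_graph_target:
  assumes N: "is_net N" and "(x, e, y) \<in> depth0_graph N"
  obtains l m where "y = LinkNode m" "collapses_to N m y" "e \<in> prems m"
    "collapses_to N l x" "e \<in> concs l"
proof -
  obtain l m where lm: "collapses_to N l x" "collapses_to N m y" "e \<in> concs l" "e \<in> prems m"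
    and nb: "\<not> (\<exists>b. x = BoxNode b \<and> y = BoxNode b)"
    using assms(2) by (auto simp: depth0_graph_def)
  show ?thesis
  proof (cases y)
    case (LinkNode k)
    then show ?thesis using that lm by auto
  next
    case (BoxNode b)
    then have b: "b \<in> outermost_boxes N" "m \<in> box_links b" "b \<in> boxes N"
      using lm(2) by (auto simp: outermost_boxes_def)
    have "l \<in> content b"
      by (rule box_prem_concluded_inside[OF is_netD(1)[OF N] is_netD(2)[OF N b(3)] b(2) lm(4) _ lm(3)])
        (rule collapses_in_links[OF N lm(1)])
    then have "collapses_to N l (BoxNode b)"
      using b by (simp add: box_links_def)
    then have "x = BoxNode b" using collapses_unique[OF N] lm(1) by blast
    then show ?thesis using nb BoxNode by blast
  qed
qed

lemma depth0_graph_determined: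
  assumes N: "is_net N"
  shows "edge_determined (depth0_graph N)"
  unfolding edge_determined_def
proof (rule inj_onI)
  fix s t assume st: "s \<in> depth0_graph N" "t \<in> depth0_graph N" "step_edge s = step_edge t"
  obtain x e y where s: "s = (x, e, y)" by (cases s)
  obtain x' y' where t: "t = (x', e, y')" using st(3) s by (cases t) auto
  note G = is_netD(1)[OF N]
  obtain l m where 1: "collapses_to N m y" "e \<in> prems m" "collapses_to N l x" "e \<in> concs l"
    using depth0_graph_target[OF N, of x e y] st(1) s by blast
  obtain l' m' where 2: "collapses_to N m' y'" "e \<in> prems m'" "collapses_to N l' x'" "e \<in> concs l'"
    using depth0_graph_target[OF N, of x' e y'] st(2) t by blast
  have "l = l'" "m = m'"
    using net_graph_conc_unique[OF G, of l l' e] net_graph_prem_unique[OF G, of m m' e]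
      collapses_in_links[OF N] 1 2 by auto
  then show "s = t" using collapses_unique[OF N] 1 2 s t by auto
qed

lemma depth0_graph_finite:
  assumes N: "is_net N"
  shows "finite (depth0_graph N)"
proof (rule finite_imageD)
  show "inj_on step_edge (depth0_graph N)"
    using depth0_graph_determined[OF N] by (simp add: edge_determined_def)
  have "step_edge ` depth0_graph N \<subseteq> edges N"
  proof
    fix e assume "e \<in> step_edge ` depth0_graph N"
    then obtain x y where "(x, e, y) \<in> depth0_graph N" by auto
    then show "e \<in> edges N"
      using depth0_graph_target[OF N] collapses_in_links[OF N] edges_ofI(1) by metis
  qed
  then show "finite (step_edge ` depth0_graph N)"
    using net_graph_finite_edges[OF is_netD(1)[OF N]] finite_subset by blast
qed

lemma depth0_graphI:
  assumes "is_net N" "collapses_to N m (LinkNode m)" "e \<in> prems m"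
  obtains l x where "(x, e, LinkNode m) \<in> depth0_graph N" "collapses_to N l x" "e \<in> concs l"
proof -
  have "m \<in> links N" using collapses_in_links assms by blast
  then obtain l where "l \<in> links N" "e \<in> concs l"
    using net_graph_concluded[OF is_netD(1)[OF assms(1)]] assms(3) edges_ofI(1) by blast
  moreover obtain x where "collapses_to N l x"
    using collapses_exists[OF assms(1)] calculation by blast
  ultimately show ?thesis
    using that[of x l] assms unfolding depth0_graph_def by blast
qed

lemma switching_eq:
  "switching N s = {(x, e, y). (x, e, y) \<in> depth0_graph N \<and>
     (\<exists>l m. collapses_to N l x \<and> collapses_to N m y \<and> e \<in> concs l \<and> e \<in> prems m \<and>
        (switched m \<longrightarrow> e = s m))}"
  unfolding switching_def depth0_graph_def by blast

section \<open>From switchings to cusps\<close>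

definition DR_acyclic :: "'a net \<Rightarrow> bool" where
  "DR_acyclic N \<longleftrightarrow> (\<forall>s p. switching_choice N s \<longrightarrow> \<not> cycle (switching N s) p)"

lemma DR_correct_iff:
  "DR_correct N \<longleftrightarrow> DR_acyclic N \<and> (\<forall>b\<in>boxes N. DR_correct (box_net N b))"
  by (subst DR_correct.simps) (auto simp: DR_acyclic_def)

lemma adjacent_in_iff: "(u, v) \<in> adjacent_in H \<longleftrightarrow> (\<exists>e. (u, e, v) \<in> sym_steps H)"
  by (auto simp: adjacent_in_def)

lemma rotate_to_source:
  assumes "closed_chain R p" "y \<in> step_source ` set p"
  obtains r where "closed_chain R r" "set r = set p" "step_source (hd r) = y"
    "distinct (map step_source r) = distinct (map step_source p)"
proof -
  obtain s where "s \<in> set p" "step_source s = y" using assms(2) by (metis imageE)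
  then obtain xs ys where p: "p = xs @ s # ys" by (metis split_list)
  show ?thesis
  proof (rule that[of "(s # ys) @ xs"])
    show "closed_chain R ((s # ys) @ xs)" using assms(1) p closed_chain_rotate by metis
  qed (use p \<open>step_source s = y\<close> in auto)
qed

context cusped_graph
begin

text \<open>A repeated edge would be traversed in both directions, by \<open>s\<close> and by
  \<open>rev_step s\<close>. The step after \<open>s\<close> starts at the same vertex as
  \<open>rev_step s\<close> and therefore equals it, a turning back that \<open>follows\<close>
  forbids.\<close>

lemma ring_edges_distinct:
  assumes "is_ring p"
  shows "distinct (map step_edge p)"
proof -
  have S: "set p \<subseteq> sym_steps G" and c: "closed_chain follows p" and d: "distinct (map step_source p)"
    using assms by (simp_all add: is_ring_def)
  have "inj_on step_edge (set p)"
  proof (rule inj_onI, rule ccontr)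
    fix s t assume st: "s \<in> set p" "t \<in> set p" "step_edge s = step_edge t" "s \<noteq> t"
    then have t: "t = rev_step s"
      using sym_steps_same_edge[OF determined, of t s] S by auto
    obtain r where r: "closed_chain follows r" "set r = set p" "step_source (hd r) = step_source s"
      "distinct (map step_source r) = distinct (map step_source p)"
      using rotate_to_source[OF c imageI[OF st(1)]] by metis
    have "hd r \<in> set r" using r(1) by (simp add: closed_chain_def)
    then have "hd r = s"
      using r(2,3) st(1) d by (metis distinct_map inj_on_def)
    then obtain r' where r': "r = s # r'"
      using r(1) by (cases r) (auto simp: closed_chain_def)
    have ne: "r' \<noteq> []"
    proof
      assume "r' = []"
      then have "set p = {s}" using r(2) r' by simp
      then show False using st(2,4) by simp
    qed
    have "hd r' \<in> set r" using ne r' by simp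
    then have f: "hd r' \<in> set p" "follows s (hd r')"
      using r(1) r' ne unfolding r(2) by (simp_all add: closed_chain_def successively_Cons)
    then have "step_source (hd r') = step_source t" using t by (simp add: follows_def)
    then have "hd r' = t" using f(1) st(2) d by (metis distinct_map inj_on_def)
    then show False using f(2) st(3) by (simp add: follows_def)
  qed
  moreover have "distinct p" using d by (simp add: distinct_map)
  ultimately show ?thesis by (simp add: distinct_map)
qed

text \<open>The ring passes \<open>y\<close> once, so two different edges of it at \<open>y\<close>
  belong to consecutive steps, and these form no cusp.\<close>

lemma ring_incident:
  assumes "set p \<subseteq> sym_steps G" "closed_chain adm p" "distinct (map step_source p)"
    and "s \<in> set p" "t \<in> set p" "step_edge s \<noteq> step_edge t"
    and "step_source s = y \<or> step_target s = y" "step_source t = y \<or> step_target t = y"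
  shows "\<not> cusp y (step_edge s) (step_edge t)"
proof -
  have cl: "closed_chain linked p"
    using assms(2) by (rule closed_chain_mono) (simp add: adm_def follows_def)
  have "step_target ` set p = step_source ` set p"
    using closed_chain_targets[OF cl] by (metis set_map set_rotate1)
  then have "y \<in> step_source ` set p" using assms(4,7) by (metis imageI)
  from rotate_to_source[OF assms(2) this] obtain r where r: "closed_chain adm r" "set r = set p" "step_source (hd r) = y"
    "distinct (map step_source r) = distinct (map step_source p)"
    by metis
  have dr: "distinct (map step_source r)"
    using assms(3) r(4) by simp
  have clr: "closed_chain linked r"
    using r(1) by (rule closed_chain_mono) (simp add: adm_def follows_def)
  have dt: "distinct (map step_target r)"
    using closed_chain_targets[OF clr] dr by simp
  have hl: "hd r \<in> set r" "last r \<in> set r" "adm (last r) (hd r)"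
    using r(1) by (simp_all add: closed_chain_def)
  then have last_y: "step_target (last r) = y"
    using r(3) by (simp add: adm_def follows_def)
  have inj: "inj_on step_source (set r)" "inj_on step_target (set r)"
    using dr dt by (simp_all add: distinct_map)
  have "u = hd r \<or> u = last r" if "u \<in> set p" "step_source u = y \<or> step_target u = y" for u
    using that hl(1,2) last_y r(3) inj unfolding r(2)[symmetric] inj_on_def by metis
  then have "s = hd r \<and> t = last r \<or> s = last r \<and> t = hd r"
    using assms(4-8) by metis
  then show ?thesis
    using hl(3) last_y cusp_sym unfolding adm_def by metis
qed

end

text \<open>The case \<open>e = e'\<close> is included, as symmetry and transitivity demand.\<close>

definition premise_cusp :: "'a net \<Rightarrow> 'a node \<Rightarrow> 'a edge \<Rightarrow> 'a edge \<Rightarrow> bool" where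
  "premise_cusp N y e e' \<longleftrightarrow>
     (\<exists>m. y = LinkNode m \<and> switched m \<and> collapses_to N m y \<and> e \<in> prems m \<and> e' \<in> prems m)"

text \<open>A switching adapted to a set \<open>E\<close> of edges, to be applied with the edges of
  a cycle that it should keep. The last \<open>SOME\<close> fills in the links not met by
  \<open>E\<close>.\<close>

lemma switching_choice_through:
  "switching_choice N (\<lambda>m. if E \<inter> prems m \<noteq> {} then SOME e. e \<in> E \<inter> prems m else SOME e. e \<in> prems m)"
  unfolding switching_choice_def by (auto intro: someI) (metis (mono_tags, lifting) IntI someI_ex)+

text \<open>A loop would be a cycle of length one in the switching adapted to its edge.\<close>

lemma depth0_graph_no_loop:
  assumes N: "is_net N" and "DR_acyclic N"
  shows "(u, e, u) \<notin> depth0_graph N"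
proof
  assume u: "(u, e, u) \<in> depth0_graph N"
  let ?s = "\<lambda>m. if {e} \<inter> prems m \<noteq> {} then SOME e'. e' \<in> {e} \<inter> prems m else SOME e. e \<in> prems m"
  obtain l m where "u = LinkNode m" "collapses_to N m u" "e \<in> prems m"
    "collapses_to N l u" "e \<in> concs l"
    using depth0_graph_target[OF N u] by blast
  then have "(u, e, u) \<in> switching N ?s"
    using u unfolding switching_eq by auto
  then have "cycle (switching N ?s) [(u, e, u)]"
    by (simp add: cycle_def)
  then show False
    using assms(2) switching_choice_through[of N "{e}"] unfolding DR_acyclic_def by blast
qed

text \<open>A cusp-free ring uses at most one premise of each switched link, so the switching
  adapted to its edges keeps all of it.\<close>

lemma depth0_graph_cuspfree_acyclic:
  assumes N: "is_net N" and acyc: "DR_acyclic N"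
  shows "cuspfree_acyclic (depth0_graph N) (premise_cusp N)"
proof -
  interpret cusped_graph "depth0_graph N" "premise_cusp N"
  proof
    show "finite (depth0_graph N)" "edge_determined (depth0_graph N)"
      using depth0_graph_finite depth0_graph_determined N by blast+
    show "(u, e, u) \<notin> depth0_graph N" for u e
      using depth0_graph_no_loop[OF N acyc] .
  next
    fix v e e' assume "premise_cusp N v e e'"
    then obtain m where "v = LinkNode m" "collapses_to N m (LinkNode m)" "e \<in> prems m"
      unfolding premise_cusp_def by blast
    then show "\<exists>u. (u, e, v) \<in> depth0_graph N"
      using depth0_graphI[OF N] by metis
  qed (auto simp: premise_cusp_def)
  show ?thesis
  proof
    fix p assume S: "set p \<subseteq> sym_steps (depth0_graph N)" and c: "closed_chain adm p"
      and d: "distinct (map step_source p)"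
    define E where "E = step_edge ` set p"
    define s where "s = (\<lambda>m. if E \<inter> prems m \<noteq> {} then SOME e. e \<in> E \<inter> prems m else SOME e. e \<in> prems m)"
    have sw: "(x, e, y) \<in> switching N s" if g: "(x, e, y) \<in> depth0_graph N"
      and t: "t \<in> set p" "t = (x, e, y) \<or> t = (y, e, x)" for x e y t
    proof -
      obtain l m where lm: "y = LinkNode m" "collapses_to N m y" "e \<in> prems m"
        "collapses_to N l x" "e \<in> concs l"
        using depth0_graph_target[OF N g] by blast
      have "e = s m" if "switched m"
      proof (rule ccontr)
        assume ne: "e \<noteq> s m"
        have eE: "e \<in> E" using t by (force simp: E_def)
        then have "s m \<in> E \<inter> prems m"
          using lm(3) unfolding s_def by (metis (mono_tags, lifting) IntI empty_iff someI_ex)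
        then obtain t' where t': "t' \<in> set p" "step_edge t' = s m" "s m \<in> prems m"
          unfolding E_def by auto
        obtain x' where x': "(x', s m, y) \<in> depth0_graph N"
          using depth0_graphI[OF N, of m "s m"] lm(1,2) t'(3) by metis
        then have "t' = (x', s m, y) \<or> t' = rev_step (x', s m, y)"
          using sym_steps_same_edge[OF determined, of t' "(x', s m, y)"] S t'(1,2)
          by (auto simp: sym_steps_def)
        then have "step_source t' = y \<or> step_target t' = y" by auto
        moreover have "step_source t = y \<or> step_target t = y" "step_edge t = e" using t(2) by auto
        ultimately have "\<not> premise_cusp N y e (s m)"
          using ring_incident[OF S c d t(1) t'(1), of y] t'(2) ne by metis
        then show False using lm that t'(3) by (auto simp: premise_cusp_def)
      qed
      then show ?thesis using g lm unfolding switching_eq by auto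
    qed
    have "set p \<subseteq> sym_steps (switching N s)"
    proof
      fix t assume t: "t \<in> set p"
      obtain x e y where [simp]: "t = (x, e, y)" by (cases t)
      have "(x, e, y) \<in> depth0_graph N \<or> (y, e, x) \<in> depth0_graph N"
        using S t by (auto simp: sym_steps_def)
      then show "t \<in> sym_steps (switching N s)"
        using sw[of x e y t] sw[of y e x t] t by (auto simp: sym_steps_def)
    qed
    moreover have "closed_chain linked p"
      using c by (rule closed_chain_mono) (simp add: adm_def follows_def)
    moreover have "distinct (map step_edge p)"
      using ring_edges_distinct[of p] S d closed_chain_mono[OF c, of follows]
      by (simp add: is_ring_def adm_def)
    ultimately have "cycle (switching N s) p"
      using d by (simp add: cycle_iff_closed_chain)
    then show False
      using acyc switching_choice_through[of N E] unfolding DR_acyclic_def s_def by blast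
  qed
qed

definition terminal :: "'a net \<Rightarrow> 'a link \<Rightarrow> bool" where
  "terminal N l \<longleftrightarrow> l \<in> links N \<and> (\<forall>m\<in>links N. concs l \<inter> prems m = {})"

text \<open>The links that can be peeled off without splitting the net: their rules extend a single
  net and ask for no separation. Flat and paragraph links are counted here for this reason, not for
  their polarity.\<close>

fun negative :: "'a link \<Rightarrow> bool" where
  "negative (BottomLink c) = True"
| "negative (ParLink a b c) = True"
| "negative (WhyNotLink E c) = True"
| "negative (FlatLink a c) = True"
| "negative (ParagraphLink a c) = True"
| "negative _ = False"

text \<open>In a net every of course link and every pax link is a port of some box and hence
  collapses to a box node.\<close>

lemma link_node_not_port:
  assumes "is_net N" "collapses_to N l (LinkNode k)"
  shows "l \<noteq> OfCourseLink a c" "l \<noteq> PaxLink a c"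
proof -
  have l: "l \<in> links N" "\<And>b. b \<in> boxes N \<Longrightarrow> l \<notin> box_links b" using assms(2) by auto
  show "l \<noteq> OfCourseLink a c"
  proof
    assume "l = OfCourseLink a c"
    then obtain b where "b \<in> boxes N" "l = principal b"
      using l(1) assms(1) unfolding is_net_def by metis
    then show False using l(2) principal_in_box by metis
  qed
  show "l \<noteq> PaxLink a c"
  proof
    assume "l = PaxLink a c"
    then obtain b where "b \<in> boxes N" "l \<in> auxiliary b"
      using l(1) assms(1) unfolding is_net_def by metis
    then show False using l(2) by (auto simp: box_links_def ports_def)
  qed
qed

lemma dual_neq: "dual A \<noteq> A"
  by (induction A) auto

text \<open>The target of a maximal step is a link node with no edge below it, so its link is
  terminal. Having a premise and being neither a port nor negative, it is a cut or a tensor; as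
  these are not switched, it carries no cusp, and the maximal step lies on no ring. So its two
  premises come from different components of the rest.\<close>

lemma splitting_link:
  assumes N: "is_net N" and acyc: "DR_acyclic N" and ne: "depth0_graph N \<noteq> {}"
    and noneg: "\<And>l. terminal N l \<Longrightarrow> \<not> negative l"
  obtains l a b x x' X where "collapses_to N l (LinkNode l)" "terminal N l"
    "l = CutLink a b \<or> (\<exists>c. l = TensorLink a b c)"
    "(x, a, LinkNode l) \<in> depth0_graph N" "(x', b, LinkNode l) \<in> depth0_graph N"
    "x \<in> X" "x' \<notin> X" "x' \<noteq> LinkNode l" "LinkNode l \<notin> X"
    "\<forall>(u, e, v) \<in> depth0_graph N. u \<noteq> LinkNode l \<and> (v \<noteq> LinkNode l \<longrightarrow> (u \<in> X \<longleftrightarrow> v \<in> X))"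
proof -
  interpret cuspfree_acyclic "depth0_graph N" "premise_cusp N"
    by (rule depth0_graph_cuspfree_acyclic[OF N acyc])
  let ?G = "depth0_graph N"
  obtain s where s: "s \<in> ?G" "\<And>d. d \<in> ?G \<Longrightarrow> step_source d \<noteq> step_target s"
    and split: "(\<exists>e e'. premise_cusp N (step_target s) e e') \<or> (\<forall>p. is_ring p \<longrightarrow> last p \<noteq> s)"
    using splitting_vertex[OF ne] by metis
  obtain xa a0 y where s_eq: "s = (xa, a0, y)" by (cases s)
  obtain l where l: "y = LinkNode l" "collapses_to N l y" "a0 \<in> prems l"
    using depth0_graph_target[OF N, of xa a0 y] s(1) s_eq by metis
  have out: "(LinkNode l, e, v) \<notin> ?G" for e v
    using s(2)[of "(LinkNode l, e, v)"] s_eq l(1) by auto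
  have trm: "terminal N l"
    unfolding terminal_def
  proof (intro conjI ballI)
    show "l \<in> links N" using collapses_in_links[OF N l(2)] .
    fix m assume m: "m \<in> links N"
    obtain z where z: "collapses_to N m z" using collapses_exists[OF N m] by blast
    show "concs l \<inter> prems m = {}"
    proof (rule ccontr)
      assume "concs l \<inter> prems m \<noteq> {}"
      then obtain e where "e \<in> concs l" "e \<in> prems m" by blast
      then have "(LinkNode l, e, z) \<in> ?G"
        using l z unfolding depth0_graph_def by auto
      then show False using out by blast
    qed
  qed
  then have "\<not> negative l" by (rule noneg)
  have wt: "typed l" using is_netD(1)[OF N] trm by (auto simp: net_graph_def terminal_def)
  have "\<exists>a b. (l = CutLink a b \<or> (\<exists>c. l = TensorLink a b c)) \<and> prems l = {a, b}"
    using \<open>\<not> negative l\<close> l(3) link_node_not_port[OF N l(2)[unfolded l(1)]] by (cases l) auto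
  then obtain a b where ab: "l = CutLink a b \<or> (\<exists>c. l = TensorLink a b c)" "prems l = {a, b}"
    by blast
  obtain b0 where b0: "prems l = {a0, b0}" "{a, b} = {a0, b0}" using ab(2) l(3) by auto
  have "a \<noteq> b"
  proof
    assume "a = b"
    then show False using ab(1) wt
    proof (elim disjE exE)
      assume "l = CutLink a b"
      then show False using wt \<open>a = b\<close> by (auto simp: dual_neq)
    qed auto
  qed
  then have ab0: "a0 \<noteq> b0" using b0(2) by auto
  have l': "collapses_to N l (LinkNode l)" using l by simp
  have "b0 \<in> prems l" using b0 by simp
  from depth0_graphI[OF N l' this] obtain xb where xb: "(xb, b0, y) \<in> ?G"
    unfolding l(1) by metis
  have xa: "(xa, a0, y) \<in> ?G" using s s_eq by simp
  have "\<not> switched l" using ab(1) by auto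
  then have noring: "\<not> (is_ring p \<and> last p = s)" for p
    using split l(1) s_eq by (auto simp: premise_cusp_def)
  \<comment> \<open>The graph without the node \<open>y\<close>: no edge leaves \<open>y\<close>, so
    it suffices to drop those entering it.\<close>
  define H where "H = {d \<in> ?G. step_target d \<noteq> y}"
  have Hy: "step_source d \<noteq> y" "step_target d \<noteq> y" "step_edge d \<noteq> a0" "step_edge d \<noteq> b0"
    if "d \<in> sym_steps H" for d
  proof -
    have *: "step_source d \<noteq> y \<and> step_target d \<noteq> y \<and> step_edge d \<noteq> a0 \<and> step_edge d \<noteq> b0" if "d \<in> H" for d
    proof -
      have d: "d \<in> ?G" "step_target d \<noteq> y" using that by (simp_all add: H_def)
      have "step_source d \<noteq> y" using s(2)[OF d(1)] s_eq by simp
      moreover have "step_edge d \<noteq> a0"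
        using determined d xa unfolding edge_determined_def inj_on_def by (metis step_simps(2,3))
      moreover have "step_edge d \<noteq> b0"
        using determined d xb unfolding edge_determined_def inj_on_def by (metis step_simps(2,3))
      ultimately show ?thesis using d by blast
    qed
    show "step_source d \<noteq> y" "step_target d \<noteq> y" "step_edge d \<noteq> a0" "step_edge d \<noteq> b0"
      using *[of d] *[of "rev_step d"] that by (auto simp: sym_steps_def)
  qed
  have detH: "edge_determined H"
    using determined unfolding edge_determined_def inj_on_def H_def by blast
  have xy: "xa \<noteq> y" "xb \<noteq> y" using no_loop xa xb by metis+
  \<comment> \<open>A path between the sources of the two premises would close up through
    \<open>y\<close> to a ring ending in \<open>s\<close>.\<close>
  have nconn: "(xb, xa) \<notin> (adjacent_in H)\<^sup>*"
  proof
    assume "(xb, xa) \<in> (adjacent_in H)\<^sup>*"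
    from connected_imp_spath[OF this] obtain p where p: "spath H xb p xa" ..
    note pp = spath_props[OF p]
    let ?p = "(y, b0, xb) # p @ [s]"
    have sub: "set ?p \<subseteq> sym_steps ?G"
      using pp(1) xb s(1) by (auto simp: sym_steps_def H_def)
    have de: "distinct (map step_edge p)" by (rule spath_distinct_edges[OF detH p])
    have pf: "successively follows p"
      using pp(2) de by (induction p) (auto simp: successively_Cons follows_def)
    have "closed_chain follows ?p"
    proof (cases "p = []")
      case True
      then show ?thesis using pp(7) ab0 s_eq by (auto simp: closed_chain_def follows_def)
    next
      case False
      then have "hd p \<in> sym_steps H" "last p \<in> sym_steps H" using pp(1) by auto
      then have "step_edge (hd p) \<noteq> b0" "step_edge (last p) \<noteq> a0" using Hy by blast+
      then show ?thesis
        using pp(5,6) False pf ab0 s_eq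
        by (auto simp: closed_chain_def successively_append_iff successively_Cons follows_def)
    qed
    moreover have "distinct (map step_source ?p)"
    proof -
      have "y \<notin> step_source ` set p" using pp(1) Hy by (metis imageE subsetD)
      then show ?thesis using pp(3,4) xy s_eq by auto
    qed
    ultimately have "is_ring ?p" using sub by (simp add: is_ring_def)
    then show False using noring[of ?p] by simp
  qed
  define Y where "Y = {z. (xb, z) \<in> (adjacent_in H)\<^sup>*}"
  have yY: "y \<notin> Y"
  proof
    assume "y \<in> Y"
    then have "(xb, y) \<in> (adjacent_in H)\<^sup>*" by (simp add: Y_def)
    then show False
    proof (cases rule: rtranclE)
      case base
      then show False using xy by simp
    next
      case (step z)
      from step(2) obtain e where "(z, e, y) \<in> sym_steps H" unfolding adjacent_in_iff ..
      then show False using Hy(2)[of "(z, e, y)"] by simp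
    qed
  qed
  have closed: "u \<in> Y \<longleftrightarrow> v \<in> Y" if uv: "(u, e, v) \<in> ?G" "v \<noteq> LinkNode l" for u e v
  proof -
    have "(u, e, v) \<in> sym_steps H" using uv l(1) by (simp add: H_def sym_steps_def)
    then have uv': "(u, v) \<in> adjacent_in H" unfolding adjacent_in_iff ..
    show ?thesis
      unfolding Y_def mem_Collect_eq
      using rtrancl_into_rtrancl[OF _ uv'] rtrancl_into_rtrancl[OF _ adjacent_in_sym[OF uv']] by metis
  qed
  have "xb \<in> Y" "xa \<notin> Y" using nconn by (auto simp: Y_def)
  \<comment> \<open>It is open which premise the maximal step uses. So \<open>X\<close> is the
    component of \<open>xb\<close> or the rest without \<open>y\<close>, whichever contains the
    source of \<open>a\<close>.\<close>
  show ?thesis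
  proof (cases "a = b0")
    case True
    then have "b = a0" using b0(2) ab0 by (metis doubleton_eq_iff)
    show ?thesis
    proof (rule that[OF l' trm ab(1), of xb xa Y])
      show "\<forall>(u, e, v) \<in> ?G. u \<noteq> LinkNode l \<and> (v \<noteq> LinkNode l \<longrightarrow> (u \<in> Y \<longleftrightarrow> v \<in> Y))"
        using closed out by blast
    qed (use xa xb True \<open>b = a0\<close> l(1) \<open>xb \<in> Y\<close> \<open>xa \<notin> Y\<close> xy yY in simp_all)
  next
    case False
    then have *: "a = a0" "b = b0" using b0(2) ab0 by (metis doubleton_eq_iff)+
    show ?thesis
    proof (rule that[OF l' trm ab(1), of xa xb "- Y - {y}"])
      show "\<forall>(u, e, v) \<in> ?G. u \<noteq> LinkNode l \<and>
          (v \<noteq> LinkNode l \<longrightarrow> (u \<in> - Y - {y} \<longleftrightarrow> v \<in> - Y - {y}))"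
        using closed out l(1) by blast
    qed (use xa xb * l(1) \<open>xb \<in> Y\<close> \<open>xa \<notin> Y\<close> xy in simp_all)
  qed
qed

section \<open>Sequentialization\<close>

definition part :: "'a net \<Rightarrow> 'a node set \<Rightarrow> 'a link set" where
  "part N X = {k \<in> links N. \<exists>x\<in>X. collapses_to N k x}"

definition sub_net :: "'a net \<Rightarrow> 'a node set \<Rightarrow> 'a net" where
  "sub_net N X = Net (part N X) {b \<in> boxes N. box_links b \<subseteq> part N X}"

text \<open>Closure under predecessors keeps the premises together with the links concluding them,
  which makes \<open>part N X\<close> a net. Edges leaving \<open>X\<close> become conclusions of
  the part.\<close>

definition up_closed :: "'a net \<Rightarrow> 'a node set \<Rightarrow> bool" where
  "up_closed N X \<longleftrightarrow> (\<forall>u e v. (u, e, v) \<in> depth0_graph N \<longrightarrow> v \<in> X \<longrightarrow> u \<in> X)"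

lemma sub_net_simps [simp]:
  "links (sub_net N X) = part N X" "boxes (sub_net N X) = {b \<in> boxes N. box_links b \<subseteq> part N X}"
  by (simp_all add: sub_net_def)

text \<open>A box collapses to one node, so it lies in a part wholly or not at all.\<close>

lemma part_box:
  assumes N: "is_net N" and b: "b \<in> boxes N" and k: "k \<in> box_links b" "k \<in> part N X"
  shows "box_links b \<subseteq> part N X"
proof
  fix k' assume k': "k' \<in> box_links b"
  obtain x where x: "x \<in> X" "collapses_to N k x" using k(2) by (auto simp: part_def)
  have "collapses_to N k' x" by (rule box_collapses[OF N b k(1) k' x(2)])
  then show "k' \<in> part N X" using x(1) collapses_in_links[OF N] by (auto simp: part_def)
qed

lemma part_upward:
  assumes N: "is_net N" and X: "up_closed N X"
    and k: "k \<in> part N X" "e \<in> prems k" and m: "m \<in> links N" "e \<in> concs m"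
  shows "m \<in> part N X"
proof -
  obtain x where x: "x \<in> X" "collapses_to N k x" using k(1) by (auto simp: part_def)
  obtain y where y: "collapses_to N m y" using collapses_exists[OF N m(1)] by blast
  have "y \<in> X"
  proof (cases "\<exists>b. y = BoxNode b \<and> x = BoxNode b")
    case False
    then have "(y, e, x) \<in> depth0_graph N"
      using x y k m unfolding depth0_graph_def by blast
    then show ?thesis using X x(1) unfolding up_closed_def by blast
  qed (use x in auto)
  then show ?thesis using y m by (auto simp: part_def)
qed

lemma sub_net_is_net:
  assumes N: "is_net N" and X: "up_closed N X"
  shows "is_net (sub_net N X)"
  unfolding is_net_def sub_net_simps
proof (intro conjI allI ballI impI)
  show "net_graph (part N X)"
  proof (rule net_graph_subset[OF is_netD(1)[OF N]])
    fix l e assume le: "l \<in> part N X" "e \<in> prems l"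
    then have "e \<in> edges N" using edges_ofI(1) by (auto simp: part_def)
    then obtain m where "m \<in> links N" "e \<in> concs m"
      using net_graph_concluded[OF is_netD(1)[OF N]] by blast
    then show "\<exists>m\<in>part N X. e \<in> concs m" using part_upward[OF N X le] by blast
  qed (auto simp: part_def)
next
  fix b assume "b \<in> {b \<in> boxes N. box_links b \<subseteq> part N X}"
  then show "delimits_box (part N X) b"
    using is_netD(2)[OF N, of b] by (auto simp: delimits_box_def)
next
  fix a c assume l: "OfCourseLink a c \<in> part N X"
  then have "OfCourseLink a c \<in> links N" by (simp add: part_def)
  then obtain b where b: "b \<in> boxes N" "OfCourseLink a c = principal b"
    using N unfolding is_net_def by metis
  then have "box_links b \<subseteq> part N X"
    using part_box[OF N b(1) principal_in_box] l by simp
  then show "\<exists>!b. b \<in> {b \<in> boxes N. box_links b \<subseteq> part N X} \<and> OfCourseLink a c = principal b"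
    using b principal_unique[OF N] by (intro ex1I[of _ b]) auto
next
  fix a c assume l: "PaxLink a c \<in> part N X"
  then have "PaxLink a c \<in> links N" by (simp add: part_def)
  then have ex1: "\<exists>!b. b \<in> boxes N \<and> PaxLink a c \<in> auxiliary b"
    using N unfolding is_net_def by metis
  then obtain b where b: "b \<in> boxes N" "PaxLink a c \<in> auxiliary b" by blast
  then have "box_links b \<subseteq> part N X"
    using part_box[OF N b(1) _ l] by (simp add: box_links_def ports_def)
  then show "\<exists>!b. b \<in> {b \<in> boxes N. box_links b \<subseteq> part N X} \<and> PaxLink a c \<in> auxiliary b"
    using b ex1 by (intro ex1I[of _ b]) auto
next
  fix b b' assume "b \<in> {b \<in> boxes N. box_links b \<subseteq> part N X}" "b' \<in> {b \<in> boxes N. box_links b \<subseteq> part N X}" "b \<noteq> b'"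
  then show "box_links b \<inter> box_links b' = {} \<or> box_links b \<subseteq> content b' \<or> box_links b' \<subseteq> content b"
    using is_netD(3)[OF N] by blast
qed

text \<open>Dropping boxes could make an inner box outermost, but a box around a box of the part
  shares links with it and so lies in the part as well.\<close>

lemma collapses_sub_net:
  assumes N: "is_net N" and "collapses_to (sub_net N X) k x"
  shows "collapses_to N k x"
proof (cases x)
  case (LinkNode m)
  then have k: "x = LinkNode k" "k \<in> part N X"
    "\<And>b. b \<in> boxes N \<Longrightarrow> box_links b \<subseteq> part N X \<Longrightarrow> k \<notin> box_links b"
    using assms(2) by auto
  then have "k \<notin> box_links b" if "b \<in> boxes N" for b
    using part_box[OF N that _ k(2)] k(3)[OF that] by blast
  then show ?thesis using k(1,2) by (simp add: part_def)
next
  case (BoxNode b)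
  then have b: "b \<in> boxes N" "box_links b \<subseteq> part N X" "k \<in> box_links b"
    "\<And>b'. b' \<in> boxes N \<Longrightarrow> box_links b' \<subseteq> part N X \<Longrightarrow> \<not> box_links b \<subseteq> content b'"
    using assms(2) by (auto simp: outermost_boxes_def)
  have "\<not> box_links b \<subseteq> content b'" if b': "b' \<in> boxes N" for b'
  proof
    assume sub: "box_links b \<subseteq> content b'"
    have "principal b \<in> part N X" "principal b \<in> box_links b'"
      using b(2) sub principal_in_box[of b] by (auto simp: box_links_def)
    then have "box_links b' \<subseteq> part N X" using part_box[OF N b'] by blast
    then show False using b(4)[OF b'] sub by blast
  qed
  then show ?thesis using b BoxNode by (simp add: outermost_boxes_def)
qed

text \<open>A switching of the sub-net extends to one of \<open>N\<close> by arbitrary choices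
  elsewhere, and its graph is a subgraph. The nets inside the boxes stay the same.\<close>

lemma sub_net_DR_correct:
  assumes N: "is_net N" and DR: "DR_correct N"
  shows "DR_correct (sub_net N X)"
  unfolding DR_correct_iff[of "sub_net N X"]
proof
  show "DR_acyclic (sub_net N X)"
    unfolding DR_acyclic_def
  proof (intro allI impI notI)
    fix s p assume s: "switching_choice (sub_net N X) s" and p: "cycle (switching (sub_net N X) s) p"
    let ?s = "\<lambda>m. if m \<in> part N X then s m else SOME e. e \<in> prems m"
    have "switching_choice N ?s"
      using s unfolding switching_choice_def by (auto intro: some_in_eq[THEN iffD2])
    moreover have "switching (sub_net N X) s \<subseteq> switching N ?s"
    proof -
      have "\<exists>l m. collapses_to N l x \<and> collapses_to N m y \<and> e \<in> concs l \<and> e \<in> prems m \<and> (switched m \<longrightarrow> e = ?s m)"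
        if lm: "collapses_to (sub_net N X) l x" "collapses_to (sub_net N X) m y"
          "e \<in> concs l" "e \<in> prems m" "switched m \<longrightarrow> e = s m" for l m x e y
      proof -
        have "m \<in> part N X" using lm(2) by (cases y) (auto simp: outermost_boxes_def)
        then show ?thesis
          using collapses_sub_net[OF N lm(1)] collapses_sub_net[OF N lm(2)] lm(3-5)
          by (intro exI[of _ l] exI[of _ m]) simp
      qed
      then show ?thesis unfolding switching_def by blast
    qed
    ultimately show False
      using DR cycle_mono[OF p] unfolding DR_correct_iff[of N] DR_acyclic_def by blast
  qed
  show "\<forall>b\<in>boxes (sub_net N X). DR_correct (box_net (sub_net N X) b)"
  proof
    fix b assume "b \<in> boxes (sub_net N X)"
    then have b: "b \<in> boxes N" "content b \<subseteq> part N X" by (auto simp: box_links_def)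
    then have "box_net (sub_net N X) b = box_net N b" by (auto simp: box_net_def)
    then show "DR_correct (box_net (sub_net N X) b)"
      using DR b(1) unfolding DR_correct_iff[of N] by simp
  qed
qed

lemma boxes_sub_net_split:
  assumes N: "is_net N" and "\<And>b. BoxNode b \<in> X \<union> Y"
  shows "boxes N = boxes (sub_net N X) \<union> boxes (sub_net N Y)"
proof -
  have "box_links b \<subseteq> part N X \<or> box_links b \<subseteq> part N Y" if b: "b \<in> boxes N" for b
  proof -
    have "principal b \<in> links N"
      using delimits_boxD(1)[OF is_netD(2)[OF N b]] principal_in_box by blast
    then obtain x where x: "collapses_to N (principal b) x" using collapses_exists[OF N] by blast
    then have "x \<in> X \<union> Y" using assms(2) b principal_in_box[of b] by (cases x) auto
    then have "principal b \<in> part N X \<or> principal b \<in> part N Y"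
      using x \<open>principal b \<in> links N\<close> by (auto simp: part_def)
    then show ?thesis using part_box[OF N b principal_in_box] by blast
  qed
  then show ?thesis by auto
qed

text \<open>An up-closed part contains the concluding link of each of its edges, and that link
  collapses to only one node.\<close>

lemma sub_net_edges_disjoint:
  assumes N: "is_net N" and X: "up_closed N X" and Y: "up_closed N Y" and XY: "X \<inter> Y = {}"
  shows "edges (sub_net N X) \<inter> edges (sub_net N Y) = {}"
proof (rule ccontr)
  assume "edges (sub_net N X) \<inter> edges (sub_net N Y) \<noteq> {}"
  then obtain e l m where lm: "l \<in> part N X" "e \<in> concs l" "m \<in> part N Y" "e \<in> concs m"
    using net_graph_concluded[OF is_netD(1)[OF sub_net_is_net[OF N X]]]
      net_graph_concluded[OF is_netD(1)[OF sub_net_is_net[OF N Y]]] unfolding sub_net_simps by blast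
  then have "l = m" using net_graph_conc_unique[OF is_netD(1)[OF N]] by (auto simp: part_def)
  then show False using lm(1,3) collapses_unique[OF N] XY by (auto simp: part_def)
qed

text \<open>Inside a box every conclusion is used within the box. A cut has no conclusion and is
  \<open>terminal\<close> at any depth, whence the condition on \<open>concs l\<close>.\<close>

lemma terminal_collapses:
  assumes N: "is_net N" and "terminal N l" "concs l \<noteq> {}" "\<And>a c. l \<noteq> OfCourseLink a c"
    "\<And>a c. l \<noteq> PaxLink a c"
  shows "collapses_to N l (LinkNode l)"
proof -
  have "l \<notin> box_links b" if b: "b \<in> boxes N" for b
  proof
    assume l: "l \<in> box_links b"
    note d = delimits_boxD[OF is_netD(2)[OF N b]]
    have "l \<notin> ports b" using d(2) d(3)[of l] assms(4,5) unfolding ports_def by auto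
    then have "l \<in> content b" using l by (simp add: box_links_def)
    obtain e where e: "e \<in> concs l" using assms(3) by blast
    from box_content_conc_used[OF is_netD(2)[OF N b] \<open>l \<in> content b\<close> e]
    obtain m where "m \<in> box_links b" "e \<in> prems m" ..
    then show False using assms(2) e d(1) unfolding terminal_def by blast
  qed
  then show ?thesis using assms(2) by (simp add: terminal_def)
qed

lemma add_negative_link:
  assumes "sequentializable M" "negative l" "typed l" "prems l \<subseteq> conclusions M" "concs l \<inter> edges M = {}"
  shows "sequentializable (add_link l M)"
  using assms by (cases l) (auto intro: sequentializable.intros)

text \<open>A port found in the content of \<open>b\<close> belongs to a box lying entirely in that
  content, so the assignment of ports to boxes restricts.\<close>

lemma box_net_is_net:
  assumes N: "is_net N" and b: "b \<in> boxes N"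
  shows "is_net (box_net N b)"
proof -
  note d = delimits_boxD[OF is_netD(2)[OF N b]]
  have inner: "box_links c \<subseteq> content b" if c: "c \<in> boxes N" and l: "l \<in> ports c" "l \<in> content b" for c l
  proof -
    note dc = delimits_boxD[OF is_netD(2)[OF N c]]
    show ?thesis
      using nested_boxes[OF N c b, of l] l dc(4) by (auto simp: box_links_def)
  qed
  show ?thesis
    unfolding is_net_def box_net_def net.sel
  proof (intro conjI allI ballI impI)
    show "net_graph (content b)" by (rule d(5))
  next
    fix c assume "c \<in> {c \<in> boxes N. box_links c \<subseteq> content b}"
    then show "delimits_box (content b) c"
      using is_netD(2)[OF N, of c] by (auto simp: delimits_box_def)
  next
    fix a c assume l: "OfCourseLink a c \<in> content b"
    then have "OfCourseLink a c \<in> links N" using d(1,7) by blast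
    then obtain b' where b': "b' \<in> boxes N" "OfCourseLink a c = principal b'"
      using N unfolding is_net_def by metis
    then have "box_links b' \<subseteq> content b"
      using inner[OF b'(1), of "principal b'"] l by (simp add: ports_def)
    then show "\<exists>!b'. b' \<in> {c \<in> boxes N. box_links c \<subseteq> content b} \<and> OfCourseLink a c = principal b'"
      using b' principal_unique[OF N] by (intro ex1I[of _ b']) auto
  next
    fix a c assume l: "PaxLink a c \<in> content b"
    then have "PaxLink a c \<in> links N" using d(1,7) by blast
    then have ex1: "\<exists>!b. b \<in> boxes N \<and> PaxLink a c \<in> auxiliary b"
      using N unfolding is_net_def by metis
    then obtain b' where b': "b' \<in> boxes N" "PaxLink a c \<in> auxiliary b'" by blast
    then have "box_links b' \<subseteq> content b"
      using inner[OF b'(1) _ l] by (simp add: ports_def)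
    then show "\<exists>!b'. b' \<in> {c \<in> boxes N. box_links c \<subseteq> content b} \<and> PaxLink a c \<in> auxiliary b'"
      using b' ex1 by (intro ex1I[of _ b']) auto
  next
    fix c c' assume "c \<in> {c \<in> boxes N. box_links c \<subseteq> content b}" "c' \<in> {c \<in> boxes N. box_links c \<subseteq> content b}" "c \<noteq> c'"
    then show "box_links c \<inter> box_links c' = {} \<or> box_links c \<subseteq> content c' \<or> box_links c' \<subseteq> content c"
      using is_netD(3)[OF N] by blast
  qed
qed

text \<open>Recovers the data of the \<open>box\<close> rule from the ports. \<open>f\<close>
  describes the pax links because an edge is a premise of at most one link, and it is injective
  because an edge is a conclusion of only one.\<close>

lemma single_box_sequentializable:
  assumes N: "is_net N" and b: "b \<in> boxes N" and all: "links N = box_links b"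
    and inner: "sequentializable (box_net N b)"
  shows "sequentializable N"
proof -
  note d = delimits_boxD[OF is_netD(2)[OF N b]]
  note G = is_netD(1)[OF N]
  let ?M = "box_net N b"
  obtain a c where p: "principal b = OfCourseLink a c" using d(2) by blast
  define E where "E = \<Union>(prems ` auxiliary b)"
  define f where "f e = (SOME c. PaxLink e c \<in> auxiliary b)" for e
  have sub: "ports b \<subseteq> links N" "content b \<subseteq> links N" using d(1) by (auto simp: box_links_def)
  have typed: "typed l" if "l \<in> links N" for l using G that by (auto simp: net_graph_def)
  have aux: "PaxLink e (f e) \<in> auxiliary b" if e: "e \<in> E" for e
  proof -
    obtain l where l: "l \<in> auxiliary b" "e \<in> prems l" using e by (auto simp: E_def)
    then obtain c where "l = PaxLink e c" using d(3) by fastforce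
    then show ?thesis using l(1) unfolding f_def by (metis someI)
  qed
  have auxN: "PaxLink e (f e) \<in> links N" if "e \<in> E" for e
    using aux[OF that] sub(1) by (auto simp: ports_def)
  have P: "auxiliary b = (\<lambda>e. PaxLink e (f e)) ` E"
  proof (intro equalityI subsetI)
    fix l assume l: "l \<in> auxiliary b"
    then obtain e c where ec: "l = PaxLink e c" using d(3) by blast
    then have "e \<in> E" using l by (force simp: E_def)
    moreover have "l = PaxLink e (f e)"
      using net_graph_prem_unique[OF G, of l "PaxLink e (f e)" e] l aux[OF \<open>e \<in> E\<close>] sub ec
      by (auto simp: ports_def)
    ultimately show "l \<in> (\<lambda>e. PaxLink e (f e)) ` E" by blast
  qed (use aux in auto)
  have fresh: "e \<notin> edges ?M" if "l \<in> ports b" "e \<in> concs l" for l e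
  proof
    assume "e \<in> edges ?M"
    then obtain m where "m \<in> content b" "e \<in> concs m"
      using net_graph_concluded[OF d(5)] by (auto simp: box_net_def)
    moreover have "m = l"
      using net_graph_conc_unique[OF G, of m l e] calculation that sub by blast
    ultimately show False using that d(4) by blast
  qed
  have "conclusions ?M = insert a E"
    using d(6) p by (simp add: box_net_def ports_def E_def)
  moreover have "c \<notin> edges ?M" using fresh[of "principal b" c] p by (simp add: ports_def)
  moreover have "typed (OfCourseLink a c)" using typed[of "principal b"] sub p by (simp add: ports_def)
  moreover have "inj_on f E"
  proof (rule inj_onI)
    fix e e' assume e: "e \<in> E" "e' \<in> E" "f e = f e'"
    have "PaxLink e (f e) = PaxLink e' (f e')"
      using net_graph_conc_unique[OF G, of "PaxLink e (f e)" "PaxLink e' (f e')" "f e"]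
        auxN[OF e(1)] auxN[OF e(2)] e(3) by simp
    then show "e = e'" by simp
  qed
  moreover have "f ` E \<inter> edges ?M = {}"
    using fresh aux by (fastforce simp: ports_def)
  moreover have "c \<notin> f ` E"
  proof
    assume "c \<in> f ` E"
    then obtain e where "e \<in> E" "c = f e" by blast
    then have "PaxLink e (f e) = OfCourseLink a c"
      using net_graph_conc_unique[OF G, of "PaxLink e (f e)" "OfCourseLink a c" c]
        aux sub p[symmetric] p by (auto simp: ports_def subset_iff)
    then show False by simp
  qed
  moreover have "\<forall>e\<in>E. typed (PaxLink e (f e))"
    using typed[OF auxN] by blast
  ultimately have seq: "sequentializable (Net (insert (principal b) (auxiliary b) \<union> links ?M)
      (insert (Box (principal b) (auxiliary b) (links ?M)) (boxes ?M)))"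
    using inner p P by (intro sequentializable.box) 
  have "boxes N = insert b (boxes ?M)"
  proof (intro equalityI subsetI)
    fix b' assume b': "b' \<in> boxes N"
    note d' = delimits_boxD[OF is_netD(2)[OF N b']]
    show "b' \<in> insert b (boxes ?M)"
    proof (cases "b' = b")
      case False
      moreover have "box_links b' \<inter> box_links b \<noteq> {}"
        using d'(1) all principal_in_box by blast
      moreover have "\<not> box_links b \<subseteq> content b'" using d'(1,7,8) all by blast
      ultimately show ?thesis using is_netD(3)[OF N b' b] b' by (auto simp: box_net_def)
    qed simp
  qed (use b in \<open>auto simp: box_net_def\<close>)
  then have "N = Net (insert (principal b) (auxiliary b) \<union> links ?M)
      (insert (Box (principal b) (auxiliary b) (links ?M)) (boxes ?M))"
    using all by (cases N; cases b) (simp add: box_net_def box_links_def ports_def)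
  then show ?thesis using seq by simp
qed

lemma sub_net_conclusionI:
  assumes N: "is_net N" and "k \<in> part N X" "e \<in> concs k" "l \<in> links N" "l \<notin> part N X" "e \<in> prems l"
  shows "e \<in> conclusions (sub_net N X)"
  unfolding conclusions_of_iff
proof (intro conjI ballI notI)
  show "e \<in> edges (sub_net N X)" using assms(2,3) edges_ofI(2) by fastforce
  fix m assume "m \<in> links (sub_net N X)" "e \<in> prems m"
  then have "m \<in> part N X" "m = l"
    using net_graph_prem_unique[OF is_netD(1)[OF N], of m l e] assms by (auto simp: part_def)
  then show False using assms by simp
qed

lemma conc_not_in_sub_net:
  assumes N: "is_net N" and X: "up_closed N X" and l: "l \<in> links N" "l \<notin> part N X" "e \<in> concs l"
  shows "e \<notin> edges (sub_net N X)"
proof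
  assume "e \<in> edges (sub_net N X)"
  then obtain m where m: "m \<in> part N X" "e \<in> concs m"
    using net_graph_concluded[OF is_netD(1)[OF sub_net_is_net[OF N X]]] by auto
  then have "m = l"
    using net_graph_conc_unique[OF is_netD(1)[OF N], of m l e] l by (auto simp: part_def)
  then show False using m l by simp
qed

lemma remove_terminal_negative:
  assumes N: "is_net N" and trm: "terminal N l" and neg: "negative l"
    and X: "X = - {LinkNode l}" and seq: "sequentializable (sub_net N X)"
    and up: "up_closed N X" and part: "part N X = links N - {l}"
  shows "sequentializable N"
proof -
  have lN: "l \<in> links N" using trm by (simp add: terminal_def)
  have "typed l" using is_netD(1)[OF N] lN by (auto simp: net_graph_def)
  have "prems l \<subseteq> conclusions (sub_net N X)"
  proof
    fix e assume e: "e \<in> prems l"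
    then obtain m where m: "m \<in> links N" "e \<in> concs m"
      using net_graph_concluded[OF is_netD(1)[OF N]] edges_ofI(1)[OF lN] by blast
    then have "m \<noteq> l" using trm e lN by (auto simp: terminal_def)
    then show "e \<in> conclusions (sub_net N X)"
      using sub_net_conclusionI[OF N, of m X e l] m e lN part by simp
  qed
  moreover have "concs l \<inter> edges (sub_net N X) = {}"
    using conc_not_in_sub_net[OF N up lN] part by blast
  ultimately have "sequentializable (add_link l (sub_net N X))"
    using add_negative_link seq neg \<open>typed l\<close> by blast
  moreover have "boxes N = boxes (sub_net N X)"
    using boxes_sub_net_split[OF N, of X X] X by simp
  then have eq: "N = add_link l (sub_net N X)"
    using lN part by (cases N) (auto simp: add_link_def)
  ultimately show ?thesis unfolding eq[symmetric] by blast
qed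

lemma terminal_negative_parts:
  assumes N: "is_net N" and trm: "terminal N l" and neg: "negative l"
  shows "up_closed N (- {LinkNode l})" "part N (- {LinkNode l}) = links N - {l}"
proof -
  have node: "collapses_to N l (LinkNode l)"
    using neg by (intro terminal_collapses[OF N trm]) (auto elim: negative.elims)
  show "up_closed N (- {LinkNode l})"
    unfolding up_closed_def
  proof (intro allI impI)
    fix u e v assume "(u, e, v) \<in> depth0_graph N"
    then obtain k m where km: "collapses_to N m v" "e \<in> prems m" "collapses_to N k u" "e \<in> concs k"
      using depth0_graph_target[OF N] by metis
    have "u \<noteq> LinkNode l"
    proof
      assume "u = LinkNode l"
      then have "k = l" using km(3) by simp
      then show False
        using trm km(2,4) collapses_in_links[OF N km(1)] unfolding terminal_def by blast
    qed
    then show "u \<in> - {LinkNode l}" by simp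
  qed
  have "k \<in> part N (- {LinkNode l}) \<longleftrightarrow> k \<in> links N \<and> k \<noteq> l" for k
  proof
    assume "k \<in> part N (- {LinkNode l})"
    then obtain x where "k \<in> links N" "x \<noteq> LinkNode l" "collapses_to N k x" by (auto simp: part_def)
    then show "k \<in> links N \<and> k \<noteq> l" using collapses_unique[OF N node] by blast
  next
    assume k: "k \<in> links N \<and> k \<noteq> l"
    then obtain x where x: "collapses_to N k x" using collapses_exists[OF N] by blast
    moreover have "x \<noteq> LinkNode l" using x k by auto
    ultimately show "k \<in> part N (- {LinkNode l})" using k by (auto simp: part_def)
  qed
  then show "part N (- {LinkNode l}) = links N - {l}" by blast
qed

lemma split_sub_nets:
  assumes N: "is_net N" and X: "up_closed N X" and Y: "up_closed N Y" and XY: "X \<inter> Y = {}"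
    and l: "l = CutLink a b \<or> (\<exists>c. l = TensorLink a b c)" "l \<in> links N"
    and "links N = insert l (part N X \<union> part N Y)" "l \<notin> part N X" "l \<notin> part N Y"
    and "\<And>b. BoxNode b \<in> X \<union> Y"
    and ka: "ka \<in> part N X" "a \<in> concs ka" and kb: "kb \<in> part N Y" "b \<in> concs kb"
    and seq: "sequentializable (sub_net N X)" "sequentializable (sub_net N Y)"
  shows "sequentializable N"
proof -
  have prems: "a \<in> prems l" "b \<in> prems l" using l(1) by auto
  have typed: "typed l" using is_netD(1)[OF N] l(2) by (auto simp: net_graph_def)
  have a: "a \<in> conclusions (sub_net N X)"
    by (rule sub_net_conclusionI[OF N ka l(2) assms(8) prems(1)])
  have b: "b \<in> conclusions (sub_net N Y)"
    by (rule sub_net_conclusionI[OF N kb l(2) assms(9) prems(2)])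
  have disj: "edges (sub_net N X) \<inter> edges (sub_net N Y) = {}"
    by (rule sub_net_edges_disjoint[OF N X Y XY])
  have fresh: "e \<notin> edges (sub_net N X) \<union> edges (sub_net N Y)" if "e \<in> concs l" for e
    using conc_not_in_sub_net[OF N X l(2) assms(8) that] conc_not_in_sub_net[OF N Y l(2) assms(9) that]
    by blast
  have eq: "N = add_link l (juxtapose (sub_net N X) (sub_net N Y))"
    using assms(7) boxes_sub_net_split[OF N, of X Y] assms(10)
    by (cases N) (simp add: add_link_def juxtapose_def)
  show ?thesis
  proof (cases l)
    case (CutLink a' b')
    then have "l = CutLink a b" using l(1) by auto
    then have "sequentializable (add_link l (juxtapose (sub_net N X) (sub_net N Y)))"
      using sequentializable.cut[OF seq disj a b] typed by simp
    then show ?thesis unfolding eq[symmetric] .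
  next
    case (TensorLink a' b' c)
    then have "l = TensorLink a b c" using l(1) by auto
    then have "sequentializable (add_link l (juxtapose (sub_net N X) (sub_net N Y)))"
      using sequentializable.tensor[OF seq disj a b, of c] typed fresh[of c] by simp
    then show ?thesis unfolding eq[symmetric] .
  qed (use l(1) in auto)
qed

text \<open>Induction on the number of links. Parts given by up-closed sets and contents of boxes
  inherit the hypotheses, so only something to peel is needed: a terminal negative link, else a
  splitting cut or tensor, else, with no edge left at depth zero, an isolated node.\<close>

theorem DR_correct_imp_sequentializable:
  "is_net N \<Longrightarrow> DR_correct N \<Longrightarrow> sequentializable N"
proof (induction "card (links N)" arbitrary: N rule: less_induct)
  case less
  note N = less.prems(1)
  have fin: "finite (links N)" using is_netD(1)[OF N] net_graph_finite by blast
  have acyc: "DR_acyclic N" using less.prems(2) DR_correct_iff by blast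
  have sub: "sequentializable (sub_net N X)" if "up_closed N X" "k \<in> links N" "k \<notin> part N X" for X k
  proof -
    have "part N X \<subset> links N" using that by (auto simp: part_def)
    then have "card (links (sub_net N X)) < card (links N)"
      using fin by (simp add: psubset_card_mono)
    then show ?thesis
      using less.hyps sub_net_is_net[OF N that(1)] sub_net_DR_correct[OF less.prems] by blast
  qed
  have part_iff: "k \<in> part N X \<longleftrightarrow> x \<in> X" if "collapses_to N k x" for k x X
    using that collapses_unique[OF N that] collapses_in_links[OF N that] unfolding part_def by blast
  show ?case
  proof (cases "\<exists>l. terminal N l \<and> negative l")
    case True
    then obtain l where l: "terminal N l" "negative l" by blast
    note P = terminal_negative_parts[OF N l]
    have "sequentializable (sub_net N (- {LinkNode l}))"
      using sub[OF P(1), of l] P(2) l(1) by (simp add: terminal_def)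
    from remove_terminal_negative[OF N l refl this P] show ?thesis .
  next
    case noneg: False
    show ?thesis
    proof (cases "depth0_graph N = {}")
      case False
      have nn: "\<And>l. terminal N l \<Longrightarrow> \<not> negative l" using noneg by blast
      obtain l a b x x' X where l: "collapses_to N l (LinkNode l)" "terminal N l"
        "l = CutLink a b \<or> (\<exists>c. l = TensorLink a b c)"
        and ab: "(x, a, LinkNode l) \<in> depth0_graph N" "(x', b, LinkNode l) \<in> depth0_graph N"
        and x: "x \<in> X" "x' \<notin> X" "x' \<noteq> LinkNode l" "LinkNode l \<notin> X"
        and XG: "\<forall>(u, e, v) \<in> depth0_graph N. u \<noteq> LinkNode l \<and>
          (v \<noteq> LinkNode l \<longrightarrow> (u \<in> X \<longleftrightarrow> v \<in> X))"
        by (rule splitting_link[OF N acyc False nn])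
      have X: "\<And>u e v. (u, e, v) \<in> depth0_graph N \<Longrightarrow> v \<noteq> LinkNode l \<Longrightarrow> u \<in> X \<longleftrightarrow> v \<in> X"
        and out: "\<And>e v. (LinkNode l, e, v) \<notin> depth0_graph N"
        using XG by fast+
      define Y where "Y = - X - {LinkNode l}"
      have lN: "l \<in> links N" using l(2) by (simp add: terminal_def)
      have upX: "up_closed N X" unfolding up_closed_def using X x(4) by metis
      have upY: "up_closed N Y"
        unfolding up_closed_def
      proof (intro allI impI)
        fix u e v assume uv: "(u, e, v) \<in> depth0_graph N" "v \<in> Y"
        then have "u \<noteq> LinkNode l" using out by metis
        then show "u \<in> Y" using X[OF uv(1)] uv(2) by (simp add: Y_def)
      qed
      have lX: "l \<notin> part N X" "l \<notin> part N Y"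
        using part_iff[OF l(1)] x(4) by (simp_all add: Y_def)
      have "k \<in> insert l (part N X \<union> part N Y)" if k: "k \<in> links N" for k
      proof -
        obtain z where z: "collapses_to N k z" using collapses_exists[OF N k] by blast
        show ?thesis
        proof (cases "z = LinkNode l")
          case True
          then show ?thesis using z by simp
        next
          case False
          then show ?thesis using part_iff[OF z] by (simp add: Y_def)
        qed
      qed
      then have links: "links N = insert l (part N X \<union> part N Y)"
        using lN by (auto simp: part_def)
      obtain ka where ka: "collapses_to N ka x" "a \<in> concs ka"
        using depth0_graph_target[OF N ab(1)] by metis
      obtain kb where kb: "collapses_to N kb x'" "b \<in> concs kb"
        using depth0_graph_target[OF N ab(2)] by metis
      have box: "BoxNode b \<in> X \<union> Y" for b by (simp add: Y_def)
      have kaX: "ka \<in> part N X" and kbY: "kb \<in> part N Y"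
        using part_iff[OF ka(1)] part_iff[OF kb(1)] x by (simp_all add: Y_def)
      show ?thesis
        by (rule split_sub_nets[OF N upX upY _ l(3) lN links lX box kaX ka(2) kbY kb(2)
              sub[OF upX lN lX(1)] sub[OF upY lN lX(2)]]) (auto simp: Y_def)
    next
      case empty: True
      \<comment> \<open>Without edges every set of nodes is up-closed, so one node can be juxtaposed
        with all the others.\<close>
      have up: "up_closed N X" for X using empty by (simp add: up_closed_def)
      show ?thesis
      proof (cases "links N = {}")
        case True
        have "boxes N = {}"
          using True delimits_boxD(1)[OF is_netD(2)[OF N]] principal_in_box by blast
        then have "N = Net {} {}" using True by (cases N) simp
        then show ?thesis using sequentializable.empty by simp
      next
        case False
        then obtain k z where k: "k \<in> links N" "collapses_to N k z"
          using collapses_exists[OF N] by blast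
        have kz: "k \<in> part N {z}" "k \<notin> part N (- {z})" using part_iff[OF k(2)] by simp_all
        show ?thesis
        proof (cases "part N (- {z}) = {}")
          case False
          then obtain k' z' where k': "k' \<in> links N" "collapses_to N k' z'" "z' \<noteq> z"
            by (auto simp: part_def)
          then have "k' \<notin> part N {z}" using part_iff[OF k'(2)] by simp
          then have seq: "sequentializable (sub_net N {z})" "sequentializable (sub_net N (- {z}))"
            using sub[OF up] k k'(1) kz(2) by blast+
          have links: "links N = part N {z} \<union> part N (- {z})"
          proof -
            have "j \<in> part N {z} \<union> part N (- {z})" if j: "j \<in> links N" for j
            proof -
              obtain w where "collapses_to N j w" using collapses_exists[OF N j] by blast
              then show ?thesis using part_iff by simp
            qed
            then show ?thesis by (auto simp: part_def)
          qed
          have eq: "N = juxtapose (sub_net N {z}) (sub_net N (- {z}))"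
            using links boxes_sub_net_split[OF N, of "{z}" "- {z}"]
            by (cases N) (simp add: juxtapose_def)
          have "sequentializable (juxtapose (sub_net N {z}) (sub_net N (- {z})))"
            using sequentializable.juxtaposition[OF seq sub_net_edges_disjoint[OF N up up]] by blast
          then show ?thesis unfolding eq[symmetric] .
        next
          case True
          have all: "collapses_to N j z" if j: "j \<in> links N" for j
          proof -
            obtain w where w: "collapses_to N j w" using collapses_exists[OF N j] by blast
            have "j \<notin> part N (- {z})" using True by blast
            then have "w = z" using part_iff[OF w] by simp
            then show ?thesis using w by simp
          qed
          show ?thesis
          proof (cases z)
            case (BoxNode b)
            then have b: "b \<in> boxes N" using k(2) by (simp add: outermost_boxes_def)
            note d = delimits_boxD[OF is_netD(2)[OF N b]]
            have links: "links N = box_links b"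
              using d(1) all BoxNode by auto
            have "content b \<subset> links N"
              using links d(7,8) by blast
            then have "card (links (box_net N b)) < card (links N)"
              using fin by (simp add: box_net_def psubset_card_mono)
            then have "sequentializable (box_net N b)"
              using less.hyps box_net_is_net[OF N b] less.prems(2) b DR_correct_iff by blast
            then show ?thesis by (rule single_box_sequentializable[OF N b links])
          next
            case (LinkNode l)
            then have "l = k" using k(2) by simp
            have links: "links N = {k}" using all LinkNode k by auto
            have "boxes N = {}"
            proof (rule ccontr)
              assume "boxes N \<noteq> {}"
              then obtain b where b: "b \<in> boxes N" by blast
              have "principal b \<in> links N"
                using delimits_boxD(1)[OF is_netD(2)[OF N b]] principal_in_box by blast
              then show False using all[of "principal b"] LinkNode b principal_in_box[of b] by auto
            qed
            then have Neq: "N = Net {k} {}" using links by (cases N) simp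
            have knode: "collapses_to N k (LinkNode k)" using k(2) LinkNode \<open>l = k\<close> by simp
            have noprem: "prems k = {}"
            proof (rule ccontr)
              assume "prems k \<noteq> {}"
              then obtain e where "e \<in> prems k" by blast
              from depth0_graphI[OF N knode this] show False using empty by auto
            qed
            then have "terminal N k" using links by (simp add: terminal_def)
            \<comment> \<open>Bottom links and why not links without premises are negative, so an
              axiom or a one link remains.\<close>
            then have "\<not> negative k" using noneg by blast
            moreover have "typed k" using is_netD(1)[OF N] k(1) by (auto simp: net_graph_def)
            ultimately show ?thesis
              using noprem link_node_not_port[OF N knode] unfolding Neq
              by (cases k) (auto intro: sequentializable.intros)
          qed
        qed
      qed
    qed
  qed
qed

section \<open>Correctness of sequentializable nets\<close>

lemma chain_connected:
  assumes "set q \<subseteq> sym_steps H" "successively linked (q @ [t])"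
  shows "(step_source (hd (q @ [t])), step_source t) \<in> (adjacent_in H)\<^sup>*"
  using assms
proof (induction q)
  case (Cons s q)
  have "step_target s = step_source (hd (q @ [t]))"
    using Cons.prems(2) by (cases q) auto
  moreover have "(step_source s, step_target s) \<in> adjacent_in H"
    using Cons.prems(1) unfolding adjacent_in_def set_simps by blast
  moreover have "(step_source (hd (q @ [t])), step_source t) \<in> (adjacent_in H)\<^sup>*"
    using Cons by (simp add: successively_Cons)
  ultimately show ?case
    by (simp add: converse_rtrancl_into_rtrancl)
qed simp

text \<open>A cycle in the larger graph must pass \<open>v\<close>. It leaves and re-enters
  \<open>v\<close> by two different edges of \<open>K\<close>, and its remaining steps connect their
  sources within \<open>H\<close>.\<close>

lemma acyclic_add_vertex:
  assumes noH: "\<And>p. \<not> cycle H p"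
    and H: "\<And>s. s \<in> H \<Longrightarrow> step_source s \<noteq> v \<and> step_target s \<noteq> v"
    and K: "\<And>s. s \<in> K \<Longrightarrow> step_source s \<noteq> v \<and> step_target s = v"
    and sep: "\<And>s t. s \<in> K \<Longrightarrow> t \<in> K \<Longrightarrow> step_edge s \<noteq> step_edge t \<Longrightarrow>
      (step_source s, step_source t) \<notin> (adjacent_in H)\<^sup>*"
  shows "\<not> cycle (H \<union> K) p"
proof
  assume p: "cycle (H \<union> K) p"
  have avoid: "s \<in> sym_steps H" if "s \<in> sym_steps (H \<union> K)" "step_source s \<noteq> v" "step_target s \<noteq> v" for s
    using that K[of s] K[of "rev_step s"] unfolding sym_steps_def
    by (simp only: mem_Collect_eq Un_iff step_simps) blast
  show False
  proof (cases "v \<in> step_source ` set p")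
    case False
    have c: "closed_chain linked p" using p by (simp add: cycle_iff_closed_chain)
    have ts: "step_target ` set p = step_source ` set p"
      using closed_chain_targets[OF c] by (metis set_map set_rotate1)
    have "set p \<subseteq> sym_steps H"
    proof
      fix s assume s: "s \<in> set p"
      have "step_source s \<noteq> v" "step_target s \<noteq> v"
        using False ts imageI[OF s, of step_source] imageI[OF s, of step_target] by metis+
      moreover have "s \<in> sym_steps (H \<union> K)" using p s by (auto simp: cycle_iff_closed_chain)
      ultimately show "s \<in> sym_steps H" using avoid by metis
    qed
    then have "cycle H p" using p by (simp add: cycle_iff_closed_chain)
    then show False using noH by metis
  next
    case True
    then obtain s where s: "s \<in> set p" "step_source s = v" by (metis imageE)
    then obtain xs ys where "p = xs @ (s # ys)" by (metis split_list)
    then have c: "cycle (H \<union> K) (s # (ys @ xs))"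
      using cycle_rotate[of "H \<union> K" xs "s # ys"] p by simp
    \<comment> \<open>The cycle is rotated to start at \<open>v\<close>: its first and last steps
      use edges of \<open>K\<close>, and all steps between them avoid \<open>v\<close>.\<close>
    define q where "q = ys @ xs"
    have S: "s \<in> sym_steps (H \<union> K)" "set q \<subseteq> sym_steps (H \<union> K)"
      and cl: "closed_chain linked (s # q)" and d: "distinct (map step_source (s # q))"
      and e: "distinct (map step_edge (s # q))"
      using c by (auto simp: cycle_iff_closed_chain q_def)
    have sK: "rev_step s \<in> K"
      using S(1) s(2) H[of s] H[of "rev_step s"] K[of s] unfolding sym_steps_def
      by (simp only: mem_Collect_eq Un_iff step_simps) blast
    have sv: "step_target s \<noteq> v" using K[OF sK] by simp
    have "q \<noteq> []"
      using cl sv s(2) by (auto simp: closed_chain_def)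
    then obtain q' t where q: "q = q' @ [t]" by (metis rev_exhaust)
    have t: "step_target t = v" using cl s(2) by (simp add: closed_chain_def q)
    have tS: "t \<in> sym_steps (H \<union> K)" using S(2) q by simp
    have "step_source t \<noteq> v" using d s(2) q by auto
    then have tK: "t \<in> K"
      using tS t H[of t] H[of "rev_step t"] K[of "rev_step t"] unfolding sym_steps_def
      by (simp only: mem_Collect_eq Un_iff step_simps) blast
    have dt: "distinct (map step_target (s # q))"
      using closed_chain_targets[OF cl] d by simp
    have st: "step_source s \<notin> step_source ` set q'" "step_target t \<notin> step_target ` set q'"
      using d dt by (simp_all add: q)
    have "set q' \<subseteq> sym_steps H"
    proof
      fix u assume u: "u \<in> set q'"
      have "step_source u \<noteq> step_source s" "step_target u \<noteq> step_target t"
        using st imageI[OF u, of step_source] imageI[OF u, of step_target] by metis+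
      moreover have "u \<in> sym_steps (H \<union> K)" using u S(2) unfolding q by auto
      ultimately show "u \<in> sym_steps H" using avoid s(2) t by metis
    qed
    moreover have "successively linked (q' @ [t])" "step_target s = step_source (hd (q' @ [t]))"
      using cl unfolding closed_chain_def q by (auto simp: successively_Cons)
    ultimately have "(step_target s, step_source t) \<in> (adjacent_in H)\<^sup>*"
      using chain_connected[of q' H t] by simp
    moreover have "step_edge s \<noteq> step_edge t" using e q by simp
    ultimately show False using sep[OF sK tK] by simp
  qed
qed

text \<open>\<open>P\<close> has the same value at both ends of every edge and hence is constant
  along the cycle.\<close>

lemma cycle_union_disjoint:
  assumes p: "cycle (H \<union> K) p"
    and H: "\<And>s. s \<in> H \<Longrightarrow> P (step_source s) \<and> P (step_target s)"
    and K: "\<And>s. s \<in> K \<Longrightarrow> \<not> P (step_source s) \<and> \<not> P (step_target s)"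
  shows "cycle H p \<or> cycle K p"
proof -
  have S: "set p \<subseteq> sym_steps (H \<union> K)" and c: "p \<noteq> []" "successively linked p"
    using p by (auto simp: cycle_iff_closed_chain closed_chain_def)
  have inv: "P (step_source s) \<longleftrightarrow> P (step_target s)" if "s \<in> sym_steps (H \<union> K)" for s
    using that H[of s] H[of "rev_step s"] K[of s] K[of "rev_step s"] unfolding sym_steps_def
    by (simp only: mem_Collect_eq Un_iff step_simps) blast
  have all: "\<forall>s\<in>set p. P (step_source s) \<longleftrightarrow> P (step_source (hd p))"
    using S c
  proof (induction p)
    case (Cons s p)
    show ?case
    proof (cases "p = []")
      case False
      have sp: "set p \<subseteq> sym_steps (H \<union> K)" "s \<in> sym_steps (H \<union> K)"
        using Cons.prems(1) by simp_all
      have lp: "successively linked p" "step_target s = step_source (hd p)"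
        using Cons.prems(3) False by (simp_all add: successively_Cons)
      note IH = Cons.IH[OF sp(1) False lp(1)]
      show ?thesis
      proof
        fix t assume "t \<in> set (s # p)"
        then consider "t = s" | "t \<in> set p" by (metis set_ConsD)
        then show "P (step_source t) \<longleftrightarrow> P (step_source (hd (s # p)))"
        proof cases
          case 2
          then show ?thesis using bspec[OF IH 2] lp(2) inv[OF sp(2)] by simp
        qed simp
      qed
    qed simp
  qed simp
  show ?thesis
  proof (cases "P (step_source (hd p))")
    case True
    have "set p \<subseteq> sym_steps H"
    proof
      fix s assume s: "s \<in> set p"
      have "P (step_source s)" using bspec[OF all s] True by simp
      then show "s \<in> sym_steps H"
        using subsetD[OF S s] K[of s] K[of "rev_step s"] unfolding sym_steps_def
        by (simp only: mem_Collect_eq Un_iff step_simps) blast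
    qed
    then show ?thesis using p by (simp add: cycle_iff_closed_chain)
  next
    case False
    have "set p \<subseteq> sym_steps K"
    proof
      fix s assume s: "s \<in> set p"
      have "\<not> P (step_source s)" using bspec[OF all s] False by simp
      then show "s \<in> sym_steps K"
        using subsetD[OF S s] H[of s] H[of "rev_step s"] unfolding sym_steps_def
        by (simp only: mem_Collect_eq Un_iff step_simps) blast
    qed
    then show ?thesis using p by (simp add: cycle_iff_closed_chain)
  qed
qed

lemma connected_invariant:
  assumes "(x, y) \<in> (adjacent_in (H \<union> K))\<^sup>*" "P x"
    and H: "\<And>s. s \<in> H \<Longrightarrow> P (step_source s) \<and> P (step_target s)"
    and K: "\<And>s. s \<in> K \<Longrightarrow> \<not> P (step_source s) \<and> \<not> P (step_target s)"
  shows "P y"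
  using assms(1,2)
proof (induction rule: rtrancl_induct)
  case (step y z)
  then obtain e where "(y, e, z) \<in> sym_steps (H \<union> K)" unfolding adjacent_in_iff by blast
  then have "P y \<longleftrightarrow> P z"
    using H[of "(y, e, z)"] H[of "(z, e, y)"] K[of "(y, e, z)"] K[of "(z, e, y)"]
    unfolding sym_steps_def
    by (simp only: mem_Collect_eq Un_iff step_simps) blast
  then show ?case using step by simp
qed

text \<open>A common link would bring a common edge, since every link has an incident edge.\<close>

lemma links_disjoint: "edges_of L \<inter> edges_of L' = {} \<Longrightarrow> L \<inter> L' = {}"
  using incident_nonempty unfolding edges_of_def by fastforce

lemma box_links_subset: "is_net N \<Longrightarrow> b \<in> boxes N \<Longrightarrow> box_links b \<subseteq> links N"
  using delimits_boxD(1) is_netD(2) by blast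

lemma delimits_box_mono: "delimits_box L b \<Longrightarrow> L \<subseteq> L' \<Longrightarrow> delimits_box L' b"
  unfolding delimits_box_def by blast

lemma edges_of_Un: "edges_of (L \<union> L') = edges_of L \<union> edges_of L'"
  by (auto simp: edges_of_def)

lemma net_graph_Un:
  assumes "net_graph L" "net_graph L'" "edges_of L \<inter> edges_of L' = {}"
  shows "net_graph (L \<union> L')"
  unfolding net_graph_def edges_of_Un
proof (intro conjI ballI)
  show "finite (L \<union> L')" using assms net_graph_finite by blast
next
  fix l assume "l \<in> L \<union> L'"
  then show "typed l" using assms by (auto simp: net_graph_def)
next
  fix e assume "e \<in> edges_of L \<union> edges_of L'"
  then obtain m where m: "m \<in> L \<union> L'" "e \<in> concs m"
    using net_graph_concluded assms(1,2) by blast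
  have "k = m" if k: "k \<in> L \<union> L'" "e \<in> concs k" for k
  proof -
    have "e \<notin> edges_of L \<or> e \<notin> edges_of L'" using assms(3) by blast
    then show ?thesis
      using k m edges_ofI(2)[of k _ e] edges_ofI(2)[of m _ e]
        net_graph_conc_unique[OF assms(1), of k m e] net_graph_conc_unique[OF assms(2), of k m e]
      by (metis Un_iff)
  qed
  then show "\<exists>!l. l \<in> L \<union> L' \<and> e \<in> concs l" using m by metis
next
  fix l m assume lm: "l \<in> L \<union> L'" "m \<in> L \<union> L'"
  show "prems l \<inter> prems m \<noteq> {} \<longrightarrow> l = m"
  proof
    assume "prems l \<inter> prems m \<noteq> {}"
    then obtain e where e: "e \<in> prems l" "e \<in> prems m" by blast
    have "e \<notin> edges_of L \<or> e \<notin> edges_of L'" using assms(3) by blast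
    then show "l = m"
      using e lm edges_ofI(1)[of l _ e] edges_ofI(1)[of m _ e]
        net_graph_prem_unique[OF assms(1), of l m e] net_graph_prem_unique[OF assms(2), of l m e]
      by (metis Un_iff)
  qed
qed

section \<open>Juxtaposition preserves correctness\<close>

lemma juxtapose_simps [simp]:
  "links (juxtapose M N) = links M \<union> links N" "boxes (juxtapose M N) = boxes M \<union> boxes N"
  by (simp_all add: juxtapose_def)

lemma add_link_simps [simp]:
  "links (add_link l N) = insert l (links N)" "boxes (add_link l N) = boxes N"
  by (simp_all add: add_link_def)

lemma juxtapose_commute: "juxtapose M N = juxtapose N M"
  by (simp add: juxtapose_def Un_commute)

lemma juxtapose_is_net:
  assumes M: "is_net M" and N: "is_net N" and disj: "edges M \<inter> edges N = {}"
  shows "is_net (juxtapose M N)"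
proof -
  have ld: "links M \<inter> links N = {}" by (rule links_disjoint[OF disj])
  note bM = box_links_subset[OF M] and bN = box_links_subset[OF N]
  show ?thesis
    unfolding is_net_def juxtapose_simps
  proof (intro conjI allI ballI impI)
    show "net_graph (links M \<union> links N)" using net_graph_Un is_netD(1) M N disj by blast
  next
    fix b assume "b \<in> boxes M \<union> boxes N"
    then show "delimits_box (links M \<union> links N) b"
      using is_netD(2)[OF M] is_netD(2)[OF N] delimits_box_mono by (metis Un_iff Un_upper1 Un_upper2)
  next
    fix a c assume l: "OfCourseLink a c \<in> links M \<union> links N"
    have "\<exists>b. b \<in> boxes M \<union> boxes N \<and> OfCourseLink a c = principal b"
      using l M N unfolding is_net_def by (metis Un_iff)
    moreover have "b = b'" if "b \<in> boxes M \<union> boxes N" "b' \<in> boxes M \<union> boxes N" "principal b = principal b'" for b b'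
    proof -
      have "principal b \<in> box_links b" "principal b' \<in> box_links b'" by (rule principal_in_box)+
      then have "b \<in> boxes M \<and> b' \<in> boxes M \<or> b \<in> boxes N \<and> b' \<in> boxes N"
        using that ld bM bN by (metis IntI UnE empty_iff subsetD)
      then show ?thesis using principal_unique M N that(3) by blast
    qed
    ultimately show "\<exists>!b. b \<in> boxes M \<union> boxes N \<and> OfCourseLink a c = principal b" by metis
  next
    fix a c assume l: "PaxLink a c \<in> links M \<union> links N"
    have uM: "\<exists>!b. b \<in> boxes M \<and> PaxLink a c \<in> auxiliary b" if "PaxLink a c \<in> links M"
      using that M unfolding is_net_def by metis
    have uN: "\<exists>!b. b \<in> boxes N \<and> PaxLink a c \<in> auxiliary b" if "PaxLink a c \<in> links N"
      using that N unfolding is_net_def by metis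
    have "PaxLink a c \<in> links M" if "b \<in> boxes M" "PaxLink a c \<in> auxiliary b" for b
      using bM[OF that(1)] that(2) by (auto simp: box_links_def ports_def)
    moreover have "PaxLink a c \<in> links N" if "b \<in> boxes N" "PaxLink a c \<in> auxiliary b" for b
      using bN[OF that(1)] that(2) by (auto simp: box_links_def ports_def)
    ultimately show "\<exists>!b. b \<in> boxes M \<union> boxes N \<and> PaxLink a c \<in> auxiliary b"
      using l ld uM uN by (metis IntI Un_iff empty_iff)
  next
    fix b b' assume b: "b \<in> boxes M \<union> boxes N" "b' \<in> boxes M \<union> boxes N" "b \<noteq> b'"
    show "box_links b \<inter> box_links b' = {} \<or> box_links b \<subseteq> content b' \<or> box_links b' \<subseteq> content b"
    proof (cases "b \<in> boxes M \<longleftrightarrow> b' \<in> boxes M")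
      case True
      then show ?thesis using b is_netD(3)[OF M, of b b'] is_netD(3)[OF N, of b b'] by blast
    next
      case False
      then have "box_links b \<inter> box_links b' = {}" using b bM bN ld by blast
      then show ?thesis ..
    qed
  qed
qed

lemma collapses_juxtapose_left:
  assumes M: "is_net M" and N: "is_net N" and ld: "links M \<inter> links N = {}"
    and k: "k \<in> links M"
  shows "collapses_to (juxtapose M N) k x \<longleftrightarrow> collapses_to M k x"
proof (cases x)
  case (LinkNode m)
  then show ?thesis using k ld box_links_subset[OF N] by auto
next
  case (BoxNode b)
  have "b \<in> outermost_boxes (juxtapose M N) \<longleftrightarrow> b \<in> outermost_boxes M" if kb: "k \<in> box_links b"
  proof -
    have "\<not> box_links b \<subseteq> content b'" if b': "b' \<in> boxes N" for b'
      using kb k ld box_links_subset[OF N b'] by (auto simp: box_links_def)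
    moreover have "b \<notin> boxes N" using kb k ld box_links_subset[OF N] by blast
    ultimately show ?thesis unfolding outermost_boxes_def by auto
  qed
  then show ?thesis using BoxNode by auto
qed

lemma collapses_juxtapose:
  assumes M: "is_net M" and N: "is_net N" and ld: "links M \<inter> links N = {}"
  shows "collapses_to (juxtapose M N) k x \<longleftrightarrow> collapses_to M k x \<or> collapses_to N k x"
proof -
  have dl: "links N \<inter> links M = {}" using ld by blast
  consider "k \<in> links M" "k \<notin> links N" | "k \<in> links N" "k \<notin> links M" | "k \<notin> links M" "k \<notin> links N"
    using ld by blast
  then show ?thesis
  proof cases
    case 1
    then show ?thesis
      using collapses_juxtapose_left[OF M N ld] collapses_in_links[OF N] by blast
  next
    case 2
    then show ?thesis
      using collapses_juxtapose_left[OF N M dl, of k x] collapses_in_links[OF M]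
      unfolding juxtapose_commute[of N M] by blast
  next
    case 3
    then have "\<not> collapses_to (juxtapose M N) k x"
      using box_links_subset[OF M] box_links_subset[OF N] by (cases x) (auto simp: outermost_boxes_def)
    then show ?thesis using 3 collapses_in_links[OF M] collapses_in_links[OF N] by blast
  qed
qed

lemma switching_juxtapose:
  assumes M: "is_net M" and N: "is_net N" and disj: "edges M \<inter> edges N = {}"
  shows "switching (juxtapose M N) s = switching M s \<union> switching N s"
proof -
  note c = collapses_juxtapose[OF M N links_disjoint[OF disj]]
  have mixed: False if "collapses_to M k x" "e \<in> prems k \<union> concs k" "collapses_to N m y" "e \<in> prems m \<union> concs m" for k x e m y
    using that collapses_in_links[OF M that(1)] collapses_in_links[OF N that(3)] edges_ofI disj
    by (metis IntI Un_iff empty_iff)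
  show ?thesis
  proof (intro equalityI subsetI)
    fix t assume t: "t \<in> switching (juxtapose M N) s"
    obtain x e y where [simp]: "t = (x, e, y)" by (cases t)
    obtain l m where lm: "collapses_to (juxtapose M N) l x" "collapses_to (juxtapose M N) m y"
      "e \<in> concs l" "e \<in> prems m" "switched m \<longrightarrow> e = s m" and nb: "\<not> (\<exists>b. x = BoxNode b \<and> y = BoxNode b)"
      using t unfolding switching_def by auto
    have "collapses_to M l x \<and> collapses_to M m y \<or> collapses_to N l x \<and> collapses_to N m y"
      using lm(1-4) mixed[of l x e m y] mixed[of m y e l x] unfolding c by blast
    then show "t \<in> switching M s \<union> switching N s"
      using lm(3-5) nb unfolding switching_def by auto
  next
    fix t assume "t \<in> switching M s \<union> switching N s"
    then show "t \<in> switching (juxtapose M N) s"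
      unfolding switching_def c by auto
  qed
qed

text \<open>A common box node would give a common principal port.\<close>

lemma nodes_disjoint:
  assumes M: "is_net M" and N: "is_net N" and ld: "links M \<inter> links N = {}"
    and "collapses_to M k x" "collapses_to N k' x"
  shows False
proof (cases x)
  case (LinkNode m)
  then show ?thesis using assms by auto
next
  case (BoxNode b)
  then have "b \<in> boxes M" "b \<in> boxes N" using assms by (auto simp: outermost_boxes_def)
  then show ?thesis using box_links_subset M N principal_in_box ld by blast
qed

lemma switching_nodes:
  assumes "t \<in> switching N s"
  shows "(\<exists>k. collapses_to N k (step_source t)) \<and> (\<exists>k. collapses_to N k (step_target t))"
  using assms unfolding switching_def by auto

lemma juxtapose_DR_correct:
  assumes M: "is_net M" "DR_correct M" and N: "is_net N" "DR_correct N" and disj: "edges M \<inter> edges N = {}"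
  shows "DR_correct (juxtapose M N)"
  unfolding DR_correct_iff[of "juxtapose M N"]
proof
  have ld: "links M \<inter> links N = {}" by (rule links_disjoint[OF disj])
  show "DR_acyclic (juxtapose M N)"
    unfolding DR_acyclic_def
  proof (intro allI impI notI)
    fix s p assume s: "switching_choice (juxtapose M N) s" and p: "cycle (switching (juxtapose M N) s) p"
    have "switching_choice M s" "switching_choice N s" using s by (auto simp: switching_choice_def)
    moreover have "cycle (switching M s) p \<or> cycle (switching N s) p"
      using p unfolding switching_juxtapose[OF M(1) N(1) disj]
    proof (rule cycle_union_disjoint[where P = "\<lambda>x. \<exists>k. collapses_to M k x"])
      show "(\<exists>k. collapses_to M k (step_source t)) \<and> (\<exists>k. collapses_to M k (step_target t))"
        if "t \<in> switching M s" for t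
        by (rule switching_nodes[OF that])
      show "\<not> (\<exists>k. collapses_to M k (step_source t)) \<and> \<not> (\<exists>k. collapses_to M k (step_target t))"
        if "t \<in> switching N s" for t
        using switching_nodes[OF that] nodes_disjoint[OF M(1) N(1) ld] by blast
    qed
    ultimately show False
      using M(2) N(2) unfolding DR_correct_iff[of M] DR_correct_iff[of N] DR_acyclic_def by blast
  qed
  show "\<forall>b\<in>boxes (juxtapose M N). DR_correct (box_net (juxtapose M N) b)"
  proof
    fix b assume b: "b \<in> boxes (juxtapose M N)"
    have *: "box_net (juxtapose M' N') b' = box_net M' b'"
      if M': "is_net M'" and N': "is_net N'" and ld': "links M' \<inter> links N' = {}" and b': "b' \<in> boxes M'"
      for M' N' :: "'a net" and b'
    proof -
      have "\<not> box_links c \<subseteq> content b'" if c: "c \<in> boxes N'" for c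
      proof
        assume "box_links c \<subseteq> content b'"
        then have "principal c \<in> content b'" using principal_in_box by blast
        then show False
          using box_links_subset[OF M' b'] box_links_subset[OF N' c] principal_in_box[of c] ld'
          by (auto simp: box_links_def)
      qed
      then show ?thesis by (auto simp: box_net_def)
    qed
    have dl: "links N \<inter> links M = {}" using ld by blast
    show "DR_correct (box_net (juxtapose M N) b)"
    proof (cases "b \<in> boxes M")
      case True
      then show ?thesis using *[OF M(1) N(1) ld] M(2) DR_correct_iff[of M] by simp
    next
      case False
      then have "b \<in> boxes N" using b by simp
      then show ?thesis
        using *[OF N(1) M(1) dl] N(2) DR_correct_iff[of N] unfolding juxtapose_commute[of N M] by simp
    qed
  qed
qed

section \<open>Adding a single link that is not a port\<close>

definition addable :: "'a link \<Rightarrow> 'a net \<Rightarrow> bool" where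
  "addable l M \<longleftrightarrow> typed l \<and> prems l \<subseteq> conclusions M \<and> concs l \<inter> edges M = {} \<and>
     (\<forall>a c. l \<noteq> OfCourseLink a c \<and> l \<noteq> PaxLink a c)"

lemma addable_new:
  assumes "addable l M"
  shows "l \<notin> links M"
proof
  assume l: "l \<in> links M"
  obtain e where "e \<in> prems l \<union> concs l" using incident_nonempty by blast
  then show False
    using assms l edges_ofI(2)[OF l] unfolding addable_def by (auto simp: conclusions_of_iff)
qed

lemma edges_of_insert: "edges_of (insert l L) = prems l \<union> concs l \<union> edges_of L"
  by (auto simp: edges_of_def)

lemma net_graph_insert:
  assumes L: "net_graph L" and l: "typed l" "prems l \<subseteq> conclusions_of L" "concs l \<inter> edges_of L = {}"
  shows "net_graph (insert l L)"
proof -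
  have sub: "prems l \<subseteq> edges_of L" using l(2) by (auto simp: conclusions_of_iff)
  show ?thesis
    unfolding net_graph_def
  proof (intro conjI ballI)
    show "finite (insert l L)" using L by (simp add: net_graph_finite)
  next
    fix k assume "k \<in> insert l L"
    then show "typed k" using l(1) L by (auto simp: net_graph_def)
  next
    fix e assume e: "e \<in> edges_of (insert l L)"
    show "\<exists>!k. k \<in> insert l L \<and> e \<in> concs k"
    proof (cases "e \<in> concs l")
      case True
      then show ?thesis using l(3) edges_ofI(2)[of _ L e] by (intro ex1I[of _ l]) auto
    next
      case False
      then have "e \<in> edges_of L" using e sub unfolding edges_of_insert by blast
      then obtain m where "m \<in> L" "e \<in> concs m" using net_graph_concluded[OF L] by blast
      then show ?thesis using False net_graph_conc_unique[OF L] by (intro ex1I[of _ m]) auto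
    qed
  next
    fix k m assume "k \<in> insert l L" "m \<in> insert l L"
    then show "prems k \<inter> prems m \<noteq> {} \<longrightarrow> k = m"
      using net_graph_prem_unique[OF L, of k m] l(2) by (auto simp: conclusions_of_iff subset_iff)
  qed
qed

lemma add_link_is_net:
  assumes M: "is_net M" and l: "addable l M"
  shows "is_net (add_link l M)"
  unfolding is_net_def add_link_simps
proof (intro conjI allI ballI impI)
  show "net_graph (insert l (links M))"
    using net_graph_insert[OF is_netD(1)[OF M]] l by (simp add: addable_def)
next
  fix b assume "b \<in> boxes M"
  then show "delimits_box (insert l (links M)) b"
    using is_netD(2)[OF M] delimits_box_mono by blast
next
  fix a c assume "OfCourseLink a c \<in> insert l (links M)"
  then have "OfCourseLink a c \<in> links M" using l by (auto simp: addable_def)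
  then show "\<exists>!b. b \<in> boxes M \<and> OfCourseLink a c = principal b"
    using M unfolding is_net_def by metis
next
  fix a c assume "PaxLink a c \<in> insert l (links M)"
  then have "PaxLink a c \<in> links M" using l by (auto simp: addable_def)
  then show "\<exists>!b. b \<in> boxes M \<and> PaxLink a c \<in> auxiliary b"
    using M unfolding is_net_def by metis
next
  fix b b' assume "b \<in> boxes M" "b' \<in> boxes M" "b \<noteq> b'"
  then show "box_links b \<inter> box_links b' = {} \<or> box_links b \<subseteq> content b' \<or> box_links b' \<subseteq> content b"
    using is_netD(3)[OF M] by blast
qed

lemma collapses_add_link:
  assumes M: "is_net M" and l: "addable l M"
  shows "collapses_to (add_link l M) k x \<longleftrightarrow> (if k = l then x = LinkNode l else collapses_to M k x)"
proof -
  have "\<And>b. b \<in> boxes M \<Longrightarrow> l \<notin> box_links b"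
    using box_links_subset[OF M] addable_new[OF l] by blast
  then show ?thesis by (cases x) (auto simp: outermost_boxes_def)
qed

text \<open>The new node is joined only to the nodes that conclude its kept premises: its own
  conclusions are fresh, so no edge leaves it. For a switched link \<open>sep\<close> holds
  vacuously, as a switching keeps only one premise.\<close>

lemma add_link_DR_correct:
  assumes M: "is_net M" "DR_correct M" and l: "addable l M"
    and sep: "\<And>s e e' k k' x x'. \<lbrakk>e \<in> prems l; e' \<in> prems l; e \<noteq> e'; switched l \<Longrightarrow> e = s l \<and> e' = s l;
       collapses_to M k x; e \<in> concs k; collapses_to M k' x'; e' \<in> concs k'\<rbrakk>
       \<Longrightarrow> (x, x') \<notin> (adjacent_in (switching M s))\<^sup>*"
  shows "DR_correct (add_link l M)"
  unfolding DR_correct_iff[of "add_link l M"]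
proof
  note c = collapses_add_link[OF M(1) l]
  show "DR_acyclic (add_link l M)"
    unfolding DR_acyclic_def
  proof (intro allI impI notI)
    fix s p assume s: "switching_choice (add_link l M) s" and p: "cycle (switching (add_link l M) s) p"
    define H where "H = switching M s"
    define K where "K = {(x, e, LinkNode l) | x e k. e \<in> prems l \<and> (switched l \<longrightarrow> e = s l) \<and>
        collapses_to M k x \<and> e \<in> concs k}"
    have not_l: "x \<noteq> LinkNode l" if "collapses_to M k x" for k x
      using that addable_new[OF l] by auto
    have sub: "switching (add_link l M) s \<subseteq> H \<union> K"
    proof
      fix t assume t: "t \<in> switching (add_link l M) s"
      obtain x e y where [simp]: "t = (x, e, y)" by (cases t)
      obtain k m where km: "collapses_to (add_link l M) k x" "collapses_to (add_link l M) m y"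
        "e \<in> concs k" "e \<in> prems m" "switched m \<longrightarrow> e = s m" and nb: "\<not> (\<exists>b. x = BoxNode b \<and> y = BoxNode b)"
        using t unfolding switching_def by auto
      have "e \<in> edges M"
      proof (cases "m = l")
        case True
        then show ?thesis using km(4) l by (auto simp: addable_def conclusions_of_iff)
      next
        case False
        then have "m \<in> links M" using km(2) c collapses_in_links[OF M(1)] by metis
        then show ?thesis using km(4) edges_ofI(1) by blast
      qed
      then have "k \<noteq> l" using km(3) l by (auto simp: addable_def)
      then have k: "collapses_to M k x" using km(1) c by simp
      show "t \<in> H \<union> K"
      proof (cases "m = l")
        case True
        then have "y = LinkNode l" using km(2) c by simp
        then show ?thesis using True km k unfolding K_def by auto
      next
        case False
        then have "collapses_to M m y" using km(2) c by simp
        then show ?thesis using km k nb unfolding H_def switching_def by auto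
      qed
    qed
    have sM: "switching_choice M s" using s by (auto simp: switching_choice_def)
    have "\<not> cycle (H \<union> K) p"
    proof (rule acyclic_add_vertex[where v = "LinkNode l"])
      show "\<not> cycle H q" for q
        using sM M(2) unfolding H_def DR_correct_iff[of M] DR_acyclic_def by blast
      show "step_source t \<noteq> LinkNode l \<and> step_target t \<noteq> LinkNode l" if "t \<in> H" for t
        using switching_nodes[of t M s] that not_l unfolding H_def by metis
      show "step_source t \<noteq> LinkNode l \<and> step_target t = LinkNode l" if "t \<in> K" for t
        using that not_l unfolding K_def by auto
      show "(step_source t, step_source u) \<notin> (adjacent_in H)\<^sup>*"
        if t: "t \<in> K" and u: "u \<in> K" and tu: "step_edge t \<noteq> step_edge u" for t u
      proof -
        obtain x e k where 1: "t = (x, e, LinkNode l)" "e \<in> prems l" "switched l \<longrightarrow> e = s l"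
          "collapses_to M k x" "e \<in> concs k" using t unfolding K_def by blast
        obtain x' e' k' where 2: "u = (x', e', LinkNode l)" "e' \<in> prems l" "switched l \<longrightarrow> e' = s l"
          "collapses_to M k' x'" "e' \<in> concs k'" using u unfolding K_def by blast
        show ?thesis
          using sep[of e e' s k x k' x'] 1 2 tu unfolding H_def by simp
      qed
    qed
    then show False using cycle_mono[OF p sub] by blast
  qed
  show "\<forall>b\<in>boxes (add_link l M). DR_correct (box_net (add_link l M) b)"
    using M(2) unfolding DR_correct_iff[of M] by (simp add: box_net_def)
qed

text \<open>A switching keeps at most one premise of the new link, so the new node has at most one
  edge and lies on no cycle. Par and why not links fall under this case.\<close>

lemma add_unary_link:
  assumes "is_net M" "DR_correct M" "addable l M"
    and one: "\<And>e e'. e \<in> prems l \<Longrightarrow> e' \<in> prems l \<Longrightarrow> \<not> switched l \<Longrightarrow> e = e'"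
  shows "is_net (add_link l M) \<and> DR_correct (add_link l M)"
proof
  show "is_net (add_link l M)" by (rule add_link_is_net[OF assms(1,3)])
  show "DR_correct (add_link l M)"
  proof (rule add_link_DR_correct[OF assms(1-3)])
    fix s :: "'a link \<Rightarrow> 'a edge" and e e' x x'
    assume "e \<in> prems l" "e' \<in> prems l" "e \<noteq> e'" "switched l \<Longrightarrow> e = s l \<and> e' = s l"
    then show "(x, x') \<notin> (adjacent_in (switching M s))\<^sup>*" using one by metis
  qed
qed

lemma conclusions_juxtapose:
  assumes "edges M \<inter> edges N = {}" "e \<in> conclusions M"
  shows "e \<in> conclusions (juxtapose M N)"
proof -
  have "e \<in> edges M" "e \<notin> edges N" using assms by (auto simp: conclusions_of_iff)
  then show ?thesis
    using assms(2) edges_ofI(1)[of _ "links N" e] by (auto simp: conclusions_of_iff edges_of_Un)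
qed

text \<open>The two premises come from different sides of a juxtaposition, and no path in a
  switching crosses from one side to the other.\<close>

lemma add_binary_link:
  assumes M: "is_net M" "DR_correct M" and N: "is_net N" "DR_correct N"
    and disj: "edges M \<inter> edges N = {}"
    and ab: "a \<in> conclusions M" "b \<in> conclusions N"
    and l: "typed l" "prems l = {a, b}" "concs l \<inter> (edges M \<union> edges N) = {}"
      "\<And>a c. l \<noteq> OfCourseLink a c \<and> l \<noteq> PaxLink a c"
  shows "is_net (add_link l (juxtapose M N)) \<and> DR_correct (add_link l (juxtapose M N))"
proof -
  let ?J = "juxtapose M N"
  have ld: "links M \<inter> links N = {}" by (rule links_disjoint[OF disj])
  have disj': "edges N \<inter> edges M = {}" using disj by blast
  have J: "is_net ?J" "DR_correct ?J"
    using juxtapose_is_net juxtapose_DR_correct M N disj by blast+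
  have "a \<in> conclusions ?J" by (rule conclusions_juxtapose[OF disj ab(1)])
  moreover have "b \<in> conclusions ?J"
    using conclusions_juxtapose[OF disj' ab(2)] unfolding juxtapose_commute[of N M] .
  ultimately have add: "addable l ?J"
    using l by (auto simp: addable_def edges_of_Un)
  have sideM: "collapses_to M k x" if "collapses_to ?J k x" "a \<in> concs k" for k x
  proof -
    have "a \<notin> edges N" using ab(1) disj by (auto simp: conclusions_of_iff)
    then have "\<not> collapses_to N k x"
      using that(2) collapses_in_links[OF N(1)] edges_ofI(2) by blast
    then show ?thesis using that(1) collapses_juxtapose[OF M(1) N(1) ld] by blast
  qed
  have sideN: "collapses_to N k x" if "collapses_to ?J k x" "b \<in> concs k" for k x
  proof -
    have "b \<notin> edges M" using ab(2) disj by (auto simp: conclusions_of_iff)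
    then have "\<not> collapses_to M k x"
      using that(2) collapses_in_links[OF M(1)] edges_ofI(2) by blast
    then show ?thesis using that(1) collapses_juxtapose[OF M(1) N(1) ld] by blast
  qed
  have sep: "(x, x') \<notin> (adjacent_in (switching ?J s))\<^sup>*"
    if "collapses_to M k x" "collapses_to N k' x'" for k k' x x' s
  proof
    assume conn: "(x, x') \<in> (adjacent_in (switching ?J s))\<^sup>*"
    have "\<exists>k. collapses_to M k x'"
    proof (rule connected_invariant[OF conn[unfolded switching_juxtapose[OF M(1) N(1) disj]],
          where P = "\<lambda>x. \<exists>k. collapses_to M k x"])
      show "\<exists>k. collapses_to M k x" using that(1) ..
      show "(\<exists>k. collapses_to M k (step_source t)) \<and> (\<exists>k. collapses_to M k (step_target t))"
        if "t \<in> switching M s" for t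
        by (rule switching_nodes[OF that])
      show "\<not> (\<exists>k. collapses_to M k (step_source t)) \<and> \<not> (\<exists>k. collapses_to M k (step_target t))"
        if "t \<in> switching N s" for t
        using switching_nodes[OF that] nodes_disjoint[OF M(1) N(1) ld] by blast
    qed
    then show False using nodes_disjoint[OF M(1) N(1) ld] that(2) by blast
  qed
  have "DR_correct (add_link l ?J)"
  proof (rule add_link_DR_correct[OF J add])
    fix s :: "'a link \<Rightarrow> 'a edge" and e e' k k' x x'
    assume e: "e \<in> prems l" "e' \<in> prems l" "e \<noteq> e'"
      and k: "collapses_to ?J k x" "e \<in> concs k" "collapses_to ?J k' x'" "e' \<in> concs k'"
    have "e = a \<and> e' = b \<or> e = b \<and> e' = a" using e l(2) by auto
    then show "(x, x') \<notin> (adjacent_in (switching ?J s))\<^sup>*"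
    proof
      assume "e = a \<and> e' = b"
      then show ?thesis using sep[OF sideM sideN] k by blast
    next
      assume "e = b \<and> e' = a"
      then have "(x', x) \<notin> (adjacent_in (switching ?J s))\<^sup>*" using sep[OF sideM sideN] k by blast
      then show ?thesis using connected_sym by metis
    qed
  qed
  then show ?thesis using add_link_is_net[OF J(1) add] by blast
qed

text \<open>The ports of a box come all at once: a port without its box would violate
  \<open>is_net\<close>, so they cannot be added one by one as in the other rules.\<close>

lemma net_graph_add_ports:
  assumes L: "net_graph L" and Q: "finite Q" "\<And>l. l \<in> Q \<Longrightarrow> typed l \<and> prems l \<subseteq> conclusions_of L \<and> concs l \<inter> edges_of L = {}"
    and pair: "\<And>l m. l \<in> Q \<Longrightarrow> m \<in> Q \<Longrightarrow> l \<noteq> m \<Longrightarrow> prems l \<inter> prems m = {} \<and> concs l \<inter> concs m = {}"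
  shows "net_graph (Q \<union> L)"
  unfolding net_graph_def
proof (intro conjI ballI)
  show "finite (Q \<union> L)" using L Q(1) net_graph_finite by blast
next
  fix l assume "l \<in> Q \<union> L"
  then show "typed l" using L Q(2) by (auto simp: net_graph_def)
next
  fix e assume e: "e \<in> edges_of (Q \<union> L)"
  show "\<exists>!k. k \<in> Q \<union> L \<and> e \<in> concs k"
  proof (cases "\<exists>l\<in>Q. e \<in> concs l")
    case True
    then obtain l where l: "l \<in> Q" "e \<in> concs l" by blast
    have "k = l" if k: "k \<in> Q \<union> L" "e \<in> concs k" for k
    proof (cases "k \<in> Q")
      case True
      then show ?thesis using pair[OF True l(1)] k(2) l(2) by blast
    next
      case False
      then have "e \<in> edges_of L" using k edges_ofI(2) by blast
      then show ?thesis using Q(2)[OF l(1)] l(2) by blast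
    qed
    then show ?thesis using l by (metis UnI1)
  next
    case False
    have "e \<in> edges_of L"
    proof (rule ccontr)
      assume "e \<notin> edges_of L"
      then obtain l where l: "l \<in> Q" "e \<in> prems l"
        using e False unfolding edges_of_def by blast
      then show False using Q(2)[OF l(1)] \<open>e \<notin> edges_of L\<close> by (auto simp: conclusions_of_iff)
    qed
    then obtain m where "m \<in> L" "e \<in> concs m" using net_graph_concluded[OF L] by blast
    then show ?thesis using False net_graph_conc_unique[OF L] by (metis Un_iff)
  qed
next
  fix k m assume km: "k \<in> Q \<union> L" "m \<in> Q \<union> L"
  show "prems k \<inter> prems m \<noteq> {} \<longrightarrow> k = m"
  proof
    assume "prems k \<inter> prems m \<noteq> {}"
    then obtain e where e: "e \<in> prems k" "e \<in> prems m" by blast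
    have "e \<notin> prems n" if "n \<in> L" "q \<in> Q" "e \<in> prems q" for n q
      using Q(2)[OF that(2)] that(1,3) by (auto simp: conclusions_of_iff)
    then show "k = m"
      using km e pair[of k m] net_graph_prem_unique[OF L, of k m e] by blast
  qed
qed

lemma no_cycle_empty: "\<not> cycle {} p"
  by (simp add: cycle_iff_closed_chain closed_chain_def sym_steps_def)

text \<open>All links collapse to the node of the new box, so the switchings have no edges. The net
  inside the new box is \<open>M\<close>, and older boxes keep the nets they had in
  \<open>M\<close>.\<close>

lemma box_rule_correct:
  assumes M: "is_net M" "DR_correct M" and conc: "conclusions M = insert a E"
    and c: "c \<notin> edges M" "typed (OfCourseLink a c)"
    and f: "inj_on f E" "f ` E \<inter> edges M = {}" "c \<notin> f ` E" "\<forall>e\<in>E. typed (PaxLink e (f e))"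
    and p: "p = OfCourseLink a c" and P: "P = (\<lambda>e. PaxLink e (f e)) ` E"
    and N: "N = Net (insert p P \<union> links M) (insert (Box p P (links M)) (boxes M))"
  shows "is_net N \<and> DR_correct N"
proof -
  define b where "b = Box p P (links M)"
  have Nl: "links N = insert p P \<union> links M" and Nb: "boxes N = insert b (boxes M)"
    by (simp_all add: N b_def)
  have b: "principal b = p" "auxiliary b = P" "content b = links M" "ports b = insert p P"
    "box_links b = links N"
    by (auto simp: b_def ports_def box_links_def Nl)
  have fresh: "concs l \<noteq> {} \<and> concs l \<inter> edges M = {}" if "l \<in> insert p P" for l
    using that c f(2) p P by auto
  have ports_new: "insert p P \<inter> links M = {}"
  proof -
    have "l \<notin> links M" if "l \<in> insert p P" for l
      using fresh[OF that] edges_ofI(2)[of l "links M"] by blast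
    then show ?thesis by blast
  qed
  have "finite E"
    using net_graph_finite_edges[OF is_netD(1)[OF M(1)]] conc
    by (metis Diff_subset conclusions_of_def finite_insert finite_subset)
  have aE: "a \<notin> E" using c(2) f(4) by auto
  have "net_graph (links N)"
    unfolding Nl
  proof (rule net_graph_add_ports[OF is_netD(1)[OF M(1)]])
    show "finite (insert p P)" using \<open>finite E\<close> P by simp
    show "typed l \<and> prems l \<subseteq> conclusions M \<and> concs l \<inter> edges M = {}" if "l \<in> insert p P" for l
      using that fresh[OF that] c(2) f(4) unfolding conc p P by auto
    show "prems l \<inter> prems m = {} \<and> concs l \<inter> concs m = {}"
      if "l \<in> insert p P" "m \<in> insert p P" "l \<noteq> m" for l m
      using that aE f(3) inj_onD[OF f(1)] unfolding p P by auto
  qed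
  have sub: "box_links c \<subseteq> links M" "content c \<subseteq> links M" if "c \<in> boxes M" for c
    using box_links_subset[OF M(1) that] by (auto simp: box_links_def)
  have pN: "p \<in> insert p P" by simp
  have "is_net N"
    unfolding is_net_def
  proof (intro conjI allI ballI impI)
    show "net_graph (links N)" by fact
  next
    fix b' assume "b' \<in> boxes N"
    then consider "b' = b" | "b' \<in> boxes M" using Nb by blast
    then show "delimits_box (links N) b'"
    proof cases
      case 1
      have "conclusions M = \<Union> (prems ` insert p P)"
        unfolding conc using p P by auto
      then show ?thesis
        unfolding delimits_box_def 1 b using p P ports_new is_netD(1)[OF M(1)] by auto
    next
      case 2
      then show ?thesis using is_netD(2)[OF M(1) 2] delimits_box_mono Nl by blast
    qed
  next
    fix a' c' assume l: "OfCourseLink a' c' \<in> links N"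
    show "\<exists>!b'. b' \<in> boxes N \<and> OfCourseLink a' c' = principal b'"
    proof (cases "OfCourseLink a' c' = p")
      case True
      have "p \<noteq> principal b'" if "b' \<in> boxes M" for b'
        using sub(1)[OF that] principal_in_box[of b'] ports_new by auto
      then show ?thesis using True b(1) Nb by auto
    next
      case False
      then have "OfCourseLink a' c' \<in> links M" using l Nl P by auto
      then have "\<exists>!b'. b' \<in> boxes M \<and> OfCourseLink a' c' = principal b'"
        using M(1) unfolding is_net_def by metis
      then show ?thesis using False b(1) Nb by (metis insert_iff)
    qed
  next
    fix a' c' assume l: "PaxLink a' c' \<in> links N"
    show "\<exists>!b'. b' \<in> boxes N \<and> PaxLink a' c' \<in> auxiliary b'"
    proof (cases "PaxLink a' c' \<in> P")
      case True
      have "PaxLink a' c' \<notin> auxiliary b'" if "b' \<in> boxes M" for b'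
        using sub(1)[OF that] ports_new True by (auto simp: box_links_def ports_def)
      then show ?thesis using True b(2) Nb by auto
    next
      case False
      then have "PaxLink a' c' \<in> links M" using l Nl p by auto
      then have "\<exists>!b'. b' \<in> boxes M \<and> PaxLink a' c' \<in> auxiliary b'"
        using M(1) unfolding is_net_def by metis
      then show ?thesis using False b(2) Nb by (metis insert_iff)
    qed
  next
    fix b1 b2 assume "b1 \<in> boxes N" "b2 \<in> boxes N" "b1 \<noteq> b2"
    then show "box_links b1 \<inter> box_links b2 = {} \<or> box_links b1 \<subseteq> content b2 \<or> box_links b2 \<subseteq> content b1"
      using is_netD(3)[OF M(1), of b1 b2] sub(1) b(3) Nb by auto
  qed
  moreover have "DR_correct N"
    unfolding DR_correct_iff[of N]
  proof
    have "switching N s = {}" for s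
    proof -
      have "x = BoxNode b" if "collapses_to N k x" for k x
        using that sub(1) b(3,5) Nb by (cases x) (auto simp: outermost_boxes_def)
      then show ?thesis unfolding switching_def by blast
    qed
    then show "DR_acyclic N" by (simp add: DR_acyclic_def no_cycle_empty)
    have not_b: "\<not> box_links b \<subseteq> content c" if "content c \<subseteq> links M" for c
      using that ports_new b(5) Nl by blast
    have inner: "box_net N b = M"
      using sub not_b[of b] b(3) Nb by (cases M) (auto simp: box_net_def)
    have "DR_correct (box_net N c)" if "c \<in> boxes M" for c
    proof -
      have "box_net N c = box_net M c"
        using not_b[OF sub(2)[OF that]] Nb by (auto simp: box_net_def)
      then show ?thesis using M(2) that DR_correct_iff[of M] by metis
    qed
    then show "\<forall>b\<in>boxes N. DR_correct (box_net N b)"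
      using M(2) Nb inner by (metis insert_iff)
  qed
  ultimately show ?thesis ..
qed

lemma empty_net_correct: "is_net (Net {} {} :: 'a net) \<and> DR_correct (Net {} {} :: 'a net)"
proof -
  have "\<not> collapses_to (Net {} {}) l x" for l :: "'a link" and x
    by (cases x) (simp_all add: outermost_boxes_def)
  then have "switching (Net {} {}) s = {}" for s :: "'a link \<Rightarrow> 'a edge"
    unfolding switching_def by blast
  then show ?thesis
    unfolding DR_correct_iff[of "Net {} {}"] DR_acyclic_def
    by (simp add: no_cycle_empty is_net_def net_graph_def edges_of_def)
qed

theorem sequentializable_imp_DR_correct:
  "sequentializable N \<Longrightarrow> is_net N \<and> DR_correct N"
proof (induction rule: sequentializable.induct)
  case empty
  show ?case by (rule empty_net_correct)
next
  case (ax c d)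
  \<comment> \<open>An axiom, like the one link below, is treated as a link without premises added
    to the empty net.\<close>
  have "is_net (add_link (AxLink c d) (Net {} {})) \<and> DR_correct (add_link (AxLink c d) (Net {} {}))"
    using ax by (intro add_unary_link empty_net_correct[THEN conjunct1] empty_net_correct[THEN conjunct2])
      (auto simp: addable_def edges_of_def)
  then show ?case by (simp add: add_link_def)
next
  case (one c)
  have "is_net (add_link (OneLink c) (Net {} {})) \<and> DR_correct (add_link (OneLink c) (Net {} {}))"
    using one by (intro add_unary_link empty_net_correct[THEN conjunct1] empty_net_correct[THEN conjunct2])
      (auto simp: addable_def edges_of_def)
  then show ?case by (simp add: add_link_def)
next
  case (juxtaposition M N)
  then show ?case using juxtapose_is_net juxtapose_DR_correct by blast
next
  case (cut M N a b)
  then show ?case by (intro add_binary_link) auto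
next
  case (tensor M N a b c)
  then show ?case by (intro add_binary_link) auto
next
  case (bottom N c)
  then show ?case by (intro add_unary_link) (auto simp: addable_def)
next
  case (par N a b c)
  then show ?case by (intro add_unary_link) (auto simp: addable_def)
next
  case (why_not N E c)
  then show ?case by (intro add_unary_link) (auto simp: addable_def)
next
  case (flat N a c)
  then show ?case by (intro add_unary_link) (auto simp: addable_def)
next
  case (para N a c)
  then show ?case by (intro add_unary_link) (auto simp: addable_def)
next
  case (box N a E c f p P)
  then show ?case by (intro box_rule_correct[OF _ _ box.hyps(2-10) refl]) auto
qed

section \<open>Indexings and balanced cycles\<close>

lemma sum_cyclic_shift:
  fixes f :: "nat \<Rightarrow> int"
  shows "(\<Sum>i<n. f (Suc i mod n)) = (\<Sum>i<n. f i)"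
proof (cases n)
  case (Suc m)
  have "(\<Sum>i<Suc m. f (Suc i mod Suc m)) = (\<Sum>i<m. f (Suc i)) + f 0"
    by simp
  also have "\<dots> = (\<Sum>i<Suc m. f i)"
    by (subst sum.lessThan_Suc_shift) simp
  finally show ?thesis using Suc by simp
qed simp

lemma traversal_count:
  fixes p :: "('a link \<times> 'a edge \<times> 'a link) list"
  shows "(\<Sum>i<length p. of_bool (i \<in> upward_traversals p) - of_bool (i \<in> downward_traversals p)) =
     int (card (upward_traversals p)) - int (card (downward_traversals p))"
proof -
  have "{..<length p} \<inter> {i. i \<in> upward_traversals p} = upward_traversals p"
    "{..<length p} \<inter> {i. i \<in> downward_traversals p} = downward_traversals p"
    by (auto simp: upward_traversals_def downward_traversals_def)
  then show ?thesis by (simp add: sum_subtractf sum_of_bool_eq)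
qed

lemma not_paragraph_no_traversal:
  assumes "\<And>a c. step_target (p ! i) \<noteq> ParagraphLink a c"
  shows "i \<notin> upward_traversals p" "i \<notin> downward_traversals p"
  using assms by (auto simp: upward_traversals_def downward_traversals_def)

lemma paragraph_traversal:
  assumes "i < length p" "step_target (p ! i) = ParagraphLink a c"
  shows "i \<in> upward_traversals p \<longleftrightarrow> step_edge (p ! (Suc i mod length p)) = a \<and> step_edge (p ! i) = c"
    "i \<in> downward_traversals p \<longleftrightarrow> step_edge (p ! i) = a \<and> step_edge (p ! (Suc i mod length p)) = c"
  using assms by (auto simp: upward_traversals_def downward_traversals_def)

lemma cycle_nth:
  assumes "cycle (underlying_graph C) p" "i < length p"
  defines "j \<equiv> Suc i mod length p"
  shows "p ! i \<in> sym_steps (underlying_graph C)" "p ! j \<in> sym_steps (underlying_graph C)"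
    "step_source (p ! j) = step_target (p ! i)" "j < length p"
proof -
  show j: "j < length p" unfolding j_def using assms(2) by (intro mod_less_divisor) linarith
  have "set p \<subseteq> sym_steps (underlying_graph C)" using assms(1) by (simp add: cycle_iff_closed_chain)
  then show "p ! i \<in> sym_steps (underlying_graph C)" "p ! j \<in> sym_steps (underlying_graph C)"
    using assms(2) j nth_mem by blast+
  show "step_source (p ! j) = step_target (p ! i)"
    using assms(1,2) unfolding cycle_def j_def by simp
qed

lemma underlying_step:
  assumes "s \<in> sym_steps (underlying_graph C)"
  shows "step_target s \<in> links C" "step_edge s \<in> prems (step_target s) \<union> concs (step_target s)"
    "step_edge s \<in> prems (step_source s) \<union> concs (step_source s)"
    "s \<in> underlying_graph C \<Longrightarrow> step_edge s \<in> prems (step_target s)"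
    "s \<in> underlying_graph C \<Longrightarrow> step_edge s \<in> concs (step_source s)"
    "s \<notin> underlying_graph C \<Longrightarrow> step_edge s \<in> concs (step_target s)"
    "s \<notin> underlying_graph C \<Longrightarrow> step_edge s \<in> prems (step_source s)"
  using assms by (cases s; auto simp: sym_steps_def underlying_graph_def)+

lemma paragraph_index_change:
  fixes I :: "'b \<Rightarrow> int"
  assumes "I a = I c + 1" "e = c \<or> e = a" "f = c \<or> f = a"
  shows "I f - I e = of_bool (f = a \<and> e = c) - of_bool (e = a \<and> f = c)"
proof -
  have "a \<noteq> c" using assms(1) by auto
  then show ?thesis using assms by (elim disjE) simp_all
qed

lemma index_constraint_not_paragraph:
  assumes "\<And>a c. l \<noteq> ParagraphLink a c"
  shows "index_constraint I l \<longleftrightarrow> (\<forall>e \<in> prems l \<union> concs l. \<forall>f \<in> prems l \<union> concs l. I e = I f)"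
proof (cases l)
  case (ParagraphLink a c)
  then show ?thesis using assms by blast
qed simp_all

lemma index_constraint_cong:
  assumes "\<And>e. e \<in> prems l \<union> concs l \<Longrightarrow> I e = J e"
  shows "index_constraint I l \<longleftrightarrow> index_constraint J l"
proof (cases "\<exists>a c. l = ParagraphLink a c")
  case True
  then obtain a c where l: "l = ParagraphLink a c" by blast
  then have "I a = J a" "I c = J c" using assms[of a] assms[of c] by simp_all
  then show ?thesis using l by simp
next
  case False
  then have *: "\<And>a c. l \<noteq> ParagraphLink a c" by blast
  show ?thesis unfolding index_constraint_not_paragraph[OF *] using assms by metis
qed

text \<open>The differences between the indices of successive edges sum to zero around the cycle.
  Such a difference vanishes except at a paragraph link, where it is 1 for an upward and -1 for a
  downward traversal.\<close>

lemma indexing_imp_balanced: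
  assumes I: "indexing C I" and p: "cycle (underlying_graph C) p"
  shows "balanced p"
proof -
  let ?n = "length p"
  have *: "I (step_edge (p ! (Suc i mod ?n))) - I (step_edge (p ! i)) =
      of_bool (i \<in> upward_traversals p) - of_bool (i \<in> downward_traversals p)" if i: "i < ?n" for i
  proof -
    define v where "v = step_target (p ! i)"
    let ?j = "Suc i mod ?n"
    note c = cycle_nth[OF p i]
    have "index_constraint I v"
      using bspec[OF I[unfolded indexing_def] underlying_step(1)[OF c(1)]] by (simp only: v_def)
    moreover have "step_edge (p ! i) \<in> prems v \<union> concs v"
      using underlying_step(2)[OF c(1)] by (simp only: v_def)
    moreover have "step_edge (p ! ?j) \<in> prems v \<union> concs v"
      using underlying_step(3)[OF c(2)] by (simp only: v_def c(3))
    ultimately have v: "index_constraint I v" "step_edge (p ! i) \<in> prems v \<union> concs v"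
      "step_edge (p ! ?j) \<in> prems v \<union> concs v" .
    show ?thesis
    proof (cases "\<exists>a c. v = ParagraphLink a c")
      case True
      then obtain a c where ac: "v = ParagraphLink a c" by blast
      have "I a = I c + 1" "step_edge (p ! i) = c \<or> step_edge (p ! i) = a"
        "step_edge (p ! ?j) = c \<or> step_edge (p ! ?j) = a"
        using v unfolding ac by simp_all
      then show ?thesis
        unfolding paragraph_traversal[OF i ac[unfolded v_def]] by (rule paragraph_index_change)
    next
      case False
      then have "I (step_edge (p ! ?j)) = I (step_edge (p ! i))"
        using v index_constraint_not_paragraph[of v I] by blast
      then show ?thesis
        using not_paragraph_no_traversal[of p i] False by (simp add: v_def)
    qed
  qed
  have "(\<Sum>i<?n. I (step_edge (p ! (Suc i mod ?n))) - I (step_edge (p ! i))) = 0"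
    using sum_cyclic_shift[of "\<lambda>i. I (step_edge (p ! i))" ?n] by (simp add: sum_subtractf)
  then have "(\<Sum>i<?n. of_bool (i \<in> upward_traversals p) - of_bool (i \<in> downward_traversals p)) = (0 :: int)"
    using * by simp
  then show ?thesis unfolding traversal_count balanced_def by simp
qed

lemma underlying_graph_determined:
  assumes "net_graph (links C)"
  shows "edge_determined (underlying_graph C)"
  unfolding edge_determined_def
proof (rule inj_onI)
  fix s t assume st: "s \<in> underlying_graph C" "t \<in> underlying_graph C" "step_edge s = step_edge t"
  obtain l e m where s: "s = (l, e, m)" by (cases s)
  obtain l' m' where t: "t = (l', e, m')" using st(3) s by (cases t) auto
  show "s = t"
    using st(1,2) net_graph_conc_unique[OF assms, of l l' e] net_graph_prem_unique[OF assms, of m m' e]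
    unfolding s t underlying_graph_def by auto
qed

lemma underlying_graph_finite:
  assumes "net_graph (links C)"
  shows "finite (underlying_graph C)"
proof (rule finite_imageD)
  show "inj_on step_edge (underlying_graph C)"
    using underlying_graph_determined[OF assms] by (simp add: edge_determined_def)
  have "step_edge ` underlying_graph C \<subseteq> edges C"
    by (auto simp: underlying_graph_def edges_of_def)
  then show "finite (step_edge ` underlying_graph C)"
    using net_graph_finite_edges[OF assms] finite_subset by blast
qed

definition para_weight :: "'a link \<Rightarrow> int" where
  "para_weight l = of_bool (\<exists>a c. l = ParagraphLink a c)"

text \<open>The potential of a link is meant as the index of its conclusions. An edge from
  \<open>l\<close> to \<open>m\<close> then has index \<open>J l\<close>, which must equal
  \<open>J m\<close>, or \<open>J m + 1\<close> if \<open>m\<close> is a paragraph link; this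
  dictates the weight \<open>- para_weight m\<close>.\<close>

lemma balanced_imp_indexable:
  assumes C: "net_graph (links C)" and bal: "\<And>p. cycle (underlying_graph C) p \<Longrightarrow> balanced p"
  shows "\<exists>I. indexing C I"
proof -
  let ?G = "underlying_graph C"
  define w where "w s = - para_weight (step_target s)" for s :: "'a link \<times> 'a edge \<times> 'a link"
  have zero: "(\<Sum>s\<leftarrow>p. if s \<in> ?G then w s else - w (rev_step s)) = 0" if p: "cycle ?G p" for p
  proof -
    let ?n = "length p"
    \<comment> \<open>A step along its edge contributes at its target, recorded in \<open>A\<close>,
      and a step against its edge at its source, recorded in \<open>B\<close>. Shifting
      \<open>B\<close> by one position brings both to the same vertex, where together they count one
      traversal of a paragraph link.\<close>
    define A where "A i = (if p ! i \<in> ?G then para_weight (step_target (p ! i)) else 0)" for i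
    define B where "B i = (if p ! i \<in> ?G then 0 else para_weight (step_source (p ! i)))" for i
    have "(\<Sum>s\<leftarrow>p. if s \<in> ?G then w s else - w (rev_step s)) = (\<Sum>i<?n. B i - A i)"
      unfolding sum_list_sum_nth by (auto simp: A_def B_def w_def atLeast0LessThan intro: sum.cong)
    also have "\<dots> = (\<Sum>i<?n. B (Suc i mod ?n) - A i)"
      using sum_cyclic_shift[of B ?n] by (simp add: sum_subtractf)
    also have "\<dots> = (\<Sum>i<?n. of_bool (i \<in> upward_traversals p) - of_bool (i \<in> downward_traversals p))"
    proof (rule sum.cong[OF refl])
      fix i assume "i \<in> {..<?n}"
      then have i: "i < ?n" by simp
      define v where "v = step_target (p ! i)"
      let ?j = "Suc i mod ?n"
      note c = cycle_nth[OF p i]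
      show "B ?j - A i = of_bool (i \<in> upward_traversals p) - of_bool (i \<in> downward_traversals p)"
      proof (cases "\<exists>a c. v = ParagraphLink a c")
        case True
        then obtain a e where ae: "v = ParagraphLink a e" by blast
        have "v \<in> links C" using underlying_step(1)[OF c(1)] by (simp add: v_def)
        then have "typed v" using C by (auto simp: net_graph_def)
        then have "a \<noteq> e" using ae by auto
        have i_edge: "step_edge (p ! i) = (if p ! i \<in> ?G then a else e)"
          using underlying_step(4,6)[OF c(1)] ae by (auto simp: v_def)
        have j_edge: "step_edge (p ! ?j) = (if p ! ?j \<in> ?G then e else a)"
          using underlying_step(5,7)[OF c(2)] ae c(3) by (auto simp: v_def)
        have AB: "A i = of_bool (p ! i \<in> ?G)" "B ?j = of_bool (p ! ?j \<notin> ?G)"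
          using ae c(3) by (auto simp: A_def B_def para_weight_def v_def)
        show ?thesis
          unfolding AB paragraph_traversal[OF i ae[unfolded v_def]] i_edge j_edge
          using \<open>a \<noteq> e\<close> by auto
      next
        case False
        then have "A i = 0" "B ?j = 0"
          using c(3) by (auto simp: A_def B_def para_weight_def v_def)
        then show ?thesis
          using not_paragraph_no_traversal[of p i] False by (simp add: v_def)
      qed
    qed
    also have "\<dots> = 0"
      using bal[OF p] unfolding traversal_count balanced_def by simp
    finally show ?thesis .
  qed
  obtain J where J: "\<forall>s\<in>?G. J (step_target s) - J (step_source s) = w s"
    using potential_exists[OF underlying_graph_finite[OF C] underlying_graph_determined[OF C] zero] ..
  define I where "I e = J (THE l. l \<in> links C \<and> e \<in> concs l)" for e
  have I_conc: "I e = J l" if "l \<in> links C" "e \<in> concs l" for l e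
  proof -
    have "(THE l. l \<in> links C \<and> e \<in> concs l) = l"
      using that net_graph_conc_unique[OF C] by (intro the_equality) blast+
    then show ?thesis by (simp add: I_def)
  qed
  have I_prem: "I e = J m + para_weight m" if m: "m \<in> links C" "e \<in> prems m" for m e
  proof -
    obtain l where l: "l \<in> links C" "e \<in> concs l"
      using net_graph_concluded[OF C] edges_ofI(1)[OF m] by blast
    then have "(l, e, m) \<in> ?G" using m by (simp add: underlying_graph_def)
    from bspec[OF J this] have "J m - J l = - para_weight m" by (simp add: w_def)
    then show ?thesis using I_conc[OF l] by simp
  qed
  have "index_constraint I l" if l: "l \<in> links C" for l
  proof (cases "\<exists>a c. l = ParagraphLink a c")
    case True
    then obtain a c where "l = ParagraphLink a c" by blast
    then show ?thesis
      using I_conc[OF l, of c] I_prem[OF l, of a] by (simp add: para_weight_def)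
  next
    case False
    then have "I e = J l" if "e \<in> prems l \<union> concs l" for e
      using that I_conc[OF l] I_prem[OF l] by (auto simp: para_weight_def)
    then show ?thesis using False index_constraint_not_paragraph[of l I] by simp
  qed
  then show ?thesis by (auto simp: indexing_def)
qed

lemma conclusions_add_link:
  assumes "prems l \<subseteq> conclusions N" "concs l \<inter> edges N = {}"
  shows "conclusions (add_link l N) = concs l \<union> (conclusions N - prems l)"
proof -
  have sets: "(P \<union> Q \<union> E) - (P \<union> U) = Q \<union> (E - U - P)"
    if "P \<subseteq> E - U" "Q \<inter> E = {}" "U \<subseteq> E" for P Q E U :: "'a edge set"
    using that by blast
  have "(prems l \<union> concs l \<union> edges N) - (prems l \<union> \<Union> (prems ` links N)) =
      concs l \<union> (edges N - \<Union> (prems ` links N) - prems l)"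
    using assms by (intro sets) (auto simp: conclusions_of_def edges_of_def)
  then show ?thesis
    by (simp add: conclusions_of_def edges_of_insert)
qed

lemma par_closure_net_graph:
  "par_closure N C \<Longrightarrow> net_graph (links N) \<Longrightarrow> net_graph (links C)"
proof (induction rule: par_closure.induct)
  case (step a N b c C)
  then show ?case using net_graph_insert[of "links N" "ParLink a b c"] by simp
qed

text \<open>A par link gives its premises the index of its conclusion, and that conclusion is a
  conclusion of the extended net, where all indices agree by induction.\<close>

lemma par_closure_strong_indexing:
  "par_closure N C \<Longrightarrow> indexing C I \<Longrightarrow> strong_indexing N I"
proof (induction rule: par_closure.induct)
  case (closed N)
  then show ?case by (auto simp: strong_indexing_def)
next
  case (step a N b c C)
  let ?l = "ParLink a b c"
  have s: "strong_indexing (add_link ?l N) I" using step by blast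
  have conc: "conclusions (add_link ?l N) = {c} \<union> (conclusions N - {a, b})"
    using conclusions_add_link[of ?l N] step.hyps by simp
  have ind: "\<forall>m \<in> insert ?l (links N). index_constraint I m"
    using s unfolding strong_indexing_def indexing_def add_link_simps by (rule conjunct1)
  then have "index_constraint I ?l" by (rule bspec) (rule insertI1)
  then have ab: "I a = I c" "I b = I c"
    unfolding index_constraint.simps prems.simps concs.simps by blast+
  have "I e = I c" if "e \<in> conclusions N" for e
  proof (cases "e = a \<or> e = b")
    case True
    then show ?thesis using ab by auto
  next
    case False
    then have "e \<in> conclusions (add_link ?l N)" "c \<in> conclusions (add_link ?l N)"
      unfolding conc using that by simp_all
    then show ?thesis using s unfolding strong_indexing_def by blast
  qed
  then show ?case
    using ind unfolding strong_indexing_def indexing_def by (metis insertI2)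
qed

text \<open>Each par link merges two conclusions into one, whose fresh edge receives their common
  index. The conclusions must be free of flat formulas for the par link to be typed.\<close>

lemma par_closure_exists:
  assumes "net_graph (links N)" "flat_free_conclusions N" "strong_indexing N I"
  shows "\<exists>C J. par_closure N C \<and> indexing C J"
  using assms
proof (induction "card (conclusions N)" arbitrary: N I rule: less_induct)
  case less
  show ?case
  proof (cases "\<forall>e\<in>conclusions N. \<forall>e'\<in>conclusions N. e = e'")
    case True
    then show ?thesis
      using par_closure.closed less.prems(3) unfolding strong_indexing_def by blast
  next
    case False
    then obtain a b where ab: "a \<in> conclusions N" "b \<in> conclusions N" "a \<noteq> b" by blast
    obtain A B where AB: "label a = Formula A" "label b = Formula B"
      using less.prems(2) ab unfolding flat_free_conclusions_def by blast
    have fin: "finite (edges N)" by (rule net_graph_finite_edges[OF less.prems(1)])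
    \<comment> \<open>A new identifier makes the edge new whatever its label.\<close>
    obtain n where n: "n \<notin> edge_id ` edges N"
      using ex_new_if_finite[OF infinite_UNIV_nat finite_imageI[OF fin]] by blast
    define c where "c = Edge n (Formula (Par A B))"
    let ?l = "ParLink a b c" and ?I = "I(c := I a)"
    have c: "c \<notin> edges N" using n by (force simp: c_def)
    have wt: "typed ?l" using AB ab(3) by (simp add: c_def)
    have conc: "conclusions (add_link ?l N) = {c} \<union> (conclusions N - {a, b})"
      using conclusions_add_link[of ?l N] ab c by simp
    have sub: "conclusions N \<subseteq> edges N" by (auto simp: conclusions_of_iff)
    have net: "net_graph (links (add_link ?l N))"
      using net_graph_insert[OF less.prems(1) wt] ab c by simp
    have ff: "flat_free_conclusions (add_link ?l N)"
      using less.prems(2) unfolding flat_free_conclusions_def conc by (auto simp: c_def)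
    have card: "card (conclusions (add_link ?l N)) < card (conclusions N)"
    proof -
      have f: "finite (conclusions N)" using sub fin finite_subset by blast
      have "card (conclusions N - {a, b}) = card (conclusions N) - 2"
        using ab by (subst card_Diff_subset) auto
      moreover have "card {a, b} \<le> card (conclusions N)"
        using ab f by (intro card_mono) auto
      moreover have "card (conclusions (add_link ?l N)) \<le> Suc (card (conclusions N - {a, b}))"
        unfolding conc by (simp add: card_insert_le_m1 f card_insert_if)
      ultimately show ?thesis using ab(3) by simp
    qed
    have I: "indexing N I" "\<And>e e'. e \<in> conclusions N \<Longrightarrow> e' \<in> conclusions N \<Longrightarrow> I e = I e'"
      using less.prems(3) unfolding strong_indexing_def by blast+
    have same: "?I e = I e" if "e \<in> edges N" for e using that c by auto
    have "index_constraint ?I m" if m: "m \<in> links N" for m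
    proof -
      have "?I e = I e" if "e \<in> prems m \<union> concs m" for e
        using that same[of e] edges_ofI(1)[OF m, of e] edges_ofI(2)[OF m, of e] by (metis UnE)
      then have "index_constraint ?I m \<longleftrightarrow> index_constraint I m" by (rule index_constraint_cong)
      then show ?thesis using bspec[OF I(1)[unfolded indexing_def] m] by simp
    qed
    moreover have "index_constraint ?I ?l"
    proof -
      have "?I a = I a" "?I b = I a" "?I c = I a"
        using I(2)[OF ab(2,1)] same[of a] same[of b] ab(1,2) sub by auto
      then show ?thesis by simp
    qed
    ultimately have ind: "indexing (add_link ?l N) ?I"
      unfolding indexing_def add_link_simps by (metis insertE)
    have "?I e = I a" if "e \<in> conclusions (add_link ?l N)" for e
      using that I(2)[of e a] ab(1) unfolding conc by auto
    then have "strong_indexing (add_link ?l N) ?I"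
      using ind unfolding strong_indexing_def by metis
    from less.hyps[OF card net ff this]
    obtain C J where "par_closure (add_link ?l N) C" "indexing C J" by blast
    then show ?thesis using par_closure.step[OF ab(1,2) c wt] by blast
  qed
qed

text \<open>A proof net asks for some closure with balanced cycles. Left to right, the closure that
  carries an indexing will do; right to left, whichever closure is given, an indexing of it is a
  strong indexing of \<open>N\<close>.\<close>

theorem mainTheorem11:
  fixes N :: "'a net"
  assumes "is_net N" and "flat_free_conclusions N"
  shows "(strongly_indexable N \<and> sequentializable N) \<longleftrightarrow> proof_net N"
proof
  assume *: "strongly_indexable N \<and> sequentializable N"
  then obtain I where "strong_indexing N I" by (auto simp: strongly_indexable_def)
  then obtain C J where "par_closure N C" "indexing C J"
    using par_closure_exists[OF is_netD(1)[OF assms(1)] assms(2)] by blast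
  moreover have "DR_correct N" using sequentializable_imp_DR_correct * by blast
  ultimately show "proof_net N"
    using assms indexing_imp_balanced unfolding proof_net_def DR_net_def by blast
next
  assume "proof_net N"
  then obtain C where N: "DR_correct N" and C: "par_closure N C"
    and bal: "\<forall>p. cycle (underlying_graph C) p \<longrightarrow> balanced p"
    unfolding proof_net_def DR_net_def by blast
  have "net_graph (links C)"
    by (rule par_closure_net_graph[OF C is_netD(1)[OF assms(1)]])
  then obtain I where "indexing C I" using balanced_imp_indexable bal by metis
  then have "strongly_indexable N"
    using par_closure_strong_indexing[OF C] unfolding strongly_indexable_def by blast
  then show "strongly_indexable N \<and> sequentializable N"
    using DR_correct_imp_sequentializable[OF assms(1) N] by blast
qed

end
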